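(* Let $n\ge1$ and $0\le i\le n-1$. The set $\{\bar c(T,\sigma):(T,\sigma)\in\mathsf{Lyn}^2_{n,i}\}$ is a basis for $\tilde H^{n-3}((\hat 0,[n]^i))$ (with coefficients in $\mathbb Z$ or an arbitrary field), and the set $\{[T,\sigma]:(T,\sigma)\in\mathsf{Lyn}^2_{n,i}\}$ is a basis for $\mathcal{L}ie_2(n,i)$ (over an arbitrary field), where $\mathsf{Lyn}^2_{n,i}$ is the set of bicolored Lyndon trees with leaf label set $[n]$ and $i$ red internal nodes.
   Context: Poset. Let $[n]=\{1,\dots,n\}$. A weighted partition of $[n]$ is a set $\{B_1^{v_1},\dots,B_t^{v_t}\}$ where $\{B_1,\dots,B_t\}$ is a partition of $[n]$ and $v_i\in\{0,1,\dots,|B_i|-1\}$. The poset $\Pi_n^w$ is the set of weighted partitions of $[n]$ ordered by: $\{A_1^{w_1},\dots,A_s^{w_s}\}\le\{B_1^{v_1},\dots,B_t^{v_t}\}$ iff $\{A_j\}$ refines $\{B_k\}$ and whenever $B_k=A_{i_1}\cup\cdots\cup A_{i_l}$, then $v_k-(w_{i_1}+\cdots+w_{i_l})\in\{0,\dots,l-1\}$. Its minimum is $\hat 0=\{\{1\}^0,\dots,\{n\}^0\}$ and its maximal elements are $[n]^i:=\{[n]^i\}$, $0\le i\le n-1$. Cohomology. For a finite poset $P$ and coefficient ring $\mathbf k$, the reduced cochain module $C_r(P)$ is the free $\mathbf k$-module on chains $\alpha_0<\cdots<\alpha_r$ ($C_{-1}$ is spanned by the empty chain), with $\delta_r(\alpha_0<\cdots<\alpha_r)=\sum_{i=0}^{r+1}(-1)^i\sum_{\alpha\in(\alpha_{i-1},\alpha_i)}(\alpha_0<\cdots<\alpha_{i-1}<\alpha<\alpha_i<\cdots<\alpha_r)$,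 where $\alpha_{-1},\alpha_{r+1}$ are an adjoined minimum and maximum; $\tilde H^r(P)=\ker\delta_r/\operatorname{im}\delta_{r-1}$. Maximal chains are identified with their classes in top cohomology. For a degenerate interval, $\tilde H^r((x,x))=\mathbf k$ if $r=-2$ and $0$ otherwise. Lie side. Two Lie brackets $[\cdot,\cdot]$ (blue) and $\langle\cdot,\cdot\rangle$ (red) on one vector space are compatible if every linear combination is a Lie bracket; equivalently $[x,\langle y,z\rangle]+[z,\langle x,y\rangle]+[y,\langle z,x\rangle]+\langle x,[y,z]\rangle+\langle z,[x,y]\rangle+\langle y,[z,x]\rangle=0$ (mixed Jacobi). $\mathcal{L}ie_2(n)$ is the multilinear component (spanned by bracketings containing each element of $[n]$ exactly once) of the free Lie algebra on $[n]$ with two compatible brackets, i.e. subject only to antisymmetry and Jacobi for each bracket and mixed Jacobi. $\mathcal{L}ie_2(n,i)$ is the subspace generated by such bracketings with exactly $i$ red and $n-1-i$ blue brackets. Trees. A bicolored binary tree is a complete plane binary tree (every internal node has a left child and a right child) with each internal node colored red or blue. $\mathcal{BT}_{n,i}$ is the set of pairs $(T,\sigma)$ with $T$ a bicolored binary tree with $n$ leaves and $i$ red internal nodes and $\sigma\in\mathfrak S_n$, the $j$th leaf from left to right being labeled $\sigma(j)$. $[T,\sigma]$ is the leaf's label if $T$ is a single leaf; otherwise, with left and right labeled subtrees $(T_1,\sigma_1),(T_2,\sigma_2)$, it is the blue bracket $[[T_1,\sigma_1],[T_2,\sigma_2]]$ if the root is blue and the red bracket $\langle[T_1,\sigma_1],[T_2,\sigma_2]\rangle$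 if the root is red. A tree is normalized if the leftmost leaf of each subtree (rooted at any node) has the smallest label in that subtree. $L(x),R(x)$ are the left and right children of an internal node $x$; the valency $v(x)$ of a node $x$ is the smallest leaf label of the subtree rooted at $x$. An internal node $x$ is a Lyndon node if $v(R(L(x)))>v(R(x))$; the condition is regarded as satisfied when $L(x)$ is a leaf. A bicolored Lyndon tree is a normalized tree such that every internal node $x$ that is not a Lyndon node is colored blue and its left child is colored red. $\mathsf{Lyn}^2_{n,i}$ is the set of bicolored Lyndon trees in $\mathcal{BT}_{n,i}$. Chains. Put $u(\text{blue})=0$, $u(\text{red})=1$; to $u$-merge two blocks $A^a,B^b$ means to replace them by $(A\cup B)^{a+b+u}$. Postorder lists the internal nodes of the left subtree (recursively), then those of the right subtree, then the root. $c(T,\sigma)$ is the maximal chain of $[\hat 0,[n]^i]$ starting at $\hat 0$ whose rank $k$ element is obtained from its rank $k-1$ element by $u(\mathrm{col}_k)$-merging the blocks whose underlying sets are the leaf label sets of the left and right subtrees of the $k$th internal node in postorder, $\mathrm{col}_k$ being its color. $\bar c(T,\sigma)=c(T,\sigma)\setminus\{\hat 0,[n]^i\}$ (for $n=1$, read as the generator of $\tilde H^{-2}$). *)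

theory Defs
  imports
    Jordan_Normal_Form.VS_Connect
    "HOL-Algebra.AbelCoset"
    "HOL-Library.Poly_Mapping"
    "HOL-Library.Disjoint_Sets"
begin

section \<open>Free modules, quotient modules and bases\<close>

text \<open>
  Coefficients come from a type class, turned into a ring record by \<open>class_ring\<close>. As usual for
  module records in HOL-Algebra, the fields \<open>mult\<close> and \<open>one\<close> carry no meaning.
\<close>

definition pm_scale :: "'k::comm_ring_1 \<Rightarrow> ('a \<Rightarrow>\<^sub>0 'k) \<Rightarrow> ('a \<Rightarrow>\<^sub>0 'k)" where
  "pm_scale c f = Poly_Mapping.map (\<lambda>x. c * x) f"

definition free_module :: "'a set \<Rightarrow> ('k::comm_ring_1, 'a \<Rightarrow>\<^sub>0 'k) module" where
  "free_module A =
     \<lparr>carrier = {f. Poly_Mapping.keys f \<subseteq> A}, mult = undefined, one = undefined,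
      zero = 0, add = (+), smult = pm_scale\<rparr>"

definition quotient_module :: "('k, 'v) module \<Rightarrow> 'v set \<Rightarrow> ('k, 'v set) module" where
  "quotient_module M N =
     \<lparr>carrier = a_rcosets\<^bsub>M\<^esub> N, mult = undefined, one = undefined,
      zero = N, add = set_add M,
      smult = (\<lambda>c X. \<Union>x\<in>X. N +>\<^bsub>M\<^esub> (c \<odot>\<^bsub>M\<^esub> x))\<rparr>"

definition module_basis :: "'k ring \<Rightarrow> ('k, 'v) module \<Rightarrow> 'v set \<Rightarrow> bool" where
  "module_basis R M B \<longleftrightarrow>
     Module.module R M \<and> B \<subseteq> carrier M \<and>
     \<not> LinearCombinations.module.lin_dep R M B \<and>
     LinearCombinations.module.span R M B = carrier M"


section \<open>Reduced cohomology of finite posets\<close>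

text \<open>
  A poset is given by its ground set \<open>P\<close> and its strict order \<open>lt\<close>; a chain is listed in
  increasing order. Degrees are integers: there is exactly one chain in degree \<open>-1\<close>, the empty
  one, and none in degrees below.
\<close>

definition chains :: "'a set \<Rightarrow> ('a \<Rightarrow> 'a \<Rightarrow> bool) \<Rightarrow> int \<Rightarrow> 'a list set" where
  "chains P lt r = {xs. set xs \<subseteq> P \<and> sorted_wrt lt xs \<and> int (length xs) = r + 1}"

text \<open>
  In \<open>coboundary_chain\<close>, \<open>xs\<close> is \<open>\<alpha>\<^sub>0 < \<dots> < \<alpha>\<^sub>r\<close> and \<open>\<alpha>\<close> ranges over the open interval
  \<open>(\<alpha>\<^sub>i\<^sub>-\<^sub>1, \<alpha>\<^sub>i)\<close>; for \<open>i = 0\<close> and \<open>i = r + 1 = length xs\<close> the missing bound is the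
  adjoined minimum or maximum.
\<close>

definition coboundary_chain ::
    "'a set \<Rightarrow> ('a \<Rightarrow> 'a \<Rightarrow> bool) \<Rightarrow> 'a list \<Rightarrow> ('a list \<Rightarrow>\<^sub>0 'k::comm_ring_1)" where
  "coboundary_chain P lt xs =
     (\<Sum>i = 0..length xs.
        \<Sum>\<alpha> | \<alpha> \<in> P \<and> (0 < i \<longrightarrow> lt (xs ! (i - 1)) \<alpha>) \<and> (i < length xs \<longrightarrow> lt \<alpha> (xs ! i)).
          Poly_Mapping.single (take i xs @ \<alpha> # drop i xs) ((-1) ^ i))"

definition coboundary ::
    "'a set \<Rightarrow> ('a \<Rightarrow> 'a \<Rightarrow> bool) \<Rightarrow> ('a list \<Rightarrow>\<^sub>0 'k::comm_ring_1) \<Rightarrow> ('a list \<Rightarrow>\<^sub>0 'k)" where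
  "coboundary P lt f =
     (\<Sum>xs \<in> Poly_Mapping.keys f. pm_scale (Poly_Mapping.lookup f xs) (coboundary_chain P lt xs))"

definition cochains ::
    "'a set \<Rightarrow> ('a \<Rightarrow> 'a \<Rightarrow> bool) \<Rightarrow> int \<Rightarrow> ('k::comm_ring_1, 'a list \<Rightarrow>\<^sub>0 'k) module" where
  "cochains P lt r = free_module (chains P lt r)"

definition cocycles ::
    "'a set \<Rightarrow> ('a \<Rightarrow> 'a \<Rightarrow> bool) \<Rightarrow> int \<Rightarrow> ('a list \<Rightarrow>\<^sub>0 'k::comm_ring_1) set" where
  "cocycles P lt r = {f \<in> carrier (cochains P lt r). coboundary P lt f = 0}"

definition coboundaries ::
    "'a set \<Rightarrow> ('a \<Rightarrow> 'a \<Rightarrow> bool) \<Rightarrow> int \<Rightarrow> ('a list \<Rightarrow>\<^sub>0 'k::comm_ring_1) set" where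
  "coboundaries P lt r = coboundary P lt ` carrier (cochains P lt (r - 1))"

definition open_interval :: "'a set \<Rightarrow> ('a \<Rightarrow> 'a \<Rightarrow> bool) \<Rightarrow> 'a \<Rightarrow> 'a \<Rightarrow> 'a set" where
  "open_interval P lt x y = {z \<in> P. lt x z \<and> lt z y}"

text \<open>
  The interval versions add the convention that \<open>(x, x)\<close> has the coefficient ring as cohomology in
  degree \<open>-2\<close>, generated by the class of the empty list, and \<open>0\<close> in all other degrees.
\<close>

definition interval_cochains ::
    "'a set \<Rightarrow> ('a \<Rightarrow> 'a \<Rightarrow> bool) \<Rightarrow> 'a \<Rightarrow> 'a \<Rightarrow> int \<Rightarrow> ('k::comm_ring_1, 'a list \<Rightarrow>\<^sub>0 'k) module"
where
  "interval_cochains P lt x y r =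
     (if x = y then free_module (if r = -2 then {[]} else {})
      else cochains (open_interval P lt x y) lt r)"

definition interval_cocycles ::
    "'a set \<Rightarrow> ('a \<Rightarrow> 'a \<Rightarrow> bool) \<Rightarrow> 'a \<Rightarrow> 'a \<Rightarrow> int \<Rightarrow> ('a list \<Rightarrow>\<^sub>0 'k::comm_ring_1) set"
where
  "interval_cocycles P lt x y r =
     (if x = y then carrier (interval_cochains P lt x y r)
      else cocycles (open_interval P lt x y) lt r)"

definition interval_coboundaries ::
    "'a set \<Rightarrow> ('a \<Rightarrow> 'a \<Rightarrow> bool) \<Rightarrow> 'a \<Rightarrow> 'a \<Rightarrow> int \<Rightarrow> ('a list \<Rightarrow>\<^sub>0 'k::comm_ring_1) set"
where
  "interval_coboundaries P lt x y r =
     (if x = y then {0} else coboundaries (open_interval P lt x y) lt r)"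

definition interval_cohomology ::
    "'a set \<Rightarrow> ('a \<Rightarrow> 'a \<Rightarrow> bool) \<Rightarrow> 'a \<Rightarrow> 'a \<Rightarrow> int
      \<Rightarrow> ('k::comm_ring_1, ('a list \<Rightarrow>\<^sub>0 'k) set) module"
where
  "interval_cohomology P lt x y r =
     quotient_module ((interval_cochains P lt x y r)\<lparr>carrier := interval_cocycles P lt x y r\<rparr>)
       (interval_coboundaries P lt x y r)"

definition chain_class ::
    "'a set \<Rightarrow> ('a \<Rightarrow> 'a \<Rightarrow> bool) \<Rightarrow> 'a \<Rightarrow> 'a \<Rightarrow> int \<Rightarrow> 'a list \<Rightarrow> ('a list \<Rightarrow>\<^sub>0 'k::comm_ring_1) set"
where
  "chain_class P lt x y r xs =
     interval_coboundaries P lt x y r +>\<^bsub>interval_cochains P lt x y r\<^esub> Poly_Mapping.single xs 1"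


section \<open>The poset of weighted partitions\<close>

text \<open>The weighted block \<open>B\<^sup>v\<close> is the pair \<open>(B, v)\<close>.\<close>

type_synonym wpartition = "(nat set \<times> nat) set"

definition weighted_partitions :: "nat \<Rightarrow> wpartition set" where
  "weighted_partitions n =
     {\<alpha>. partition_on {1..n} (fst ` \<alpha>) \<and> inj_on fst \<alpha> \<and> (\<forall>(B, v) \<in> \<alpha>. v \<le> card B - 1)}"

definition blocks_in :: "wpartition \<Rightarrow> nat set \<Rightarrow> wpartition" where
  "blocks_in \<alpha> B = {(A, w) \<in> \<alpha>. A \<subseteq> B}"

definition wp_le :: "nat \<Rightarrow> wpartition \<Rightarrow> wpartition \<Rightarrow> bool" where
  "wp_le n \<alpha> \<beta> \<longleftrightarrow>
     refines {1..n} (fst ` \<alpha>) (fst ` \<beta>) \<and>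
     (\<forall>(B, v) \<in> \<beta>. int v - (\<Sum>(A, w) \<in> blocks_in \<alpha> B. int w)
                    \<in> {0..int (card (blocks_in \<alpha> B)) - 1})"

definition wp_less :: "nat \<Rightarrow> wpartition \<Rightarrow> wpartition \<Rightarrow> bool" where
  "wp_less n \<alpha> \<beta> \<longleftrightarrow> wp_le n \<alpha> \<beta> \<and> \<alpha> \<noteq> \<beta>"

definition wp_bot :: "nat \<Rightarrow> wpartition" where
  "wp_bot n = (\<lambda>j. ({j}, 0)) ` {1..n}"

definition wp_top :: "nat \<Rightarrow> nat \<Rightarrow> wpartition" where
  "wp_top n i = {({1..n}, i)}"


section \<open>Bicolored binary trees and Lyndon trees\<close>

datatype color = Blue | Red

text \<open>
  A pair \<open>(T, \<sigma>)\<close> of a plane tree and a permutation is the plane tree whose leaves carry the labels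
  \<open>\<sigma>(1), \<dots>, \<sigma>(n)\<close> from left to right. The same type serves for the bracketings.
\<close>

datatype ltree = Leaf nat | Node color ltree ltree

fun leaf_labels :: "ltree \<Rightarrow> nat list" where
  "leaf_labels (Leaf a) = [a]"
| "leaf_labels (Node c l r) = leaf_labels l @ leaf_labels r"

fun red_count :: "ltree \<Rightarrow> nat" where
  "red_count (Leaf a) = 0"
| "red_count (Node c l r) = (if c = Red then 1 else 0) + red_count l + red_count r"

fun subtrees :: "ltree \<Rightarrow> ltree set" where
  "subtrees (Leaf a) = {Leaf a}"
| "subtrees (Node c l r) = insert (Node c l r) (subtrees l \<union> subtrees r)"

definition bicolored_trees :: "nat \<Rightarrow> nat \<Rightarrow> ltree set" where
  "bicolored_trees n i =
     {T. distinct (leaf_labels T) \<and> set (leaf_labels T) = {1..n} \<and> red_count T = i}"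

definition valency :: "ltree \<Rightarrow> nat" where
  "valency T = Min (set (leaf_labels T))"

definition normalized :: "ltree \<Rightarrow> bool" where
  "normalized T \<longleftrightarrow> (\<forall>S \<in> subtrees T. hd (leaf_labels S) = Min (set (leaf_labels S)))"

text \<open>An internal node is represented by the subtree \<open>Node c l r\<close> rooted at it.\<close>

fun lyndon_node :: "ltree \<Rightarrow> ltree \<Rightarrow> bool" where
  "lyndon_node (Leaf a) r \<longleftrightarrow> True"
| "lyndon_node (Node c l1 l2) r \<longleftrightarrow> valency l2 > valency r"

definition bicolored_lyndon :: "ltree \<Rightarrow> bool" where
  "bicolored_lyndon T \<longleftrightarrow>
     normalized T \<and>
     (\<forall>c l r. Node c l r \<in> subtrees T \<and> \<not> lyndon_node l r \<longrightarrow>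
        c = Blue \<and> (\<exists>l1 l2. l = Node Red l1 l2))"

definition lyndon_trees :: "nat \<Rightarrow> nat \<Rightarrow> ltree set" where
  "lyndon_trees n i = {T \<in> bicolored_trees n i. bicolored_lyndon T}"


section \<open>The maximal chain of a tree\<close>

text \<open>
  An internal node is listed with its color and the leaf label sets of its left and right subtrees.
\<close>

fun postorder :: "ltree \<Rightarrow> (color \<times> nat set \<times> nat set) list" where
  "postorder (Leaf a) = []"
| "postorder (Node c l r) =
     postorder l @ postorder r @ [(c, set (leaf_labels l), set (leaf_labels r))]"

fun color_weight :: "color \<Rightarrow> nat" where
  "color_weight Blue = 0"
| "color_weight Red = 1"

definition merge :: "nat \<Rightarrow> nat set \<Rightarrow> nat set \<Rightarrow> wpartition \<Rightarrow> wpartition" where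
  "merge u A B \<alpha> =
     {(C, w) \<in> \<alpha>. C \<noteq> A \<and> C \<noteq> B} \<union>
     {(A \<union> B, a + b + u) | a b. (A, a) \<in> \<alpha> \<and> (B, b) \<in> \<alpha>}"

fun merge_chain :: "wpartition \<Rightarrow> (color \<times> nat set \<times> nat set) list \<Rightarrow> wpartition list" where
  "merge_chain \<alpha> [] = [\<alpha>]"
| "merge_chain \<alpha> ((c, A, B) # xs) = \<alpha> # merge_chain (merge (color_weight c) A B \<alpha>) xs"

definition tree_chain :: "nat \<Rightarrow> ltree \<Rightarrow> wpartition list" where
  "tree_chain n T = merge_chain (wp_bot n) (postorder T)"

definition proper_tree_chain :: "nat \<Rightarrow> nat \<Rightarrow> ltree \<Rightarrow> wpartition list" where
  "proper_tree_chain n i T =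
     filter (\<lambda>\<alpha>. \<alpha> \<noteq> wp_bot n \<and> \<alpha> \<noteq> wp_top n i) (tree_chain n T)"

text \<open>
  \<open>\<tilde>H\<^sup>r((\<zero>, [n]\<^sup>i))\<close> in the poset of weighted partitions, and the class of \<open>c(T, \<sigma>)\<close> without its
  two ends, in degree \<open>n - 3\<close>. For \<open>n = 1\<close> the two ends coincide and the remaining list is empty.
\<close>

definition wp_cohomology ::
    "nat \<Rightarrow> nat \<Rightarrow> int \<Rightarrow> ('k::comm_ring_1, (wpartition list \<Rightarrow>\<^sub>0 'k) set) module" where
  "wp_cohomology n i r =
     interval_cohomology (weighted_partitions n) (wp_less n) (wp_bot n) (wp_top n i) r"

definition tree_chain_class ::
    "nat \<Rightarrow> nat \<Rightarrow> ltree \<Rightarrow> (wpartition list \<Rightarrow>\<^sub>0 'k::comm_ring_1) set" where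
  "tree_chain_class n i T =
     chain_class (weighted_partitions n) (wp_less n) (wp_bot n) (wp_top n i) (int n - 3)
       (proper_tree_chain n i T)"


section \<open>The free Lie algebra with two compatible brackets\<close>

text \<open>
  \<open>free_alg n\<close> is the free nonassociative algebra on \<open>{1..n}\<close> with two bilinear operations: its
  monomials are all bracketings (repeated letters allowed), and \<open>bracket c\<close> extends \<open>Node c\<close>
  bilinearly.
\<close>

definition free_alg :: "nat \<Rightarrow> ('k::comm_ring_1, ltree \<Rightarrow>\<^sub>0 'k) module" where
  "free_alg n = free_module {T. set (leaf_labels T) \<subseteq> {1..n}}"

definition bracket ::
    "color \<Rightarrow> (ltree \<Rightarrow>\<^sub>0 'k::comm_ring_1) \<Rightarrow> (ltree \<Rightarrow>\<^sub>0 'k) \<Rightarrow> (ltree \<Rightarrow>\<^sub>0 'k)" where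
  "bracket c x y =
     (\<Sum>s \<in> Poly_Mapping.keys x. \<Sum>t \<in> Poly_Mapping.keys y.
        Poly_Mapping.single (Node c s t) (Poly_Mapping.lookup x s * Poly_Mapping.lookup y t))"

text \<open>
  The two-sided ideal of relations. Antisymmetry is imposed in the form \<open>[x, x] = 0\<close>, which gives
  \<open>[x, y] = - [y, x]\<close> by polarization and is the correct axiom in characteristic 2 as well.
\<close>

inductive_set lie2_ideal :: "nat \<Rightarrow> (ltree \<Rightarrow>\<^sub>0 'k::comm_ring_1) set" for n :: nat where
  zero: "0 \<in> lie2_ideal n"
| add: "a \<in> lie2_ideal n \<Longrightarrow> b \<in> lie2_ideal n \<Longrightarrow> a + b \<in> lie2_ideal n"
| scale: "a \<in> lie2_ideal n \<Longrightarrow> pm_scale k a \<in> lie2_ideal n"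
| left: "a \<in> lie2_ideal n \<Longrightarrow> x \<in> carrier (free_alg n) \<Longrightarrow> bracket c x a \<in> lie2_ideal n"
| right: "a \<in> lie2_ideal n \<Longrightarrow> x \<in> carrier (free_alg n) \<Longrightarrow> bracket c a x \<in> lie2_ideal n"
| alternating: "x \<in> carrier (free_alg n) \<Longrightarrow> bracket c x x \<in> lie2_ideal n"
| jacobi:
    "x \<in> carrier (free_alg n) \<Longrightarrow> y \<in> carrier (free_alg n) \<Longrightarrow> z \<in> carrier (free_alg n) \<Longrightarrow>
     bracket c x (bracket c y z) + bracket c z (bracket c x y) + bracket c y (bracket c z x)
       \<in> lie2_ideal n"
| mixed_jacobi:
    "x \<in> carrier (free_alg n) \<Longrightarrow> y \<in> carrier (free_alg n) \<Longrightarrow> z \<in> carrier (free_alg n) \<Longrightarrow>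
     bracket Blue x (bracket Red y z) + bracket Blue z (bracket Red x y)
       + bracket Blue y (bracket Red z x)
       + bracket Red x (bracket Blue y z) + bracket Red z (bracket Blue x y)
       + bracket Red y (bracket Blue z x) \<in> lie2_ideal n"

definition free_lie2 :: "nat \<Rightarrow> ('k::comm_ring_1, (ltree \<Rightarrow>\<^sub>0 'k) set) module" where
  "free_lie2 n = quotient_module (free_alg n) (lie2_ideal n)"

fun tree_bracket :: "ltree \<Rightarrow> (ltree \<Rightarrow>\<^sub>0 'k::comm_ring_1)" where
  "tree_bracket (Leaf a) = Poly_Mapping.single (Leaf a) 1"
| "tree_bracket (Node c l r) = bracket c (tree_bracket l) (tree_bracket r)"

definition tree_bracket_class :: "nat \<Rightarrow> ltree \<Rightarrow> (ltree \<Rightarrow>\<^sub>0 'k::comm_ring_1) set" where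
  "tree_bracket_class n T = lie2_ideal n +>\<^bsub>free_alg n\<^esub> tree_bracket T"

text \<open>
  \<open>Lie\<^sub>2(n, i)\<close>. A bracketing using each element of \<open>{1..n}\<close> once has \<open>n - 1\<close> brackets, so \<open>i\<close> red
  ones leave \<open>n - 1 - i\<close> blue ones.
\<close>

definition lie2 :: "nat \<Rightarrow> nat \<Rightarrow> ('k::comm_ring_1, (ltree \<Rightarrow>\<^sub>0 'k) set) module" where
  "lie2 n i = (free_lie2 n)
     \<lparr>carrier := LinearCombinations.module.span class_ring (free_lie2 n)
        (tree_bracket_class n ` bicolored_trees n i)\<rparr>"

end

theory Submission
  imports Defs 
begin

text \<open>
  Bracketings modulo the Jacobi identities and maximal chains modulo coboundaries satisfy the same
  relations: in a gap of two ranks of a maximal chain, merges of disjoint blocks can be exchanged,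
  and the ways to join three blocks with a given total weight correspond to the terms of the
  (mixed) Jacobi identity. Rewriting by these relations reduces every tree to Lyndon trees.

  Independence needs no dimension count. A Lyndon tree \<open>T\<close> on \<open>[n]\<close> is turned into a colored graph
  with \<open>n - 1\<close> edges, the edges of a rooted word. It defines a functional on bracketings (a signed
  product over the internal nodes of the number of edges of the node's color between the two
  subtrees) and one on maximal chains (a signed count of the orders of contracting the edges that
  produce the chain). If one of them does not vanish at a Lyndon tree \<open>S\<close>, every node of \<open>S\<close> is
  crossed by an edge of \<open>T\<close> of its color; this forces the word of \<open>S\<close> to be at most that of \<open>T\<close> in
  a fixed linear order, so the functionals form a unitriangular system over every commutative ring.
\<close>

text \<open>The words generalize Lyndon words: a blue node concatenates the words of its subtrees, a
  red node hangs the word of its right subtree as a branch on the last letter of the left one.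
  Branches are unordered, since in a Lyndon tree the order of successive red attachments can be read
  off from their heads. The comparison of words is built so that, among all ways of attaching one
  word to another with a given color, attaching at the end gives the least result; replacing an
  arbitrary splitting of a word along a tree by the word of that tree can then only decrease it.
  Crossing all nodes of a tree is so strong a condition because of a count: n - 1 edges must serve n
  - 1 nodes, so each node gets exactly one. Coefficients may lie in any commutative ring, so
  sign-reversing sums are cancelled in disjoint pairs instead of being shown equal to their own
  negatives. Straightening is phrased for a predicate on trees rather than for vectors, so that
  bracketings and chains share one termination argument.\<close>

section \<open>Rooted words and their order\<close>

datatype rword = RW (head: nat) (branches: "rword multiset") (tail: "rword option")

primrec labels :: "rword \<Rightarrow> nat multiset" where
  "labels (RW a E w) = add_mset a (\<Sum>\<^sub># (image_mset labels E) +
     (case map_option labels w of None \<Rightarrow> {#} | Some M \<Rightarrow> M))"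

primrec edges :: "rword \<Rightarrow> (color \<times> nat \<times> nat) set" where
  "edges (RW a E w) = (\<lambda>x. (Red, a, head x)) ` set_mset E \<union> \<Union> (set_mset (image_mset edges E)) \<union>
     (case w of None \<Rightarrow> {} | Some x \<Rightarrow> {(Blue, a, head x)}) \<union>
     (case map_option edges w of None \<Rightarrow> {} | Some G \<Rightarrow> G)"

definition branch_size :: "rword multiset \<Rightarrow> nat" where
  "branch_size E = (\<Sum>x\<in>#E. size (labels x))"

lemma branch_size_simps [simp]:
  "branch_size {#} = 0" "branch_size (add_mset x E) = size (labels x) + branch_size E"
  by (simp_all add: branch_size_def)

definition tail_size :: "rword option \<Rightarrow> nat" where
  "tail_size w = (case w of None \<Rightarrow> 0 | Some x \<Rightarrow> size (labels x))"

text \<open>A numeral in base \<open>b\<close> with three digits per vertex: the label, the total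
  size of the branches, and a complement of their number, so that more branches give a smaller
  numeral. The branches enter through the sum of their values: a sum ignores their order, is
  strictly monotone in each branch and still fits into three digits per vertex.\<close>

primrec val :: "nat \<Rightarrow> rword \<Rightarrow> nat" where
  "val b (RW a E w) =
     ((a * b + branch_size E) * b + (branch_size E + tail_size w + 1 - size E)) * b ^ (3 * (branch_size E + tail_size w))
     + (\<Sum>\<^sub># (image_mset (val b) E) * b ^ (3 * tail_size w)
     + (case map_option (val b) w of None \<Rightarrow> 0 | Some v \<Rightarrow> v))"

definition tail_val :: "nat \<Rightarrow> rword option \<Rightarrow> nat" where
  "tail_val b w = (case w of None \<Rightarrow> 0 | Some x \<Rightarrow> val b x)"

lemma tail_simps [simp]:
  "tail_size None = 0" "tail_size (Some x) = size (labels x)"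
  "tail_val b None = 0" "tail_val b (Some x) = val b x"
  by (simp_all add: tail_size_def tail_val_def)

lemma size_labels_branches [simp]: "\<Sum>\<^sub># (image_mset size (image_mset labels E)) = branch_size E"
  by (induction E) auto

lemma val_RW:
  "val b (RW a E w) =
     ((a * b + branch_size E) * b + (branch_size E + tail_size w + 1 - size E)) * b ^ (3 * (branch_size E + tail_size w))
     + (\<Sum>\<^sub># (image_mset (val b) E) * b ^ (3 * tail_size w) + tail_val b w)"
  by (cases w) simp_all

lemma size_labels_RW: "size (labels (RW a E w)) = branch_size E + tail_size w + 1"
  by (cases w) auto

lemma size_labels_pos [simp]: "0 < size (labels W)"
  by (cases W) simp

lemma labels_nonempty [simp]: "labels W \<noteq> {#}"
  by (cases W) simp

lemma head_in_labels [simp]: "head W \<in># labels W"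
  by (cases W) simp

lemma size_le_branch_size: "size E \<le> branch_size E"
proof (induction E)
  case (add x E)
  have "Suc 0 \<le> size (labels x)" using size_labels_pos[of x] by linarith
  then show ?case using add by simp
qed simp

definition bounded :: "nat \<Rightarrow> rword \<Rightarrow> bool" where
  "bounded b W \<longleftrightarrow> (\<forall>x \<in># labels W. x < b) \<and> size (labels W) < b"

lemma bounded_branch: "bounded b (RW a E w) \<Longrightarrow> x \<in># E \<Longrightarrow> bounded b x"
  unfolding bounded_def by (auto dest!: multi_member_split)

lemma bounded_tail: "bounded b (RW a E (Some x)) \<Longrightarrow> bounded b x"
  unfolding bounded_def by auto

lemma sum_mset_less_power:
  fixes B :: nat
  assumes "\<And>x. x \<in># E \<Longrightarrow> f x < B ^ g x"
  shows "\<Sum>\<^sub># (image_mset f E) < B ^ \<Sum>\<^sub># (image_mset g E)"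
  using assms
proof (induction E)
  case (add x E)
  define X Y where "X = B ^ g x" and "Y = B ^ \<Sum>\<^sub># (image_mset g E)"
  have "f x < X" "\<Sum>\<^sub># (image_mset f E) < Y" using add by (auto simp: X_def Y_def)
  \<comment> \<open>With \<open>f x \<le> X'\<close> and the remaining sum at most
    \<open>Y'\<close>, the bound is \<open>X' + Y' < (X' + 1) * (Y' + 1)\<close>.\<close>
  moreover from this obtain X' Y' where "X = Suc X'" "Y = Suc Y'"
    by (metis less_nat_zero_code not0_implies_Suc)
  ultimately have "f x + \<Sum>\<^sub># (image_mset f E) < X * Y" by simp
  then show ?case by (simp add: X_def Y_def power_add)
qed simp

lemma lex_less_iff:
  fixes q q' r r' B :: nat
  assumes "r < B" "r' < B"
  shows "q * B + r < q' * B + r' \<longleftrightarrow> q < q' \<or> q = q' \<and> r < r'"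
proof -
  have *: "u * B + v < w * B + z" if "u < w" "v < B" for u v w z :: nat
  proof -
    have "Suc u * B \<le> w * B" using that by (intro mult_le_mono1) simp
    with that show ?thesis by simp
  qed
  show ?thesis
  proof (cases q q' rule: linorder_cases)
    case less
    then show ?thesis using *[OF less assms(1), of r'] by simp
  next
    case greater
    then show ?thesis using *[OF greater assms(2), of r] by simp
  qed auto
qed

lemma combine_less:
  fixes q r B C :: nat
  assumes "q < B" "r < C" shows "q * C + r < B * C"
proof -
  have "Suc q * C \<le> B * C" using assms by (intro mult_le_mono1) simp
  with assms show ?thesis by simp
qed

lemma branch_val_less_power:
  fixes b :: nat
  assumes "\<And>x. x \<in># E \<Longrightarrow> f x < b ^ (3 * size (labels x))"
  shows "\<Sum>\<^sub># (image_mset f E) < b ^ (3 * branch_size E)"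
proof -
  have "\<Sum>\<^sub># (image_mset (\<lambda>x. 3 * size (labels x)) E) = 3 * branch_size E"
    by (induction E) auto
  with sum_mset_less_power[of E f b "\<lambda>x. 3 * size (labels x)"] assms show ?thesis by simp
qed

lemma val_less_power: "bounded b W \<Longrightarrow> val b W < b ^ (3 * size (labels W))"
proof (induction W)
  case (RW a E w)
  have b: "a < b" "branch_size E + tail_size w + 1 < b"
    using RW.prems unfolding bounded_def size_labels_RW by auto
  have E: "\<Sum>\<^sub># (image_mset (val b) E) < b ^ (3 * branch_size E)"
    by (intro branch_val_less_power RW.IH(1) bounded_branch[OF RW.prems])
  have w: "tail_val b w < b ^ (3 * tail_size w)"
    using RW.IH(2) RW.prems by (cases w) (auto dest: bounded_tail)
  have "(a * b + branch_size E) * b + (branch_size E + tail_size w + 1 - size E) < b * b * b"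
    using b by (intro combine_less) auto
  moreover have "\<Sum>\<^sub># (image_mset (val b) E) * b ^ (3 * tail_size w) + tail_val b w
      < b ^ (3 * branch_size E) * b ^ (3 * tail_size w)"
    by (intro combine_less E w)
  ultimately have "val b (RW a E w) < b * b * b * b ^ (3 * (branch_size E + tail_size w))"
    unfolding val_RW by (intro combine_less[of _ "b * b * b"]) (auto simp: power_add distrib_left)
  also have "b * b * b * b ^ (3 * (branch_size E + tail_size w)) = b ^ (3 * size (labels (RW a E w)))"
    unfolding size_labels_RW by (simp add: distrib_left power_add power3_eq_cube ac_simps)
  finally show ?case .
qed

text \<open>The order on words compared by \<open>val\<close>: lexicographic in the first vertex, the total size of its
  branches (small first), their number (large first), and recursively branches and tail.\<close>

lemma val_less_iff:
  assumes "bounded b (RW a E w)" "bounded b (RW a' E' w')"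
    and "size (labels (RW a E w)) = size (labels (RW a' E' w'))"
  shows "val b (RW a E w) < val b (RW a' E' w') \<longleftrightarrow>
    a < a' \<or> a = a' \<and> (branch_size E < branch_size E' \<or> branch_size E = branch_size E' \<and>
     (size E > size E' \<or> size E = size E' \<and>
      (\<Sum>\<^sub># (image_mset (val b) E) < \<Sum>\<^sub># (image_mset (val b) E') \<or>
       \<Sum>\<^sub># (image_mset (val b) E) = \<Sum>\<^sub># (image_mset (val b) E') \<and> tail_val b w < tail_val b w')))"
proof -
  define s where "s = branch_size E + tail_size w"
  have s': "s = branch_size E' + tail_size w'" using assms(3) by (simp add: s_def size_labels_RW del: labels.simps)
  have E: "\<Sum>\<^sub># (image_mset (val b) E) < b ^ (3 * branch_size E)" if "bounded b (RW a E w)" for a E w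
    by (intro branch_val_less_power val_less_power bounded_branch[OF that])
  have w: "tail_val b w < b ^ (3 * tail_size w)" if "bounded b (RW a E w)" for a E w
    using that by (cases w) (auto dest: bounded_tail intro: val_less_power)
  have r: "\<Sum>\<^sub># (image_mset (val b) E) * b ^ (3 * tail_size w) + tail_val b w < b ^ (3 * (branch_size E + tail_size w))"
    if "bounded b (RW a E w)" for a E w
    using combine_less[OF E[OF that] w[OF that]] by (simp add: power_add distrib_left)
  have b: "s + 1 < b" using assms(1) unfolding bounded_def size_labels_RW s_def by simp
  \<comment> \<open>The third digit is a truncated subtraction; this bound makes it determine the
    number of branches.\<close>
  have le: "size E \<le> s" "size E' \<le> s"
    using size_le_branch_size[of E] size_le_branch_size[of E'] s' by (simp_all add: s_def)
  have "val b (RW a E w) < val b (RW a' E' w') \<longleftrightarrow>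
     (a * b + branch_size E) * b + (s + 1 - size E) < (a' * b + branch_size E') * b + (s + 1 - size E') \<or>
     (a * b + branch_size E) * b + (s + 1 - size E) = (a' * b + branch_size E') * b + (s + 1 - size E') \<and>
     \<Sum>\<^sub># (image_mset (val b) E) * b ^ (3 * tail_size w) + tail_val b w <
     \<Sum>\<^sub># (image_mset (val b) E') * b ^ (3 * tail_size w') + tail_val b w'"
    unfolding val_RW using r[OF assms(1)] r[OF assms(2)]
    unfolding s_def[symmetric] s'[symmetric] by (intro lex_less_iff) 
  also have "(a * b + branch_size E) * b + (s + 1 - size E) < (a' * b + branch_size E') * b + (s + 1 - size E') \<longleftrightarrow>
     a * b + branch_size E < a' * b + branch_size E' \<or> a * b + branch_size E = a' * b + branch_size E' \<and> size E' < size E"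
  proof -
    have "s + 1 - size E < b" "s + 1 - size E' < b" using b by auto
    moreover have "s + 1 - size E < s + 1 - size E' \<longleftrightarrow> size E' < size E" using le by linarith
    ultimately show ?thesis by (metis lex_less_iff)
  qed
  also have "(a * b + branch_size E) * b + (s + 1 - size E) = (a' * b + branch_size E') * b + (s + 1 - size E') \<longleftrightarrow>
     a * b + branch_size E = a' * b + branch_size E' \<and> size E = size E'" (is "?l = ?r \<longleftrightarrow> _")
  proof -
    have "s + 1 - size E < b" "s + 1 - size E' < b" using b by auto
    from lex_less_iff[OF this, of "a * b + branch_size E" "a' * b + branch_size E'"]
      lex_less_iff[OF this(2,1), of "a' * b + branch_size E'" "a * b + branch_size E"]
    have "?l = ?r \<longleftrightarrow> a * b + branch_size E = a' * b + branch_size E' \<and> s + 1 - size E = s + 1 - size E'"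
      by (metis nat_neq_iff)
    moreover have "s + 1 - size E = s + 1 - size E' \<longleftrightarrow> size E = size E'" using le by linarith
    ultimately show ?thesis by blast
  qed
  also have "a * b + branch_size E < a' * b + branch_size E' \<longleftrightarrow> a < a' \<or> a = a' \<and> branch_size E < branch_size E'"
    using b s' by (intro lex_less_iff) (auto simp: s_def)
  finally have *: "val b (RW a E w) < val b (RW a' E' w') \<longleftrightarrow> (((a < a' \<or> a = a' \<and> branch_size E < branch_size E') \<or>
      a * b + branch_size E = a' * b + branch_size E' \<and> size E' < size E) \<or>
     (a * b + branch_size E = a' * b + branch_size E' \<and> size E = size E') \<and>
     \<Sum>\<^sub># (image_mset (val b) E) * b ^ (3 * tail_size w) + tail_val b w
     < \<Sum>\<^sub># (image_mset (val b) E') * b ^ (3 * tail_size w') + tail_val b w')" .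
  have **: "a * b + branch_size E = a' * b + branch_size E' \<longleftrightarrow> a = a' \<and> branch_size E = branch_size E'"
  proof -
    have "branch_size E < b" "branch_size E' < b" using b s' by (auto simp: s_def)
    from lex_less_iff[OF this, of a a'] lex_less_iff[OF this(2,1), of a' a] show ?thesis by (metis nat_neq_iff)
  qed
  have "\<Sum>\<^sub># (image_mset (val b) E) * b ^ (3 * tail_size w) + tail_val b w <
     \<Sum>\<^sub># (image_mset (val b) E') * b ^ (3 * tail_size w') + tail_val b w' \<longleftrightarrow>
      (\<Sum>\<^sub># (image_mset (val b) E) < \<Sum>\<^sub># (image_mset (val b) E') \<or>
       \<Sum>\<^sub># (image_mset (val b) E) = \<Sum>\<^sub># (image_mset (val b) E') \<and> tail_val b w < tail_val b w')"
    if "branch_size E = branch_size E'"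
  proof -
    have "tail_size w = tail_size w'" using that s' by (simp add: s_def)
    with w[OF assms(1)] w[OF assms(2)] show ?thesis by (metis lex_less_iff)
  qed
  with * ** show ?thesis by blast
qed

lemma val_less_head:
  assumes "bounded b V" "bounded b W" "size (labels V) = size (labels W)" "head V < head W"
  shows "val b V < val b W"
  using assms by (cases V; cases W) (simp add: val_less_iff del: val.simps labels.simps)

section \<open>Attaching one word to another\<close>

inductive attached :: "color \<Rightarrow> rword \<Rightarrow> rword \<Rightarrow> rword \<Rightarrow> bool" where
  red: "attached Red (RW a E w) B (RW a (add_mset B E) w)"
| blue: "attached Blue (RW a E None) B (RW a E (Some B))"
| in_tail: "attached c A B W \<Longrightarrow> attached c (RW a E (Some A)) B (RW a E (Some W))"
| in_branch: "attached c A B W \<Longrightarrow> attached c (RW a (add_mset A E) w) B (RW a (add_mset W E) w)"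

fun attach_end :: "color \<Rightarrow> rword \<Rightarrow> rword \<Rightarrow> rword" where
  "attach_end c (RW a E (Some w)) B = RW a E (Some (attach_end c w B))"
| "attach_end Red (RW a E None) B = RW a (add_mset B E) None"
| "attach_end Blue (RW a E None) B = RW a E (Some B)"

lemma labels_attached: "attached c A B W \<Longrightarrow> labels W = labels A + labels B"
  by (induction rule: attached.induct) auto

lemma head_attached: "attached c A B W \<Longrightarrow> head W = head A"
  by (induction rule: attached.induct) auto

lemma attached_attach_end: "attached c A B (attach_end c A B)"
  by (induction c A B rule: attach_end.induct) (auto intro: attached.intros)

lemma labels_attach_end [simp]: "labels (attach_end c A B) = labels A + labels B"
  using labels_attached[OF attached_attach_end] .

lemma head_attach_end [simp]: "head (attach_end c A B) = head A"
  using head_attached[OF attached_attach_end] .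

text \<open>Equality of words is kept apart from the comparison of values: since the values of
  branches are added, \<open>val\<close> can agree on different words, whereas triangularity has to
  end in equality of trees.\<close>

definition weakly_less :: "nat \<Rightarrow> rword \<Rightarrow> rword \<Rightarrow> bool" where
  "weakly_less b V W \<longleftrightarrow> V = W \<or> val b V < val b W"

lemma weakly_less_trans: "weakly_less b U V \<Longrightarrow> weakly_less b V W \<Longrightarrow> weakly_less b U W"
  by (auto simp: weakly_less_def)

lemma bounded_cong: "bounded b V \<Longrightarrow> labels V = labels W \<Longrightarrow> bounded b W"
  by (simp add: bounded_def)

lemma bounded_part: "bounded b V \<Longrightarrow> labels W \<subseteq># labels V \<Longrightarrow> bounded b W"
  unfolding bounded_def using mset_subset_eqD size_mset_mono by fastforce

text \<open>This dictates the clauses of the order. An attachment before the end, or inside a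
  branch, enlarges the branches of some letter on the main path, which attaching at the end avoids.
  The exception is a red attachment inside a branch of the last letter: attaching at the end also
  puts \<open>B\<close> among the branches of that letter, with the same total size but one branch
  more. Hence larger branches must count as bigger and more branches as smaller.\<close>

lemma attach_end_le_attached:
  assumes "attached c A B W" "bounded b W"
  shows "weakly_less b (attach_end c A B) W"
  using assms
proof (induction rule: attached.induct)
  case (red a E w B)
  show ?case
  proof (cases w)
    case (Some x)
    have "bounded b (attach_end Red (RW a E w) B)"
      using red by (rule bounded_cong) (simp add: ac_simps Some)
    with red show ?thesis unfolding weakly_less_def Some attach_end.simps
      by (subst val_less_iff) (auto simp: size_labels_RW)
  qed (simp add: weakly_less_def)
next
  case (in_tail c A B W a E)
  have "weakly_less b (attach_end c A B) W" using in_tail by (auto dest: bounded_tail)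
  moreover have "bounded b (RW a E (Some (attach_end c A B)))"
    using in_tail.prems by (rule bounded_cong) (simp add: labels_attached[OF in_tail(1)])
  ultimately show ?case using in_tail.prems unfolding weakly_less_def attach_end.simps
    by (subst val_less_iff) (auto simp: size_labels_RW labels_attached[OF in_tail(1)])
next
  case (in_branch c A B W a E w)
  have l: "labels W = labels A + labels B" by (rule labels_attached) fact
  have *: "bounded b (attach_end c (RW a (add_mset A E) w) B)"
    using in_branch.prems by (rule bounded_cong) (simp add: l ac_simps)
  have "size (labels B) > 0" by simp
  with in_branch.prems * show ?case unfolding weakly_less_def
    by (cases w; cases c) (auto simp: val_less_iff size_labels_RW l simp del: val.simps)
qed (simp add: weakly_less_def)

text \<open>The main paths of \<open>A'\<close> and \<open>A\<close> may have different lengths. As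
  the sizes agree, the word that ends first has the larger branches at its last letter, so the
  comparison of \<open>A'\<close> with \<open>A\<close> is decided there or before, and attaching
  \<open>B'\<close> and \<open>B\<close> does not reverse it.\<close>

lemma attach_end_strict_mono:
  assumes "size (labels A') = size (labels A)" "size (labels B') = size (labels B)"
    and "val b A' < val b A" "val b B' \<le> val b B"
    and "bounded b (attach_end c A' B')" "bounded b (attach_end c A B)"
  shows "val b (attach_end c A' B') < val b (attach_end c A B)"
  using assms
proof (induction c A' B' arbitrary: A rule: attach_end.induct)
  case (1 c a' E' x' B')
  obtain a E w where A: "A = RW a E w" by (cases A)
  note bd = bounded_part[OF "1.prems"(5), of "RW a' E' (Some x')"] bounded_part[OF "1.prems"(6), of A]
  show ?case
  proof (cases w)
    case None
    then show ?thesis using 1 bd unfolding A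
      by (cases c) (auto simp: val_less_iff size_labels_RW simp del: val.simps)
  next
    case (Some x)
    have bx: "bounded b (attach_end c x' B')" "bounded b (attach_end c x B)"
      using "1.prems"(5,6) unfolding A Some attach_end.simps by (auto dest: bounded_tail)
    have IH: "val b (attach_end c x' B') < val b (attach_end c x B)"
      if "size (labels x') = size (labels x)" "val b x' < val b x"
      using that 1 bx by auto
    show ?thesis using "1.prems" bd IH unfolding A Some
      by (auto simp: val_less_iff size_labels_RW simp del: val.simps)
  qed
next
  case (2 a' E' B')
  obtain a E w where A: "A = RW a E w" by (cases A)
  note bd = bounded_part[OF "2.prems"(5), of "RW a' E' None"] bounded_part[OF "2.prems"(6), of A]
  from 2 bd show ?case unfolding A
    by (cases w) (auto simp: val_less_iff size_labels_RW simp del: val.simps)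
next
  case (3 a' E' B')
  obtain a E w where A: "A = RW a E w" by (cases A)
  note bd = bounded_part[OF "3.prems"(5), of "RW a' E' None"] bounded_part[OF "3.prems"(6), of A]
  from 3 bd show ?case unfolding A
    by (cases w) (auto simp: val_less_iff size_labels_RW simp del: val.simps)
qed

lemma attach_end_strict_mono2:
  assumes "size (labels B') = size (labels B)" "val b B' < val b B"
    and "bounded b (attach_end c A B')" "bounded b (attach_end c A B)"
  shows "val b (attach_end c A B') < val b (attach_end c A B)"
  using assms
proof (induction c A B' rule: attach_end.induct)
  case (1 c a E x B')
  have "bounded b (attach_end c x B')" "bounded b (attach_end c x B)"
    using "1.prems"(3,4) unfolding attach_end.simps by (auto dest: bounded_tail)
  with 1 show ?case
    by (auto simp: val_less_iff size_labels_RW simp del: val.simps)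
qed (auto simp: val_less_iff size_labels_RW simp del: val.simps)

lemma attach_end_mono:
  assumes "size (labels A') = size (labels A)" "size (labels B') = size (labels B)"
    and "weakly_less b A' A" "weakly_less b B' B"
    and "bounded b (attach_end c A' B')" "bounded b (attach_end c A B)"
  shows "weakly_less b (attach_end c A' B') (attach_end c A B)"
  using assms attach_end_strict_mono[OF assms(1,2)] attach_end_strict_mono2[OF assms(2)]
  unfolding weakly_less_def by fastforce

text \<open>For a tree with blue nodes only this is the sequence of leaf labels from left to
  right.\<close>

fun word_of :: "ltree \<Rightarrow> rword" where
  "word_of (Leaf a) = RW a {#} None"
| "word_of (Node c l r) = attach_end c (word_of l) (word_of r)"

lemma labels_word_of [simp]: "labels (word_of T) = mset (leaf_labels T)"
  by (induction T) auto

lemma head_word_of: "head (word_of T) = hd (leaf_labels T)"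
proof (induction T)
  case (Node c l r)
  have "leaf_labels l \<noteq> []" by (induction l) auto
  with Node show ?case by simp
qed simp

section \<open>Cutting a word along a tree\<close>

definition crossed :: "(color \<times> nat \<times> nat) set \<Rightarrow> color \<times> nat set \<times> nat set \<Rightarrow> bool" where
  "crossed G = (\<lambda>(c, A, B). \<exists>(d, a, b) \<in> G. d = c \<and> (a \<in> A \<and> b \<in> B \<or> a \<in> B \<and> b \<in> A))"

text \<open>Recursive form of: removing suitable edges one by one splits the word according to the tree.\<close>

fun splits_as :: "rword \<Rightarrow> ltree \<Rightarrow> bool" where
  "splits_as W (Leaf a) \<longleftrightarrow> W = RW a {#} None"
| "splits_as W (Node c l r) \<longleftrightarrow>
     (\<exists>A B. attached c A B W \<and> (splits_as A l \<and> splits_as B r \<or> splits_as A r \<and> splits_as B l))"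

lemma labels_splits_as: "splits_as W T \<Longrightarrow> labels W = mset (leaf_labels T)"
  by (induction T arbitrary: W) (auto dest!: labels_attached)

lemma leaf_labels_nonempty [simp]: "leaf_labels T \<noteq> []"
  by (induction T) auto

lemma normalized_Node:
  assumes "normalized (Node c l r)"
  shows "normalized l" "normalized r" "hd (leaf_labels l) = Min (set (leaf_labels (Node c l r)))"
  using assms unfolding normalized_def by (auto simp: hd_append)

text \<open>The label of the head is the leading digit, so a word that does not start with the least
  label is larger at once. If it does, the part containing the head belongs to the left subtree;
  both parts are replaced by the words of the subtrees by monotonicity, and the attachment is moved
  to the end.\<close>

lemma word_of_le:
  assumes "splits_as W T" "normalized T" "distinct (leaf_labels T)" "bounded b W"
  shows "weakly_less b (word_of T) W"
  using assms
proof (induction T arbitrary: W)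
  case (Leaf a)
  then show ?case by (simp add: weakly_less_def)
next
  case (Node c l r)
  let ?m = "hd (leaf_labels l)"
  note n = normalized_Node[OF Node.prems(2)]
  note lW = labels_splits_as[OF Node.prems(1)]
  have bT: "bounded b (word_of (Node c l r))"
    using Node.prems(4) by (rule bounded_cong) (simp add: lW)
  show ?case
  proof (cases "head W = ?m")
    case False
    have "head W \<in> set (leaf_labels (Node c l r))"
      using head_in_labels[of W] lW by simp
    with n(3) False have "?m < head W" by (metis List.finite_set Min_le order_le_imp_less_or_eq)
    with bT Node.prems(4) have "val b (word_of (Node c l r)) < val b W"
      by (intro val_less_head) (auto simp: lW head_word_of hd_append simp del: word_of.simps)
    then show ?thesis by (simp add: weakly_less_def)
  next
    case True
    obtain A B where AB: "attached c A B W" "splits_as A l \<and> splits_as B r \<or> splits_as A r \<and> splits_as B l"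
      using Node.prems(1) by auto
    \<comment> \<open>\<open>A\<close> keeps the head of \<open>W\<close>, which is the first leaf
      of \<open>l\<close>, so the two parts cannot be assigned to the subtrees the other way
      round.\<close>
    have "\<not> splits_as A r"
    proof
      assume "splits_as A r"
      then have "?m \<in> set (leaf_labels r)"
        using head_in_labels[of A] head_attached[OF AB(1)] True by (simp add: labels_splits_as)
      moreover have "?m \<in> set (leaf_labels l)" by (rule hd_in_set) simp
      ultimately show False using Node.prems(3) unfolding leaf_labels.simps distinct_append by blast
    qed
    with AB have s: "splits_as A l" "splits_as B r" by auto
    note lab = labels_attached[OF AB(1)]
    have b: "bounded b A" "bounded b B" using Node.prems(4) lab by (auto intro: bounded_part)
    have "weakly_less b (word_of l) A" "weakly_less b (word_of r) B"
      using Node n s b by auto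
    moreover have bAB: "bounded b (attach_end c A B)" using Node.prems(4) by (rule bounded_cong) (simp add: lab)
    ultimately have "weakly_less b (attach_end c (word_of l) (word_of r)) (attach_end c A B)"
      using bT by (intro attach_end_mono) (auto simp: labels_splits_as[OF s(1)] labels_splits_as[OF s(2)])
    moreover have "weakly_less b (attach_end c A B) W"
      using AB(1) Node.prems(4) by (rule attach_end_le_attached)
    ultimately show ?thesis by (auto intro: weakly_less_trans)
  qed
qed

lemma edges_labels: "(c, a, b) \<in> edges W \<Longrightarrow> a \<in># labels W \<and> b \<in># labels W"
proof (induction W)
  case (RW x E w)
  from RW.prems consider y where "y \<in># E" "a = x" "b = head y" | y where "y \<in># E" "(c, a, b) \<in> edges y"
    | y where "w = Some y" "a = x" "b = head y" | y where "w = Some y" "(c, a, b) \<in> edges y"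
    by (cases w) auto
  then show ?case
    by cases (use RW.IH in \<open>auto dest!: multi_member_split\<close>)
qed

lemma finite_edges: "finite (edges W)"
proof (induction W)
  case (RW a E w)
  then show ?case by (cases w) auto
qed

text \<open>Singles out one edge at the root, of either color, so that inductions treat branches and
  tail alike.\<close>

definition root_attached :: "color \<Rightarrow> rword \<Rightarrow> rword \<Rightarrow> rword \<Rightarrow> bool" where
  "root_attached d R x W \<longleftrightarrow>
     (\<exists>a E w. d = Red \<and> R = RW a E w \<and> W = RW a (add_mset x E) w) \<or>
     (\<exists>a E. d = Blue \<and> R = RW a E None \<and> W = RW a E (Some x))"

lemma attached_if_root_attached: "root_attached d R x W \<Longrightarrow> attached d R x W"
  unfolding root_attached_def by (auto intro: attached.intros)

lemma edges_root_attached: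
  "root_attached d R x W \<Longrightarrow> edges W = insert (d, head W, head x) (edges R \<union> edges x)"
  unfolding root_attached_def by (auto split: option.splits)

lemma root_attached_attached:
  "root_attached d R x W \<Longrightarrow> attached c A B x \<Longrightarrow> \<exists>A'. root_attached d R A A' \<and> attached c A' B W"
  unfolding root_attached_def by (auto intro: attached.intros)

lemma root_attached_cases:
  assumes "e \<in> edges W"
  obtains d R x where "root_attached d R x W" "e = (d, head W, head x) \<or> e \<in> edges x"
proof -
  obtain a E w where W: "W = RW a E w" by (cases W)
  show thesis
  proof (cases "\<exists>x \<in># E. e = (Red, a, head x) \<or> e \<in> edges x")
    case True
    then obtain x E' where x: "E = add_mset x E'" "e = (Red, a, head x) \<or> e \<in> edges x"
      by (auto dest: multi_member_split)
    then show thesis by (intro that[of Red "RW a E' w" x]) (auto simp: W root_attached_def)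
  next
    case False
    then obtain x where x: "w = Some x" "e = (Blue, a, head x) \<or> e \<in> edges x"
      using assms by (cases w) (auto simp: W)
    then show thesis by (intro that[of Blue "RW a E None" x]) (auto simp: W root_attached_def)
  qed
qed

text \<open>A word is a tree on its vertices. Only an inequality holds in general, because edges are
  triples of labels and repeated labels can make two of them coincide.\<close>

lemma card_edges: "card (edges W) < size (labels W)"
proof (induction "size (labels W)" arbitrary: W rule: less_induct)
  case less
  show ?case
  proof (cases "edges W = {}")
    case False
    then obtain e where "e \<in> edges W" by auto
    then obtain d R x where R: "root_attached d R x W" by (rule root_attached_cases)
    note lab = labels_attached[OF attached_if_root_attached[OF R]]
    have "card (edges W) \<le> Suc (card (edges R \<union> edges x))"
      unfolding edges_root_attached[OF R] by (rule card_insert_le_m1) simp_all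
    also have "card (edges R \<union> edges x) \<le> card (edges R) + card (edges x)" by (rule card_Un_le)
    finally have "card (edges W) \<le> Suc (card (edges R) + card (edges x))" by simp
    moreover have "card (edges R) < size (labels R)" "card (edges x) < size (labels x)"
      using less lab by simp_all
    ultimately show ?thesis using lab by simp
  qed simp
qed

definition crossing :: "nat set \<Rightarrow> rword \<Rightarrow> (color \<times> nat \<times> nat) set" where
  "crossing S W = {(c, a, b) \<in> edges W. (a \<in> S) \<noteq> (b \<in> S)}"

text \<open>Words are connected: membership in \<open>S\<close> cannot change along an edge that
  does not cross \<open>S\<close>.\<close>

lemma no_crossing: "crossing S W = {} \<Longrightarrow> x \<in># labels W \<Longrightarrow> x \<in> S \<longleftrightarrow> head W \<in> S"
proof (induction W)
  case (RW a E w)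
  from RW.prems(2) consider "x = a" | y where "y \<in># E" "x \<in># labels y" | y where "w = Some y" "x \<in># labels y"
    by (cases w) auto
  then show ?case
  proof cases
    case 2
    have "crossing S y = {}" using RW.prems(1) 2 by (auto simp: crossing_def)
    moreover have "(Red, a, head y) \<notin> crossing S (RW a E w)" using RW.prems(1) by simp
    ultimately show ?thesis using 2 RW.IH(1)[OF 2(1) _ 2(2)] by (auto simp: crossing_def)
  next
    case 3
    have "crossing S y = {}" using RW.prems(1) 3 by (auto simp: crossing_def)
    moreover have "(Blue, a, head y) \<notin> crossing S (RW a E w)" using RW.prems(1) by simp
    ultimately show ?thesis using 3 RW.IH(2)[of y] by (auto simp: crossing_def)
  qed simp
qed

text \<open>Deleting the only crossing edge leaves two connected parts without crossing edges, so
  each lies on one side of \<open>S\<close>. Distinct labels guarantee that a triple stands for an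
  edge in a single place of the word.\<close>

lemma one_crossing:
  assumes "crossing S W = {(c, a, b)}" "\<And>x. count (labels W) x \<le> 1"
  shows "\<exists>A B. attached c A B W \<and> (\<forall>x \<in># labels A. x \<in> S \<longleftrightarrow> head W \<in> S) \<and>
     (\<forall>x \<in># labels B. x \<in> S \<longleftrightarrow> head W \<notin> S) \<and> edges W = insert (c, a, b) (edges A \<union> edges B)"
  using assms
proof (induction "size (labels W)" arbitrary: W rule: less_induct)
  case less
  have e: "(c, a, b) \<in> edges W" "(a \<in> S) \<noteq> (b \<in> S)"
    using singletonI[of "(c, a, b)", folded less.prems(1)] by (auto simp: crossing_def)
  obtain d R x where R: "root_attached d R x W" and ex: "(c, a, b) = (d, head W, head x) \<or> (c, a, b) \<in> edges x"
    using e(1) by (rule root_attached_cases)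
  note lab = labels_attached[OF attached_if_root_attached[OF R]]
  note hd = head_attached[OF attached_if_root_attached[OF R]]
  note ed = edges_root_attached[OF R]
  have disj: "\<not> (y \<in># labels R \<and> y \<in># labels x)" for y
  proof
    assume "y \<in># labels R \<and> y \<in># labels x"
    then have "0 < count (labels R) y" "0 < count (labels x) y" by auto
    with less.prems(2)[of y] show False by (simp add: lab)
  qed
  have sub: "crossing S V \<subseteq> {(c, a, b)} \<inter> edges V" if "edges V \<subseteq> edges W" for V
    using that less.prems(1) unfolding crossing_def by blast
  have eR: "edges R \<subseteq> edges W" "edges x \<subseteq> edges W" unfolding ed by auto
  have bx: "b \<in># labels x" using ex edges_labels by auto
  have "(c, a, b) \<notin> edges R" using edges_labels disj bx by blast
  then have "crossing S R = {}" using sub[OF eR(1)] by auto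
  then have sR: "y \<in> S \<longleftrightarrow> head W \<in> S" if "y \<in># labels R" for y
    using no_crossing[of S R y] that hd by simp
  show ?case
  proof (cases "(c, a, b) \<in> edges x")
    case False
    then have eq: "c = d" "a = head W" "b = head x" using ex by auto
    have "crossing S x = {}" using sub[OF eR(2)] False by auto
    then have "y \<in> S \<longleftrightarrow> head W \<notin> S" if "y \<in># labels x" for y
      using no_crossing[of S x y] that e(2) eq by auto
    with sR show ?thesis using attached_if_root_attached[OF R] ed unfolding eq
      by (intro exI[of _ R] exI[of _ x]) simp
  next
    case True
    then have ax: "a \<in># labels x" using edges_labels by auto
    have cx: "crossing S x = {(c, a, b)}" using sub[OF eR(2)] True e(2) by (auto simp: crossing_def)
    have "head W \<in># labels R" using hd by simp
    then have "(d, head W, head x) \<noteq> (c, a, b)" using disj ax by auto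
    then have "(d, head W, head x) \<notin> crossing S W" using less.prems(1) by simp
    then have hx: "head x \<in> S \<longleftrightarrow> head W \<in> S" by (auto simp: crossing_def ed)
    have cnt: "count (labels x) y \<le> 1" for y using less.prems(2)[of y] by (simp add: lab)
    have "size (labels x) < size (labels W)" by (simp add: lab)
    from less.hyps[OF this cx cnt] obtain A B where AB: "attached c A B x"
      "\<forall>y \<in># labels A. y \<in> S \<longleftrightarrow> head x \<in> S" "\<forall>y \<in># labels B. y \<in> S \<longleftrightarrow> head x \<notin> S"
      "edges x = insert (c, a, b) (edges A \<union> edges B)" by blast
    from root_attached_attached[OF R AB(1)] obtain A' where A': "root_attached d R A A'" "attached c A' B W"
      by blast
    have "labels A' = labels R + labels A" by (rule labels_attached[OF attached_if_root_attached[OF A'(1)]])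
    moreover have "edges W = insert (c, a, b) (edges A' \<union> edges B)"
      unfolding ed AB(4) edges_root_attached[OF A'(1)] using head_attached[OF AB(1)] head_attached[OF A'(2)] by auto
    moreover have "\<forall>y \<in># labels R + labels A. y \<in> S \<longleftrightarrow> head W \<in> S" using AB(2) hx sR by auto
    ultimately show ?thesis using A'(2) AB(3) hx by metis
  qed
qed

definition internal :: "(color \<times> nat \<times> nat) set \<Rightarrow> nat set \<Rightarrow> (color \<times> nat \<times> nat) set" where
  "internal G S = {(c, a, b) \<in> G. a \<in> S \<and> b \<in> S}"

lemma finite_internal: "finite G \<Longrightarrow> finite (internal G S)"
  by (rule finite_subset[of _ G]) (auto simp: internal_def)

text \<open>The edge crossing a node has both ends below that node but not below the same child.
  Different nodes therefore use different edges, and there is one node less than there are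
  leaves.\<close>

lemma card_internal_ge:
  assumes "finite G" "distinct (leaf_labels T)" "\<And>nd. nd \<in> set (postorder T) \<Longrightarrow> crossed G nd"
  shows "length (leaf_labels T) \<le> Suc (card (internal G (set (leaf_labels T))))"
  using assms(2,3)
proof (induction T)
  case (Node c l r)
  let ?L = "set (leaf_labels l)" and ?R = "set (leaf_labels r)"
  have "crossed G (c, ?L, ?R)" using Node.prems(2) by simp
  then obtain a b where e: "(c, a, b) \<in> G" "a \<in> ?L \<and> b \<in> ?R \<or> a \<in> ?R \<and> b \<in> ?L"
    by (auto simp: crossed_def)
  have disj: "?L \<inter> ?R = {}" using Node.prems(1) by auto
  have sub: "insert (c, a, b) (internal G ?L \<union> internal G ?R) \<subseteq> internal G (set (leaf_labels (Node c l r)))"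
    using e by (auto simp: internal_def)
  have "(c, a, b) \<notin> internal G ?L \<union> internal G ?R" using e(2) disj by (auto simp: internal_def)
  moreover have "internal G ?L \<inter> internal G ?R = {}" using disj by (auto simp: internal_def)
  ultimately have "Suc (card (internal G ?L) + card (internal G ?R)) \<le> card (internal G (set (leaf_labels (Node c l r))))"
    using card_mono[OF finite_internal[OF assms(1)] sub] by (simp add: card_Un_disjoint finite_internal assms(1))
  with Node show ?case by simp
qed simp

text \<open>Pigeonhole: the word has at most \<open>|L| + |R| - 1\<close> edges; at least
  \<open>|L| - 1\<close> of them lie inside the left leaf set and at least \<open>|R| - 1\<close>
  inside the right one. So a single edge is left to cross the root, and deleting it cuts the word
  into the two leaf sets.\<close>

lemma splits_as_if_crossed:
  assumes "labels W = mset (leaf_labels T)" "distinct (leaf_labels T)"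
    and "\<And>nd. nd \<in> set (postorder T) \<Longrightarrow> crossed (edges W) nd"
  shows "splits_as W T"
  using assms
proof (induction T arbitrary: W)
  case (Leaf a)
  obtain a' E w where W: "W = RW a' E w" by (cases W)
  have "size (labels W) = 1" using Leaf by simp
  then have "E = {#}" "w = None"
    using size_le_branch_size[of E] unfolding W size_labels_RW by (auto simp: tail_size_def split: option.splits)
  with Leaf show ?case by (simp add: W)
next
  case (Node c l r)
  let ?G = "edges W" and ?L = "set (leaf_labels l)" and ?R = "set (leaf_labels r)"
  have disj: "?L \<inter> ?R = {}" using Node.prems(2) by auto
  have ends: "a \<in> ?L \<union> ?R \<and> b \<in> ?L \<union> ?R" if "(d, a, b) \<in> ?G" for d a b
    using edges_labels[OF that] Node.prems(1) by auto
  have "crossed ?G (c, ?L, ?R)" using Node.prems(3) by simp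
  then obtain a b where e: "(c, a, b) \<in> ?G" "a \<in> ?L \<and> b \<in> ?R \<or> a \<in> ?R \<and> b \<in> ?L"
    by (auto simp: crossed_def)
  have e': "(c, a, b) \<in> crossing ?L W" using e disj by (auto simp: crossing_def)
  have fin: "finite (internal ?G S)" "finite (crossing S W)" for S
    using finite_edges[of W] by (auto intro: finite_internal finite_subset[of _ ?G] simp: crossing_def)
  have "internal ?G ?L \<union> internal ?G ?R \<union> crossing ?L W \<subseteq> ?G"
    by (auto simp: internal_def crossing_def)
  note * = card_mono[OF finite_edges this]
  have "card (internal ?G ?L) + card (internal ?G ?R) + card (crossing ?L W) \<le> card ?G"
  proof -
    have "(internal ?G ?L \<union> internal ?G ?R) \<inter> crossing ?L W = {}" "internal ?G ?L \<inter> internal ?G ?R = {}"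
      using disj by (auto simp: internal_def crossing_def)
    with * show ?thesis by (simp add: card_Un_disjoint fin)
  qed
  moreover have "card ?G < length (leaf_labels l) + length (leaf_labels r)"
    using card_edges[of W] Node.prems(1) by simp
  moreover have "length (leaf_labels l) \<le> Suc (card (internal ?G ?L))"
    "length (leaf_labels r) \<le> Suc (card (internal ?G ?R))"
    using Node.prems by (auto intro!: card_internal_ge finite_edges)
  ultimately have "card (crossing ?L W) \<le> Suc 0" by linarith
  then have cr: "crossing ?L W = {(c, a, b)}" using e' card_le_Suc0_iff_eq[OF fin(2)] by blast
  have "count (labels W) x \<le> 1" for x
    using Node.prems(2) unfolding Node.prems(1) distinct_count_atmost_1 by simp
  from one_crossing[OF cr this] obtain A B where AB: "attached c A B W"
    "\<forall>x \<in># labels A. x \<in> ?L \<longleftrightarrow> head W \<in> ?L" "\<forall>x \<in># labels B. x \<in> ?L \<longleftrightarrow> head W \<notin> ?L"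
    "?G = insert (c, a, b) (edges A \<union> edges B)" by blast
  have lab: "labels A + labels B = mset (leaf_labels l) + mset (leaf_labels r)"
    using labels_attached[OF AB(1)] Node.prems(1) by simp
  have fl: "filter_mset (\<lambda>x. x \<in> ?L) (mset (leaf_labels l)) = mset (leaf_labels l)"
    "filter_mset (\<lambda>x. x \<notin> ?L) (mset (leaf_labels l)) = {#}"
    "filter_mset (\<lambda>x. x \<in> ?L) (mset (leaf_labels r)) = {#}"
    "filter_mset (\<lambda>x. x \<notin> ?L) (mset (leaf_labels r)) = mset (leaf_labels r)"
    using disj by (auto simp: filter_mset_eq_conv)
  have part: "labels P = mset (leaf_labels l) \<and> labels Q = mset (leaf_labels r)"
    if "labels P + labels Q = mset (leaf_labels l) + mset (leaf_labels r)"
      "\<forall>x \<in># labels P. x \<in> ?L" "\<forall>x \<in># labels Q. x \<notin> ?L" for P Q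
  proof -
    have "filter_mset (\<lambda>x. x \<in> ?L) (labels P) = labels P" "filter_mset (\<lambda>x. x \<in> ?L) (labels Q) = {#}"
      "filter_mset (\<lambda>x. x \<notin> ?L) (labels P) = {#}" "filter_mset (\<lambda>x. x \<notin> ?L) (labels Q) = labels Q"
      using that(2,3) by (auto simp: filter_mset_eq_conv)
    note f = this
    have "labels P = filter_mset (\<lambda>x. x \<in> ?L) (labels P + labels Q)" using f by (simp only: filter_union_mset) simp
    also have "\<dots> = mset (leaf_labels l)" unfolding that(1) filter_union_mset fl by simp
    finally have 1: "labels P = mset (leaf_labels l)" .
    have "labels Q = filter_mset (\<lambda>x. x \<notin> ?L) (labels P + labels Q)" using f by (simp only: filter_union_mset) simp
    also have "\<dots> = mset (leaf_labels r)" unfolding that(1) filter_union_mset fl by simp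
    finally show ?thesis using 1 by blast
  qed
  \<comment> \<open>An edge crossing a node of \<open>t\<close> has both ends among the leaves of
    \<open>t\<close>, so it is neither the deleted edge nor an edge of the other part. The crossing
    hypothesis thus passes to the part that carries these leaves.\<close>
  have sub: "splits_as P t" if P: "labels P = mset (leaf_labels t)" and "t = l \<or> t = r"
    and PQ: "edges P \<union> edges Q = edges A \<union> edges B" and Q: "set_mset (labels Q) \<inter> set (leaf_labels t) = {}" for P Q t
  proof -
    have "crossed (edges P) (d, X, Y)" if nd: "(d, X, Y) \<in> set (postorder t)" for d X Y
    proof -
      have XY: "X \<subseteq> set (leaf_labels t) \<and> Y \<subseteq> set (leaf_labels t)" using nd by (induction t) auto
      have "(d, X, Y) \<in> set (postorder (Node c l r))" using nd \<open>t = l \<or> t = r\<close> by auto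
      from Node.prems(3)[OF this] obtain u v where uv: "(d, u, v) \<in> ?G" "u \<in> X \<and> v \<in> Y \<or> u \<in> Y \<and> v \<in> X"
        by (auto simp: crossed_def)
      have uv': "u \<in> set (leaf_labels t)" "v \<in> set (leaf_labels t)" using uv(2) XY by auto
      have "(d, u, v) \<noteq> (c, a, b)" using uv' e(2) disj \<open>t = l \<or> t = r\<close> by auto
      moreover have "(d, u, v) \<notin> edges Q" using edges_labels[of d u v Q] uv' Q by auto
      ultimately have "(d, u, v) \<in> edges P" using uv(1) AB(4) PQ by auto
      with uv(2) show ?thesis by (auto simp: crossed_def)
    qed
    then have cP: "crossed (edges P) nd" if "nd \<in> set (postorder t)" for nd
      using that by (cases nd) blast
    from \<open>t = l \<or> t = r\<close> show ?thesis
    proof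
      assume t: "t = l"
      show ?thesis unfolding t
        using P cP Node.prems(2) unfolding t by (intro Node.IH(1)) simp_all
    next
      assume t: "t = r"
      show ?thesis unfolding t
        using P cP Node.prems(2) unfolding t by (intro Node.IH(2)) simp_all
    qed
  qed
  show ?case
  \<comment> \<open>The part \<open>A\<close> contains the head of \<open>W\<close>, so the side of
    the head tells which subtree \<open>A\<close> belongs to.\<close>
  proof (cases "head W \<in> ?L")
    case True
    then have p: "labels A = mset (leaf_labels l) \<and> labels B = mset (leaf_labels r)"
      using part[OF lab] AB(2,3) by auto
    then have "splits_as A l" "splits_as B r"
      using sub[of A l B] sub[of B r A] disj by auto
    with AB(1) show ?thesis by auto
  next
    case False
    have lab': "labels B + labels A = mset (leaf_labels l) + mset (leaf_labels r)" using lab by (simp add: ac_simps)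
    have p: "labels B = mset (leaf_labels l) \<and> labels A = mset (leaf_labels r)"
      using part[OF lab'] AB(2,3) False by auto
    then have "splits_as B l" "splits_as A r"
      using sub[of A r B] sub[of B l A] disj by auto
    with AB(1) show ?thesis by auto
  qed
qed

section \<open>Recovering a Lyndon tree from its word\<close>

fun proper_suffixes :: "rword \<Rightarrow> rword set" where
  "proper_suffixes (RW a E None) = {}"
| "proper_suffixes (RW a E (Some w)) = insert w (proper_suffixes w)"

fun end_branches :: "rword \<Rightarrow> rword multiset" where
  "end_branches (RW a E None) = E"
| "end_branches (RW a E (Some w)) = end_branches w"

lemma proper_suffixes_attach_end:
  "proper_suffixes (attach_end c A B) =
     (\<lambda>V. attach_end c V B) ` proper_suffixes A \<union> (if c = Blue then insert B (proper_suffixes B) else {})"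
  by (induction c A B rule: attach_end.induct) auto

lemma end_branches_attach_end:
  "end_branches (attach_end c A B) = (if c = Blue then end_branches B else add_mset B (end_branches A))"
  by (induction c A B rule: attach_end.induct) auto

text \<open>Equidivisibility, as for ordinary words under concatenation: of two left factors of one
  word, one extends the other.\<close>

lemma attach_end_Blue_eq:
  "attach_end Blue A B = attach_end Blue A' B' \<Longrightarrow>
     A = A' \<and> B = B' \<or> (\<exists>V \<in> proper_suffixes A. B' = attach_end Blue V B) \<or>
     (\<exists>V \<in> proper_suffixes A'. B = attach_end Blue V B')"
proof (induction Blue A B arbitrary: A' rule: attach_end.induct)
  case (1 a E w B)
  obtain a' E' w' where A': "A' = RW a' E' w'" by (cases A')
  show ?case using 1 unfolding A' by (cases w') auto
next
  case (3 a E B)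
  obtain a' E' w' where A': "A' = RW a' E' w'" by (cases A')
  show ?case using 3 unfolding A' by (cases w') auto
qed

text \<open>The last red attachment takes place on the last letter, which belongs to the right
  factor of every blue factorization.\<close>

lemma attach_end_Red_Blue_eq:
  "attach_end Red A B = attach_end Blue A' B' \<Longrightarrow> \<exists>V \<in> proper_suffixes A. B' = attach_end Red V B"
proof (induction Red A B arbitrary: A' rule: attach_end.induct)
  case (1 a E w B)
  obtain a' E' w' where A': "A' = RW a' E' w'" by (cases A')
  show ?case using 1 unfolding A' by (cases w') auto
next
  case (2 a E B)
  obtain a' E' w' where A': "A' = RW a' E' w'" by (cases A')
  show ?case using 2 unfolding A' by (cases w') auto
qed

lemma attach_end_Red_cancel: "attach_end Red A B = attach_end Red A' B \<Longrightarrow> A = A'"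
proof (induction Red A B arbitrary: A' rule: attach_end.induct)
  case (1 a E w B)
  obtain a' E' w' where A': "A' = RW a' E' w'" by (cases A')
  show ?case using 1 unfolding A' by (cases w') auto
next
  case (2 a E B)
  obtain a' E' w' where A': "A' = RW a' E' w'" by (cases A')
  show ?case using 2 unfolding A' by (cases w') auto
qed

text \<open>The condition at a root sees the right subtree only through its least label. With a
  number in its place, induction can use the label that fits an inner node.\<close>

definition admissible :: "color \<Rightarrow> ltree \<Rightarrow> nat \<Rightarrow> bool" where
  "admissible c l v \<longleftrightarrow> (case l of Leaf a \<Rightarrow> True
     | Node d l1 l2 \<Rightarrow> v < valency l2 \<or> c = Blue \<and> d = Red)"

lemma lyndon_Leaf: "bicolored_lyndon (Leaf a)"
  by (simp add: bicolored_lyndon_def normalized_def)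

lemma lyndon_Node:
  "bicolored_lyndon (Node c l r) \<longleftrightarrow>
     bicolored_lyndon l \<and> bicolored_lyndon r \<and> admissible c l (valency r) \<and>
     hd (leaf_labels l) = Min (set (leaf_labels (Node c l r)))"
proof -
  define ok where "ok S = (case S of Leaf a \<Rightarrow> True | Node c l r \<Rightarrow> admissible c l (valency r))" for S
  have adm: "lyndon_node l r \<or> c = Blue \<and> (\<exists>l1 l2. l = Node Red l1 l2) \<longleftrightarrow> admissible c l (valency r)" for c l r
    by (cases l; cases c) (simp_all add: admissible_def)
  have alt: "bicolored_lyndon T \<longleftrightarrow> normalized T \<and> (\<forall>S \<in> subtrees T. ok S)" for T
  proof -
    have "(\<forall>c l r. Node c l r \<in> subtrees T \<and> \<not> lyndon_node l r \<longrightarrow> c = Blue \<and> (\<exists>l1 l2. l = Node Red l1 l2)) \<longleftrightarrow>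
       (\<forall>c l r. Node c l r \<in> subtrees T \<longrightarrow> admissible c l (valency r))"
      unfolding adm[symmetric] by blast
    also have "\<dots> \<longleftrightarrow> (\<forall>S \<in> subtrees T. ok S)"
    proof
      assume *: "\<forall>c l r. Node c l r \<in> subtrees T \<longrightarrow> admissible c l (valency r)"
      show "\<forall>S \<in> subtrees T. ok S"
      proof
        fix S assume "S \<in> subtrees T"
        with * show "ok S" by (cases S) (simp_all add: ok_def)
      qed
    qed (fastforce simp: ok_def)
    finally show ?thesis by (simp add: bicolored_lyndon_def)
  qed
  have "normalized (Node c l r) \<longleftrightarrow> normalized l \<and> normalized r \<and>
     hd (leaf_labels l) = Min (set (leaf_labels (Node c l r)))"
    unfolding normalized_def by (simp add: hd_append ball_Un conj_ac)
  then show ?thesis unfolding alt by (auto simp: ball_Un ok_def)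
qed

lemma valency_le: "x \<in> set (leaf_labels T) \<Longrightarrow> valency T \<le> x"
  by (simp add: valency_def)

lemma valency_in: "valency T \<in> set (leaf_labels T)"
  by (simp add: valency_def)

lemma valency_eq_hd: "bicolored_lyndon T \<Longrightarrow> valency T = hd (leaf_labels T)"
proof -
  have "T \<in> subtrees T" by (cases T) auto
  then show "bicolored_lyndon T \<Longrightarrow> ?thesis"
    by (simp add: bicolored_lyndon_def normalized_def valency_def)
qed

lemma labels_proper_suffix: "V \<in> proper_suffixes W \<Longrightarrow> labels V \<subseteq># labels W"
proof (induction W rule: proper_suffixes.induct)
  case (2 a E w)
  have "labels w \<subseteq># labels (RW a E (Some w))" by simp
  with 2 show ?case by (auto intro: subset_mset.order_trans)
qed simp

text \<open>In the word of a Lyndon tree \<open>Node c l r\<close> the word of \<open>r\<close> can be located: when \<open>c\<close> is blue it is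
  the longest proper suffix that starts with its least label, when \<open>c\<close> is red it is the branch at the
  end with the least head.\<close>

lemma suffix_not_minimal:
  assumes "bicolored_lyndon l" "distinct (leaf_labels l)" "admissible c l v"
    and "V \<in> proper_suffixes (word_of l)" "\<forall>x \<in># labels V. head V \<le> x"
  shows "v \<le> head V"
  using assms
proof (induction l arbitrary: c v V)
  case (Node d A B)
  have AB: "bicolored_lyndon A" "bicolored_lyndon B" "admissible d A (valency B)"
    using Node.prems(1) by (auto simp: lyndon_Node)
  from Node.prems(4) consider U where "U \<in> proper_suffixes (word_of A)" "V = attach_end d U (word_of B)"
    | "d = Blue" "labels V \<subseteq># labels (word_of B)"
    by (auto simp: proper_suffixes_attach_end dest: labels_proper_suffix split: if_splits)
  then show ?case
  proof cases
    case 1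
    \<comment> \<open>Here \<open>V\<close> begins inside the word of \<open>A\<close> and contains
      all of \<open>B\<close>. Its head is its least label, hence at most the valency of
      \<open>B\<close>; the induction hypothesis for \<open>A\<close>, with this valency as bound,
      gives the converse. Equality puts a label of \<open>A\<close> into \<open>B\<close>.\<close>
    have "head U \<le> valency B" using Node.prems(5) 1(2) valency_in[of B] by auto
    moreover have "valency B \<le> head U"
      using Node.IH(1)[OF AB(1) _ AB(3) 1(1)] Node.prems(2,5) 1(2) by auto
    ultimately have "head U \<in> set (leaf_labels B)" using valency_in[of B] by simp
    moreover have "head U \<in># labels (word_of A)"
      using labels_proper_suffix[OF 1(1)] head_in_labels[of U] by (rule mset_subset_eqD)
    ultimately show ?thesis using Node.prems(2) by auto
  next
    case 2
    have "head V \<in># labels (word_of B)" using 2(2) head_in_labels[of V] by (rule mset_subset_eqD)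
    then have "valency B \<le> head V" by (simp add: valency_le)
    \<comment> \<open>With a blue left child the exception of a blue root over a red left child
      cannot apply.\<close>
    moreover have "v < valency B" using Node.prems(3) 2(1) by (simp add: admissible_def)
    ultimately show ?thesis by simp
  qed
qed simp

lemma labels_end_branches: "B \<in># end_branches W \<Longrightarrow> labels B \<subseteq># labels W"
proof (induction W rule: end_branches.induct)
  case (2 a E w)
  have "labels w \<subseteq># labels (RW a E (Some w))" by simp
  with 2 show ?case by (auto intro: subset_mset.order_trans)
qed (auto dest!: multi_member_split)

text \<open>Under a red root the Lyndon inequality has no exception. Along a left spine of red nodes
  the heads attached later are therefore smaller; behind a blue left child the end branches use
  labels of its right subtree, all of which exceed \<open>v\<close>.\<close>

lemma end_branch_greater:
  assumes "bicolored_lyndon l" "admissible Red l v" "V \<in># end_branches (word_of l)"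
  shows "v < head V"
  using assms
proof (induction l arbitrary: v V)
  case (Node d A B)
  have AB: "bicolored_lyndon A" "bicolored_lyndon B" "admissible d A (valency B)"
    using Node.prems(1) by (auto simp: lyndon_Node)
  have v: "v < valency B" using Node.prems(2) by (simp add: admissible_def)
  show ?case
  proof (cases d)
    case Blue
    then have "V \<in># end_branches (word_of B)" using Node.prems(3) by (simp add: end_branches_attach_end)
    then have "head V \<in># labels (word_of B)" using labels_end_branches head_in_labels mset_subset_eqD by metis
    then have "valency B \<le> head V" by (simp add: valency_le)
    with v show ?thesis by simp
  next
    case Red
    then consider "V = word_of B" | "V \<in># end_branches (word_of A)"
      using Node.prems(3) by (auto simp: end_branches_attach_end)
    then show ?thesis
    proof cases
      case 1
      with v AB(2) show ?thesis by (simp add: head_word_of valency_eq_hd)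
    next
      case 2
      with Node.IH(1)[OF AB(1)] AB(3) Red v show ?thesis by fastforce
    qed
  qed
qed simp

lemma head_word_of_lyndon:
  assumes "bicolored_lyndon T"
  shows "head (word_of T) = valency T" "\<forall>x \<in># labels (word_of T). head (word_of T) \<le> x"
  using assms by (auto simp: head_word_of valency_eq_hd[symmetric] valency_le)

text \<open>The root can be recognized from the word. If two trees factor it differently and one of
  the roots is blue, the longer right factor, being the word of a Lyndon tree, starts with its least
  label inside the other left factor, where \<open>suffix_not_minimal\<close> forbids it. If both
  roots are red, their last branches are compared by their heads.\<close>

theorem word_of_inj:
  assumes "word_of T = word_of T'" "bicolored_lyndon T" "bicolored_lyndon T'"
    and "distinct (leaf_labels T)" "distinct (leaf_labels T')"
  shows "T = T'"
  using assms
proof (induction T arbitrary: T')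
  case (Leaf a)
  have "size (labels (word_of T')) = 1" unfolding Leaf.prems(1)[symmetric] by simp
  with Leaf.prems(1) show ?case
  proof (cases T')
    case (Node c l r)
    have "1 \<le> length (leaf_labels l)" "1 \<le> length (leaf_labels r)" by (simp_all add: Suc_le_eq)
    with \<open>size (labels (word_of T')) = 1\<close> Node show ?thesis by simp
  qed simp
next
  case (Node c l r)
  obtain c' l' r' where T': "T' = Node c' l' r'"
  proof (cases T')
    case (Leaf a)
    have "1 \<le> length (leaf_labels l)" "1 \<le> length (leaf_labels r)" by (simp_all add: Suc_le_eq)
    moreover have "size (labels (word_of (Node c l r))) = 1" unfolding Node.prems(1) Leaf by simp
    ultimately show thesis by simp
  qed
  note ly = Node.prems(2)[unfolded lyndon_Node] Node.prems(3)[unfolded T' lyndon_Node]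
  have di: "distinct (leaf_labels l)" "distinct (leaf_labels r)" "distinct (leaf_labels l')" "distinct (leaf_labels r')"
    "set (leaf_labels l) \<inter> set (leaf_labels r) = {}" "set (leaf_labels l') \<inter> set (leaf_labels r') = {}"
    using Node.prems(4,5) T' by auto
  have eq: "attach_end c (word_of l) (word_of r) = attach_end c' (word_of l') (word_of r')"
    using Node.prems(1) T' by simp
  have IH: ?case if "c = c'" "word_of l = word_of l'" "word_of r = word_of r'"
    using Node.IH(1)[OF that(2)] Node.IH(2)[OF that(3)] ly di that(1) T' by simp
  \<comment> \<open>As the first label of a Lyndon tree, \<open>head V\<close> is at most the
    valency of \<open>s\<close>; \<open>suffix_not_minimal\<close> gives the other inequality, and
    equality contradicts the disjointness of the labels of \<open>t\<close> and
    \<open>s\<close>.\<close>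
  have no: False
    if V: "V \<in> proper_suffixes (word_of t)" and W: "word_of u = attach_end d V (word_of s)"
      and ly: "bicolored_lyndon t" "admissible e t (valency s)" "bicolored_lyndon u" "bicolored_lyndon s"
      and di: "distinct (leaf_labels t)" "set (leaf_labels t) \<inter> set (leaf_labels s) = {}" for V t u s d e
  proof -
    have h: "head V = head (word_of u)" and lab: "labels (word_of u) = labels V + labels (word_of s)"
      unfolding W by simp_all
    have min: "\<forall>x \<in># labels V + labels (word_of s). head V \<le> x"
      unfolding lab[symmetric] h using head_word_of_lyndon(2)[OF ly(3)] .
    then have "valency s \<le> head V"
      by (intro suffix_not_minimal[OF ly(1) di(1) ly(2) V]) simp
    moreover have "head V \<le> valency s" using min valency_in[of s] by simp
    ultimately have "head V \<in> set (leaf_labels s)" using valency_in[of s] by simp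
    moreover have "head V \<in># labels (word_of t)"
      using labels_proper_suffix[OF V] head_in_labels[of V] by (rule mset_subset_eqD)
    ultimately show False using di(2) by auto
  qed
  consider "c = Blue" "c' = Blue" | "c = Red" "c' = Red" | "c = Red" "c' = Blue" | "c = Blue" "c' = Red"
    by (cases c; cases c') auto
  then show ?case
  proof cases
    case 1
    from attach_end_Blue_eq[OF eq[unfolded 1]] show ?thesis
    proof (elim disjE conjE bexE)
      assume "word_of l = word_of l'" "word_of r = word_of r'"
      with IH 1 show ?thesis by simp
    next
      fix V assume "V \<in> proper_suffixes (word_of l)" "word_of r' = attach_end Blue V (word_of r)"
      then have False by (rule no) (use ly di in auto)
      then show ?thesis ..
    next
      fix V assume "V \<in> proper_suffixes (word_of l')" "word_of r = attach_end Blue V (word_of r')"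
      then have False by (rule no) (use ly di in auto)
      then show ?thesis ..
    qed
  next
    case 2
    show ?thesis
    proof (cases "word_of r = word_of r'")
      case True
      with attach_end_Red_cancel eq IH 2 show ?thesis by metis
    next
      case False
      have "add_mset (word_of r) (end_branches (word_of l)) = add_mset (word_of r') (end_branches (word_of l'))"
        using arg_cong[OF eq, of end_branches] 2 by (simp add: end_branches_attach_end)
      with False have "word_of r' \<in># end_branches (word_of l)" "word_of r \<in># end_branches (word_of l')"
        by (auto simp: add_eq_conv_ex)
      \<comment> \<open>Each branch is an older branch of the other word, so each head would be
        smaller than the other.\<close>
      then have "valency r < head (word_of r')" "valency r' < head (word_of r)"
        using end_branch_greater ly 2 by auto
      then show ?thesis using ly by (simp add: head_word_of_lyndon)
    qed
  next
    case 3
    from attach_end_Red_Blue_eq[OF eq[unfolded 3]] obtain V where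
      "V \<in> proper_suffixes (word_of l)" "word_of r' = attach_end Red V (word_of r)" by auto
    then have False by (rule no) (use ly di in auto)
    then show ?thesis ..
  next
    case 4
    from attach_end_Red_Blue_eq[OF eq[unfolded 4, symmetric]] obtain V where
      "V \<in> proper_suffixes (word_of l')" "word_of r = attach_end Red V (word_of r')" by auto
    then have False by (rule no) (use ly di in auto)
    then show ?thesis ..
  qed
qed

section \<open>Straightening of trees\<close>

text \<open>\<open>rewrites_to x ys\<close>: modulo antisymmetry and the (mixed) Jacobi identities, the tree \<open>x\<close> is a linear
  combination of the trees \<open>ys\<close> with coefficients \<open>\<plusminus>1\<close>.\<close>

inductive rewrites_to :: "ltree \<Rightarrow> ltree list \<Rightarrow> bool" where
  antisym: "rewrites_to (Node c l r) [Node c r l]"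
| jacobi: "rewrites_to (Node c (Node c a b) d) [Node c (Node c a d) b, Node c a (Node c b d)]"
| mixed_jacobi: "rewrites_to (Node Red (Node Blue a b) d)
    [Node Blue (Node Red a b) d, Node Red (Node Blue a d) b, Node Blue (Node Red a d) b,
     Node Red a (Node Blue b d), Node Blue a (Node Red b d)]"
| left: "rewrites_to x ys \<Longrightarrow> rewrites_to (Node c x r) (map (\<lambda>y. Node c y r) ys)"
| right: "rewrites_to x ys \<Longrightarrow> rewrites_to (Node c l x) (map (\<lambda>y. Node c l y) ys)"

lemma rewrites_to_labels:
  "rewrites_to x ys \<Longrightarrow> y \<in> set ys \<Longrightarrow> mset (leaf_labels y) = mset (leaf_labels x) \<and> red_count y = red_count x"
  by (induction arbitrary: y rule: rewrites_to.induct) auto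

text \<open>All that straightening needs to know about membership in a submodule: signs disappear,
  and no linear structure is required of the objects attached to trees.\<close>

definition rewrite_closed :: "(ltree \<Rightarrow> bool) \<Rightarrow> bool" where
  "rewrite_closed Q \<longleftrightarrow> (\<forall>x ys. rewrites_to x ys \<longrightarrow> (\<forall>y \<in> set ys. Q y) \<longrightarrow> Q x)"

lemma rewrite_closedD: "rewrite_closed Q \<Longrightarrow> rewrites_to x ys \<Longrightarrow> (\<And>y. y \<in> set ys \<Longrightarrow> Q y) \<Longrightarrow> Q x"
  by (rule iffD1[OF rewrite_closed_def, rule_format])

lemma rewrite_closed_left:
  assumes "rewrite_closed Q" shows "rewrite_closed (\<lambda>s. Q (Node c s r))"
  unfolding rewrite_closed_def[of "\<lambda>s. Q (Node c s r)"]
proof (intro allI impI)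
  fix x ys assume "rewrites_to x ys" "\<forall>y \<in> set ys. Q (Node c y r)"
  then show "Q (Node c x r)" by (intro rewrite_closedD[OF assms rewrites_to.left]) auto
qed

lemma rewrite_closed_right:
  assumes "rewrite_closed Q" shows "rewrite_closed (\<lambda>s. Q (Node c l s))"
  unfolding rewrite_closed_def[of "\<lambda>s. Q (Node c l s)"]
proof (intro allI impI)
  fix x ys assume "rewrites_to x ys" "\<forall>y \<in> set ys. Q (Node c l y)"
  then show "Q (Node c l x)" by (intro rewrite_closedD[OF assms rewrites_to.right]) auto
qed

definition same_type :: "ltree \<Rightarrow> ltree \<Rightarrow> bool" where
  "same_type s t \<longleftrightarrow> mset (leaf_labels s) = mset (leaf_labels t) \<and> red_count s = red_count t"

lemma valency_same_type: "same_type s t \<Longrightarrow> valency s = valency t"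
  unfolding same_type_def valency_def by (metis set_mset_mset)

lemma valency_Node: "valency (Node c l r) = min (valency l) (valency r)"
  unfolding valency_def by (simp add: Min_Un)

text \<open>The rewriting decreases the least label of the right subtree of the root, except for
  trading a red root for a blue one.\<close>

lemma straighten_root:
  assumes smaller: "\<And>t Q. length (leaf_labels t) < N \<Longrightarrow> distinct (leaf_labels t) \<Longrightarrow> rewrite_closed Q \<Longrightarrow>
      (\<And>s. bicolored_lyndon s \<Longrightarrow> same_type s t \<Longrightarrow> Q s) \<Longrightarrow> Q t"
  assumes "length (leaf_labels (Node c l r)) = N" "distinct (leaf_labels (Node c l r))"
    and "valency l < valency r" "rewrite_closed Q"
    and "\<And>s. bicolored_lyndon s \<Longrightarrow> same_type s (Node c l r) \<Longrightarrow> Q s"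
  shows "Q (Node c l r)"
  using assms(2-)
proof (induction "2 * valency r + (if c = Blue then 0 else 1)" arbitrary: c l r rule: less_induct)
  case (less c r l)
  note IH = less.hyps
  note N = less.prems(1) and di = less.prems(2) and val = less.prems(3) and cl = less.prems(4) and base = less.prems(5)
  have ne: "1 \<le> length (leaf_labels t)" for t by (simp add: Suc_le_eq)
  have len: "length (leaf_labels l) < N" "length (leaf_labels r) < N"
    using N ne[of l] ne[of r] by auto
  have lyn: "Q (Node c L R)" if L: "bicolored_lyndon L" "same_type L l" and R: "bicolored_lyndon R" "same_type R r" for L R
  proof -
    have vL: "valency L = valency l" and vR: "valency R = valency r"
      using L(2) R(2) by (auto intro: valency_same_type)
    have ty: "same_type (Node c L R) (Node c l r)" using L(2) R(2) by (simp add: same_type_def)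
    have mem: "mset (leaf_labels L) = mset (leaf_labels l)" "mset (leaf_labels R) = mset (leaf_labels r)"
      "red_count L = red_count l" "red_count R = red_count r"
      using L(2) R(2) by (auto simp: same_type_def)
    have lenLR: "length (leaf_labels L) = length (leaf_labels l)" "length (leaf_labels R) = length (leaf_labels r)"
      using mem by (metis size_mset)+
    have diLR: "distinct (leaf_labels (Node c L R))"
      using di ty unfolding same_type_def by (metis mset_eq_imp_distinct_iff)
    show ?thesis
    proof (cases "admissible c L (valency R)")
      case True
      have "valency (Node c L R) = valency L" using val by (simp add: valency_Node vL vR)
      then have "hd (leaf_labels L) = Min (set (leaf_labels (Node c L R)))"
        using valency_eq_hd[OF L(1)] unfolding valency_def by metis
      with True L R have "bicolored_lyndon (Node c L R)" by (simp add: lyndon_Node)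
      then show ?thesis using ty by (rule base)
    next
      case False
      \<comment> \<open>Blue over red is the one tolerated violation. What remains is equal colors,
        where the Jacobi identity of that color applies, or red over blue, where the mixed one
        does.\<close>
      then obtain d A B where AB: "L = Node d A B" "valency B \<le> valency R" "\<not> (c = Blue \<and> d = Red)"
        by (auto simp: admissible_def split: ltree.splits)
      have "valency B \<noteq> valency R" using diLR valency_in[of B] valency_in[of R] AB(1) by auto
      with AB(2) have BR: "valency B < valency R" by simp
      have AB': "valency A < valency B"
      proof -
        have "valency A \<le> valency B"
          using L(1) valency_eq_hd[of L] valency_eq_hd[of A] valency_Node[of d A B] unfolding AB(1)
          by (simp add: lyndon_Node hd_append)
        moreover have "valency A \<noteq> valency B" using diLR valency_in[of A] valency_in[of B] AB(1) by auto
        ultimately show ?thesis by simp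
      qed
      \<comment> \<open>All terms of the identities have the least label of \<open>A\<close> on the
        left and that of \<open>B\<close>, which is smaller than that of \<open>R\<close>, on the
        right. The only exception is the term with the colors of the two nodes exchanged: it keeps
        \<open>R\<close>, but its root is blue, and the color bit of the measure drops.\<close>
      have step: "Q (Node e s t)"
        if "same_type (Node e s t) (Node c l r)" "valency s = valency A"
          "valency t = valency B \<or> e = Blue \<and> c = Red \<and> valency t = valency R" for e s t
      proof (rule IH)
        show "2 * valency t + (if e = Blue then 0 else 1) < 2 * valency r + (if c = Blue then 0 else 1)"
          using that(3) BR vR by auto
        show "length (leaf_labels (Node e s t)) = N" using that(1) N unfolding same_type_def by (metis size_mset)
        show "distinct (leaf_labels (Node e s t))"
          using that(1) di unfolding same_type_def by (metis mset_eq_imp_distinct_iff)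
        show "valency s < valency t" using that(2,3) AB' BR by auto
        show "rewrite_closed Q" by (rule cl)
        show "Q u" if "bicolored_lyndon u" "same_type u (Node e s t)" for u
          using that(1) by (rule base) (use that(2) \<open>same_type (Node e s t) (Node c l r)\<close> in \<open>simp add: same_type_def\<close>)
      qed
      have v: "min (valency A) (valency R) = valency A" "min (valency B) (valency R) = valency B"
         "min (valency A) (valency B) = valency A" using AB' BR by auto
      have tyd: "same_type (Node e s t) (Node c l r)"
        if "mset (leaf_labels s) + mset (leaf_labels t) = mset (leaf_labels A) + mset (leaf_labels B) + mset (leaf_labels R)"
          "red_count (Node e s t) = red_count (Node c (Node d A B) R)" for e s t
        using that ty unfolding AB(1) same_type_def by (simp add: add.assoc)
      show ?thesis
      proof (cases "c = d")
        case True
        show ?thesis unfolding AB(1) True[symmetric]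
          by (rule rewrite_closedD[OF cl rewrites_to.jacobi])
            (auto intro!: step tyd[unfolded True[symmetric]] simp: valency_Node v)
      next
        case False
        with AB(3) have cd: "c = Red" "d = Blue" by (metis color.exhaust)+
        show ?thesis unfolding AB(1) cd
          by (rule rewrite_closedD[OF cl rewrites_to.mixed_jacobi])
            (auto intro!: step[unfolded cd] tyd[unfolded cd] simp: valency_Node v v[unfolded vR] vR)
      qed
    qed
  qed
  \<comment> \<open>The assumption \<open>smaller\<close> is quantified over the predicate precisely
    for this use: each child is straightened inside its surrounding node.\<close>
  have "Q (Node c L r)" if "bicolored_lyndon L" "same_type L l" for L
    using smaller[OF len(2) _ rewrite_closed_right[OF cl, of c L]] lyn[OF that] di by simp
  then show ?case
    using smaller[OF len(1) _ rewrite_closed_left[OF cl, of c r]] di by simp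
qed

text \<open>Antisymmetry first moves the least label into the left subtree; from there
  \<open>straighten_root\<close> takes over, with the induction on the number of leaves providing
  its assumption about smaller trees.\<close>

theorem straightening:
  assumes "distinct (leaf_labels t)" "rewrite_closed Q"
    and "\<And>s. bicolored_lyndon s \<Longrightarrow> same_type s t \<Longrightarrow> Q s"
  shows "Q t"
  using assms
proof (induction "length (leaf_labels t)" arbitrary: t Q rule: less_induct)
  case less
  show ?case
  proof (cases t)
    case (Leaf a)
    then show ?thesis using less.prems(3)[of t] by (simp add: lyndon_Leaf same_type_def)
  next
    case (Node c l r)
    have root: "Q (Node c a b)" if ty: "same_type (Node c a b) t" and v: "valency a < valency b" for a b
    proof (rule straighten_root[where N = "length (leaf_labels t)"])
      show "Q' u" if "length (leaf_labels u) < length (leaf_labels t)" "distinct (leaf_labels u)" "rewrite_closed Q'"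
        "\<And>s. bicolored_lyndon s \<Longrightarrow> same_type s u \<Longrightarrow> Q' s" for u Q'
        using that by (rule less.hyps)
      show "length (leaf_labels (Node c a b)) = length (leaf_labels t)"
        using ty unfolding same_type_def by (metis size_mset)
      show "distinct (leaf_labels (Node c a b))"
        using ty less.prems(1) unfolding same_type_def by (metis mset_eq_imp_distinct_iff)
      show "Q s" if "bicolored_lyndon s" "same_type s (Node c a b)" for s
        using that ty by (intro less.prems(3)) (simp_all add: same_type_def)
    qed (use v less.prems(2) in auto)
    have "valency l \<noteq> valency r"
      using less.prems(1) valency_in[of l] valency_in[of r] unfolding Node by auto
    then consider "valency l < valency r" | "valency r < valency l" by linarith
    then show ?thesis
    proof cases
      case 1
      then show ?thesis using root[of l r] by (simp add: Node same_type_def)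
    next
      case 2
      then have "Q (Node c r l)" using root[of r l] by (simp add: Node same_type_def)
      then show ?thesis unfolding Node by (intro rewrite_closedD[OF less.prems(2) rewrites_to.antisym]) simp
    qed
  qed
qed

section \<open>Submodules of free modules, quotients and bases\<close>

lemma lookup_pm_scale [simp]: "Poly_Mapping.lookup (pm_scale c f) k = c * Poly_Mapping.lookup f k"
  unfolding pm_scale_def by (simp add: Poly_Mapping.map.rep_eq when_def)

lemma pm_scale_simps [simp]:
  "pm_scale c (f + g) = pm_scale c f + pm_scale c g" "pm_scale (c + d) f = pm_scale c f + pm_scale d f"
  "pm_scale c (pm_scale d f) = pm_scale (c * d) f" "pm_scale 1 f = f" "pm_scale 0 f = 0" "pm_scale c 0 = 0"
  "pm_scale c (Poly_Mapping.single x d) = Poly_Mapping.single x (c * d)"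
  by (rule poly_mapping_eqI; simp add: lookup_add distrib_left distrib_right lookup_single when_def)+

lemma pm_scale_minus_one [simp]: "pm_scale (- 1) f = - f"
  by (rule poly_mapping_eqI) simp

lemma pm_scale_sum: "pm_scale c (\<Sum>x\<in>A. f x) = (\<Sum>x\<in>A. pm_scale c (f x))"
  by (induction A rule: infinite_finite_induct) auto

definition pm_submodule :: "('a \<Rightarrow>\<^sub>0 'k::comm_ring_1) set \<Rightarrow> bool" where
  "pm_submodule N \<longleftrightarrow> 0 \<in> N \<and> (\<forall>x \<in> N. \<forall>y \<in> N. x + y \<in> N) \<and> (\<forall>c. \<forall>x \<in> N. pm_scale c x \<in> N)"

lemma pm_submoduleD:
  assumes "pm_submodule N"
  shows "0 \<in> N" "x \<in> N \<Longrightarrow> y \<in> N \<Longrightarrow> x + y \<in> N" "x \<in> N \<Longrightarrow> pm_scale c x \<in> N"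
    "x \<in> N \<Longrightarrow> - x \<in> N" "x \<in> N \<Longrightarrow> y \<in> N \<Longrightarrow> x - y \<in> N"
proof -
  show *: "0 \<in> N" "x \<in> N \<Longrightarrow> y \<in> N \<Longrightarrow> x + y \<in> N" "x \<in> N \<Longrightarrow> pm_scale c x \<in> N" for x y c
    using assms by (auto simp: pm_submodule_def)
  show m: "x \<in> N \<Longrightarrow> - x \<in> N" for x using *(3)[of x "- 1"] by simp
  show "x \<in> N \<Longrightarrow> y \<in> N \<Longrightarrow> x - y \<in> N" using *(2)[of x "- y"] m by simp
qed

lemma pm_submodule_sum:
  "pm_submodule N \<Longrightarrow> (\<And>x. x \<in> A \<Longrightarrow> f x \<in> N) \<Longrightarrow> (\<Sum>x\<in>A. f x) \<in> N"
  by (induction A rule: infinite_finite_induct) (auto intro: pm_submoduleD)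

definition coset :: "('a \<Rightarrow>\<^sub>0 'k::comm_ring_1) set \<Rightarrow> ('a \<Rightarrow>\<^sub>0 'k) \<Rightarrow> ('a \<Rightarrow>\<^sub>0 'k) set" where
  "coset N x = (\<lambda>h. h + x) ` N"

text \<open>\<open>quotient_module\<close> with the record operations replaced by those of the type.
  Both modules of the theorem are brought into this form, the degenerate interval included.\<close>

definition coset_module ::
    "('a \<Rightarrow>\<^sub>0 'k::comm_ring_1) set \<Rightarrow> ('a \<Rightarrow>\<^sub>0 'k) set \<Rightarrow> ('k, ('a \<Rightarrow>\<^sub>0 'k) set) module" where
  "coset_module Z N =
     \<lparr>carrier = coset N ` Z, mult = undefined, one = undefined,
      zero = N, add = (\<lambda>X Y. \<Union>h\<in>X. \<Union>k\<in>Y. {h + k}),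
      smult = (\<lambda>c X. \<Union>x\<in>X. coset N (pm_scale c x))\<rparr>"

lemma quotient_module_eq_coset_module:
  assumes "add M = (+)" "smult M = pm_scale"
  shows "quotient_module M N = coset_module (carrier M) N"
  unfolding quotient_module_def coset_module_def A_RCOSETS_defs set_add_defs a_r_coset_defs coset_def
  by (auto simp: assms)

locale submodule_pair =
  fixes Z N :: "('a \<Rightarrow>\<^sub>0 'k::comm_ring_1) set"
  assumes Z: "pm_submodule Z" and N: "pm_submodule N" and N_subset: "N \<subseteq> Z"
begin

abbreviation M where "M \<equiv> coset_module Z N"

lemma coset_eq_iff: "coset N x = coset N y \<longleftrightarrow> x - y \<in> N"
proof
  assume "coset N x = coset N y"
  moreover have "x \<in> coset N x" using pm_submoduleD(1)[OF N] by (force simp: coset_def)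
  ultimately obtain h where "h \<in> N" "x = h + y" by (auto simp: coset_def)
  then show "x - y \<in> N" by simp
next
  assume *: "x - y \<in> N"
  show "coset N x = coset N y"
  proof (intro equalityI subsetI)
    fix z assume "z \<in> coset N x"
    then obtain h where "h \<in> N" "z = h + x" by (auto simp: coset_def)
    then have "z = (h + (x - y)) + y" "h + (x - y) \<in> N" using * pm_submoduleD(2)[OF N] by auto
    then show "z \<in> coset N y" unfolding coset_def by (metis imageI)
  next
    fix z assume "z \<in> coset N y"
    then obtain h where "h \<in> N" "z = h + y" by (auto simp: coset_def)
    then have "z = (h - (x - y)) + x" "h - (x - y) \<in> N" using * pm_submoduleD(5)[OF N] by auto
    then show "z \<in> coset N x" unfolding coset_def by (metis imageI)
  qed
qed

lemma coset_zero: "coset N 0 = N"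
  by (auto simp: coset_def)

lemma coset_add: "add M (coset N x) (coset N y) = coset N (x + y)"
proof -
  have "\<exists>h\<in>N. \<exists>k\<in>N. g + (x + y) = h + x + (k + y)" if "g \<in> N" for g
    using that pm_submoduleD(1)[OF N] by (intro bexI[of _ g] bexI[of _ 0]) (auto simp: ac_simps)
  moreover have "\<exists>g\<in>N. h + x + (k + y) = g + (x + y)" if "h \<in> N" "k \<in> N" for h k
    using that pm_submoduleD(2)[OF N] by (intro bexI[of _ "h + k"]) (auto simp: ac_simps)
  ultimately show ?thesis unfolding coset_module_def coset_def by auto
qed

lemma coset_smult: "smult M c (coset N x) = coset N (pm_scale c x)"
proof -
  have "coset N (pm_scale c y) = coset N (pm_scale c x)" if "y \<in> coset N x" for y
  proof -
    from that obtain h where "h \<in> N" "y = h + x" by (auto simp: coset_def)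
    then show ?thesis using pm_submoduleD(3)[OF N] by (simp add: coset_eq_iff)
  qed
  note * = this
  have "x \<in> coset N x" using pm_submoduleD(1)[OF N] by (force simp: coset_def)
  then have "coset N x \<noteq> {}" by blast
  have "smult M c (coset N x) = (\<Union>y\<in>coset N x. coset N (pm_scale c y))" by (simp add: coset_module_def)
  also have "\<dots> = (\<Union>y\<in>coset N x. coset N (pm_scale c x))" by (intro SUP_cong refl *)
  also have "\<dots> = coset N (pm_scale c x)" using \<open>coset N x \<noteq> {}\<close> by simp
  finally show ?thesis .
qed

lemma carrier_M: "carrier M = coset N ` Z" and zero_M: "zero M = coset N 0"
  by (simp_all add: coset_module_def coset_zero)

lemma module_M: "Module.module class_ring M"
proof (rule Module.moduleI)
  show "cring (class_ring :: 'k ring)" by unfold_locales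
  show "abelian_group M"
  proof (rule abelian_groupI)
    fix X assume "X \<in> carrier M"
    then obtain x where "x \<in> Z" "X = coset N x" by (auto simp: carrier_M)
    then show "\<exists>Y\<in>carrier M. Y \<oplus>\<^bsub>M\<^esub> X = \<zero>\<^bsub>M\<^esub>"
      using pm_submoduleD(4)[OF Z] by (auto simp: carrier_M zero_M coset_add intro!: bexI[of _ "- x"])
  qed (use pm_submoduleD[OF Z] in \<open>auto simp: carrier_M zero_M coset_add ac_simps\<close>)
qed (use pm_submoduleD[OF Z] in \<open>auto simp: carrier_M zero_M coset_add coset_smult\<close>)

lemma lincomb_cosets:
  assumes "finite A" "\<And>v. v \<in> A \<Longrightarrow> v = coset N (x v)" "\<And>v. v \<in> A \<Longrightarrow> x v \<in> Z"
  shows "LinearCombinations.module.lincomb M a A = coset N (\<Sum>v\<in>A. pm_scale (a v) (x v))"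
proof -
  interpret Module.module class_ring M by (rule module_M)
  show ?thesis unfolding lincomb_def using assms
  proof (induction A)
    case empty
    then show ?case by (simp add: zero_M)
  next
    case (insert v A)
    have c: "a w \<odot>\<^bsub>M\<^esub> w = coset N (pm_scale (a w) (x w))" if "w \<in> insert v A" for w
      using insert.prems(1)[OF that] coset_smult[of "a w" "x w"] by simp
    have cl: "a w \<odot>\<^bsub>M\<^esub> w \<in> carrier M" if "w \<in> insert v A" for w
      unfolding c[OF that] using insert.prems(2)[OF that] pm_submoduleD(3)[OF Z] by (auto simp: carrier_M)
    have "(\<Oplus>\<^bsub>M\<^esub>w\<in>insert v A. a w \<odot>\<^bsub>M\<^esub> w) = a v \<odot>\<^bsub>M\<^esub> v \<oplus>\<^bsub>M\<^esub> (\<Oplus>\<^bsub>M\<^esub>w\<in>A. a w \<odot>\<^bsub>M\<^esub> w)"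
      using insert.hyps cl by (intro M.finsum_insert) auto
    also have "(\<Oplus>\<^bsub>M\<^esub>w\<in>A. a w \<odot>\<^bsub>M\<^esub> w) = coset N (\<Sum>w\<in>A. pm_scale (a w) (x w))"
      using insert.prems by (intro insert.IH) auto
    finally show ?case using insert.hyps c[of v] by (simp add: coset_add)
  qed
qed

end

text \<open>The submodule generated by \<open>N\<close> and the family \<open>F\<close>, that is,
  the preimage of a span in the quotient by \<open>N\<close>. Spanning can thus be argued with
  representatives instead of cosets.\<close>

definition combinations ::
    "('a \<Rightarrow>\<^sub>0 'k::comm_ring_1) set \<Rightarrow> ('i \<Rightarrow> 'a \<Rightarrow>\<^sub>0 'k) \<Rightarrow> 'i set \<Rightarrow> ('a \<Rightarrow>\<^sub>0 'k) set" where
  "combinations N F I = {x. \<exists>A c. finite A \<and> A \<subseteq> I \<and> x - (\<Sum>t\<in>A. pm_scale (c t) (F t)) \<in> N}"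

lemma pm_submodule_combinations:
  assumes N: "pm_submodule N"
  shows "pm_submodule (combinations N F I)"
  unfolding pm_submodule_def
proof (intro conjI ballI allI)
  show "0 \<in> combinations N F I"
    using pm_submoduleD(1)[OF N] unfolding combinations_def by (auto intro!: exI[of _ "{}"])
  fix x assume "x \<in> combinations N F I"
  then obtain A a where A: "finite A" "A \<subseteq> I" "x - (\<Sum>t\<in>A. pm_scale (a t) (F t)) \<in> N"
    by (auto simp: combinations_def)
  have "pm_scale c x - (\<Sum>t\<in>A. pm_scale (c * a t) (F t)) = pm_scale c (x - (\<Sum>t\<in>A. pm_scale (a t) (F t)))" for c
    by (rule poly_mapping_eqI) (simp add: lookup_minus lookup_sum right_diff_distrib sum_distrib_left mult.assoc)
  then show "pm_scale c x \<in> combinations N F I" for c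
    using A pm_submoduleD(3)[OF N A(3), of c] unfolding combinations_def
    by (intro CollectI exI[of _ A] exI[of _ "\<lambda>t. c * a t"]) simp
  fix y assume "y \<in> combinations N F I"
  then obtain B b where B: "finite B" "B \<subseteq> I" "y - (\<Sum>t\<in>B. pm_scale (b t) (F t)) \<in> N"
    by (auto simp: combinations_def)
  define d where "d t = (if t \<in> A then a t else 0) + (if t \<in> B then b t else 0)" for t
  have "(\<Sum>t\<in>A \<union> B. pm_scale (d t) (F t)) =
      (\<Sum>t\<in>A \<union> B. pm_scale (if t \<in> A then a t else 0) (F t)) + (\<Sum>t\<in>A \<union> B. pm_scale (if t \<in> B then b t else 0) (F t))"
    by (simp add: d_def sum.distrib)
  also have "(\<Sum>t\<in>A \<union> B. pm_scale (if t \<in> A then a t else 0) (F t)) = (\<Sum>t\<in>A. pm_scale (a t) (F t))"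
    using A(1) B(1) by (intro sum.mono_neutral_cong_right) auto
  also have "(\<Sum>t\<in>A \<union> B. pm_scale (if t \<in> B then b t else 0) (F t)) = (\<Sum>t\<in>B. pm_scale (b t) (F t))"
    using A(1) B(1) by (intro sum.mono_neutral_cong_right) auto
  finally have eq: "x + y - (\<Sum>t\<in>A \<union> B. pm_scale (d t) (F t)) =
      (x - (\<Sum>t\<in>A. pm_scale (a t) (F t))) + (y - (\<Sum>t\<in>B. pm_scale (b t) (F t)))" by simp
  have "x + y - (\<Sum>t\<in>A \<union> B. pm_scale (d t) (F t)) \<in> N"
    unfolding eq using A(3) B(3) by (rule pm_submoduleD(2)[OF N])
  then show "x + y \<in> combinations N F I"
    using A(1,2) B(1,2) unfolding combinations_def
    by (intro CollectI exI[of _ "A \<union> B"] exI[of _ d] conjI) simp_all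
qed

lemma combinations_base: "pm_submodule N \<Longrightarrow> t \<in> I \<Longrightarrow> F t \<in> combinations N F I"
  unfolding combinations_def using pm_submoduleD(1)
  by (intro CollectI exI[of _ "{t}"] exI[of _ "\<lambda>_. 1"]) auto

lemma subset_combinations: "N \<subseteq> combinations N F I"
  unfolding combinations_def by (auto intro!: exI[of _ "{}"])

lemma combinations_subset:
  assumes "pm_submodule Z" "N \<subseteq> Z" "\<And>t. t \<in> I \<Longrightarrow> F t \<in> Z"
  shows "combinations N F I \<subseteq> Z"
proof
  fix x assume "x \<in> combinations N F I"
  then obtain A a where A: "finite A" "A \<subseteq> I" "x - (\<Sum>t\<in>A. pm_scale (a t) (F t)) \<in> N"
    by (auto simp: combinations_def)
  then have "x - (\<Sum>t\<in>A. pm_scale (a t) (F t)) \<in> Z" using assms(2) by blast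
  moreover have "(\<Sum>t\<in>A. pm_scale (a t) (F t)) \<in> Z"
    using assms A(2) by (intro pm_submodule_sum) (auto intro: pm_submoduleD(3))
  ultimately show "x \<in> Z" using pm_submoduleD(2)[OF assms(1)] by fastforce
qed

context submodule_pair
begin

lemma span_cosets:
  assumes "\<And>t. t \<in> I \<Longrightarrow> F t \<in> Z"
  shows "LinearCombinations.module.span class_ring M ((\<lambda>t. coset N (F t)) ` I) = coset N ` combinations N F I"
proof -
  interpret Module.module class_ring M by (rule module_M)
  show ?thesis
  proof (intro equalityI subsetI)
    fix X assume "X \<in> span ((\<lambda>t. coset N (F t)) ` I)"
    then obtain a A where A: "finite A" "A \<subseteq> (\<lambda>t. coset N (F t)) ` I" "X = lincomb a A"
      unfolding span_def by blast
    \<comment> \<open>Linear combinations in the quotient are indexed by cosets, and different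
      indices might share one, so an index is chosen for each coset.\<close>
    have "\<forall>v\<in>A. \<exists>t. t \<in> I \<and> v = coset N (F t)" using A(2) by blast
    from bchoice[OF this] obtain u where u: "\<And>v. v \<in> A \<Longrightarrow> u v \<in> I \<and> v = coset N (F (u v))" by blast
    have "X = coset N (\<Sum>v\<in>A. pm_scale (a v) (F (u v)))"
      unfolding A(3) using A(1) u assms by (intro lincomb_cosets) auto
    moreover have "(\<Sum>v\<in>A. pm_scale (a v) (F (u v))) \<in> combinations N F I"
      using u by (intro pm_submodule_sum pm_submodule_combinations N pm_submoduleD(3) combinations_base) auto
    ultimately show "X \<in> coset N ` combinations N F I" by blast
  next
    fix X assume "X \<in> coset N ` combinations N F I"
    then obtain x A c where A: "X = coset N x" "finite A" "A \<subseteq> I" "x - (\<Sum>t\<in>A. pm_scale (c t) (F t)) \<in> N"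
      unfolding combinations_def by blast
    have X: "X = coset N (\<Sum>t\<in>A. pm_scale (c t) (F t))" using A by (simp add: coset_eq_iff)
    have inS: "coset N (F t) \<in> span ((\<lambda>t. coset N (F t)) ` I)" if "t \<in> I" for t
      using that assms by (intro subsetD[OF in_own_span]) (auto simp: carrier_M)
    have sub: "submodule class_ring (span ((\<lambda>t. coset N (F t)) ` I)) M"
      using assms by (intro span_is_submodule) (auto simp: carrier_M)
    have "coset N (\<Sum>t\<in>A. pm_scale (c t) (F t)) \<in> span ((\<lambda>t. coset N (F t)) ` I)"
      using A(2,3)
    proof (induction A)
      case empty
      then show ?case using submodule.zero_closed[OF sub] by (simp add: zero_M)
    next
      case (insert t A)
      then show ?case
        using submodule.m_closed[OF sub, of "coset N (pm_scale (c t) (F t))" "coset N (\<Sum>t\<in>A. pm_scale (c t) (F t))"]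
          submodule.smult_closed[OF sub, of "c t" "coset N (F t)"] inS[of t]
        by (simp add: coset_add coset_smult)
    qed
    then show "X \<in> span ((\<lambda>t. coset N (F t)) ` I)" using X by simp
  qed
qed

text \<open>Independence is by triangularity: among the indices with nonzero coefficient, the functional of one of
  least rank sees only that index.\<close>

theorem module_basis_cosets:
  fixes \<phi> :: "'i \<Rightarrow> ('a \<Rightarrow>\<^sub>0 'k) \<Rightarrow> 'k" and rank :: "'i \<Rightarrow> nat"
  assumes F: "\<And>t. t \<in> I \<Longrightarrow> F t \<in> Z" and spanning: "Z \<subseteq> combinations N F I"
    and add: "\<And>t x y. t \<in> I \<Longrightarrow> \<phi> t (x + y) = \<phi> t x + \<phi> t y"
    and scale: "\<And>t c x. t \<in> I \<Longrightarrow> \<phi> t (pm_scale c x) = c * \<phi> t x"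
    and kills: "\<And>t x. t \<in> I \<Longrightarrow> x \<in> N \<Longrightarrow> \<phi> t x = 0"
    and diag: "\<And>t. t \<in> I \<Longrightarrow> \<phi> t (F t) = 1"
    and triangular: "\<And>s t. s \<in> I \<Longrightarrow> t \<in> I \<Longrightarrow> \<phi> t (F s) \<noteq> 0 \<Longrightarrow> s = t \<or> rank s < rank t"
  shows "module_basis class_ring M ((\<lambda>t. coset N (F t)) ` I)"
proof -
  interpret Module.module class_ring M by (rule module_M)
  have "\<not> lin_dep ((\<lambda>t. coset N (F t)) ` I)"
  proof
    assume "lin_dep ((\<lambda>t. coset N (F t)) ` I)"
    then obtain A a v where A: "finite A" "A \<subseteq> (\<lambda>t. coset N (F t)) ` I" "lincomb a A = \<zero>\<^bsub>M\<^esub>" "v \<in> A" "a v \<noteq> 0"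
      unfolding lin_dep_def by auto
    have "\<forall>v\<in>A. \<exists>t. t \<in> I \<and> v = coset N (F t)" using A(2) by blast
    from bchoice[OF this] obtain u where u: "\<And>v. v \<in> A \<Longrightarrow> u v \<in> I \<and> v = coset N (F (u v))" by blast
    have "coset N (\<Sum>v\<in>A. pm_scale (a v) (F (u v))) = coset N 0"
      unfolding zero_M[symmetric] A(3)[symmetric] using A(1) u F by (intro lincomb_cosets[symmetric]) auto
    then have mem: "(\<Sum>v\<in>A. pm_scale (a v) (F (u v))) \<in> N" by (simp add: coset_eq_iff)
    obtain w where w: "w \<in> A" "a w \<noteq> 0" "\<And>v. v \<in> A \<Longrightarrow> a v \<noteq> 0 \<Longrightarrow> rank (u w) \<le> rank (u v)"
      using ex_has_least_nat[of "\<lambda>v. v \<in> A \<and> a v \<noteq> 0" v "\<lambda>v. rank (u v)"] A(4,5) by blast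
    let ?t = "u w"
    have t: "?t \<in> I" using u w(1) by auto
    have zero: "\<phi> ?t 0 = 0" using kills[OF t] pm_submoduleD(1)[OF N] .
    have "\<phi> ?t (\<Sum>v\<in>A. pm_scale (a v) (F (u v))) = (\<Sum>v\<in>A. a v * \<phi> ?t (F (u v)))"
      using A(1) by (induction A) (auto simp: zero add[OF t] scale[OF t])
    also have "\<dots> = (\<Sum>v\<in>A. if v = w then a w else 0)"
    proof (intro sum.cong refl)
      fix v assume v: "v \<in> A"
      have "u v = ?t \<longleftrightarrow> v = w" using u[OF v] u[OF w(1)] by metis
      moreover have "a v * \<phi> ?t (F (u v)) = 0" if "u v \<noteq> ?t"
        using triangular[of "u v" ?t] u[OF v] t w(3)[OF v] that by fastforce
      ultimately show "a v * \<phi> ?t (F (u v)) = (if v = w then a w else 0)" using diag[OF t] by auto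
    qed
    also have "\<dots> = a w" using A(1) w(1) by simp
    finally show False using kills[OF t mem] w(2) by simp
  qed
  moreover have "combinations N F I = Z"
    using combinations_subset[where F = F and I = I, OF Z N_subset F] spanning by (rule equalityI)
  then have "span ((\<lambda>t. coset N (F t)) ` I) = carrier M" by (simp add: span_cosets[OF F] carrier_M)
  moreover have "(\<lambda>t. coset N (F t)) ` I \<subseteq> carrier M" using F by (auto simp: carrier_M)
  ultimately show ?thesis unfolding module_basis_def using module_M by blast
qed

end

section \<open>The graph of a tree\<close>

fun end_vertex :: "rword \<Rightarrow> nat" where
  "end_vertex (RW a E None) = a"
| "end_vertex (RW a E (Some w)) = end_vertex w"

lemma end_vertex_in_labels: "end_vertex W \<in># labels W"
  by (induction W rule: end_vertex.induct) auto

lemma edges_attach_end: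
  "edges (attach_end c A B) = insert (c, end_vertex A, head B) (edges A \<union> edges B)"
proof (induction c A B rule: attach_end.induct)
  case (1 c a E w B)
  then show ?case by (simp add: insert_commute Un_assoc Un_left_commute)
qed auto

text \<open>The edges are listed in postorder, so that the edge created by a node has the position
  of that node; signs of orders of contraction refer to this list.\<close>

fun tree_edges :: "ltree \<Rightarrow> (color \<times> nat \<times> nat) list" where
  "tree_edges (Leaf a) = []"
| "tree_edges (Node c l r) = tree_edges l @ tree_edges r @ [(c, end_vertex (word_of l), hd (leaf_labels r))]"

lemma edges_word_of: "edges (word_of T) = set (tree_edges T)"
  by (induction T) (auto simp: edges_attach_end head_word_of)

lemma tree_edges_labels:
  "(c, a, b) \<in> set (tree_edges T) \<Longrightarrow> a \<in> set (leaf_labels T) \<and> b \<in> set (leaf_labels T)"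
  using edges_labels[of c a b "word_of T"] by (simp add: edges_word_of)

text \<open>The common source of triangularity: it mentions only crossings, and either functional
  being nonzero at \<open>T'\<close> provides them.\<close>

lemma tree_triangular:
  assumes "bicolored_lyndon T" "bicolored_lyndon T'" "distinct (leaf_labels T)"
    and "mset (leaf_labels T') = mset (leaf_labels T)" "bounded b (word_of T)"
    and "\<And>nd. nd \<in> set (postorder T') \<Longrightarrow> crossed (set (tree_edges T)) nd"
  shows "T' = T \<or> val b (word_of T') < val b (word_of T)"
proof -
  have d: "distinct (leaf_labels T')" using assms(3,4) by (metis mset_eq_imp_distinct_iff)
  have "splits_as (word_of T) T'"
    using assms(4,6) d by (intro splits_as_if_crossed) (simp_all add: edges_word_of)
  moreover have "normalized T'" using assms(2) by (simp add: bicolored_lyndon_def)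
  ultimately have "weakly_less b (word_of T') (word_of T)" using d assms(5) by (intro word_of_le)
  then show ?thesis using word_of_inj[OF _ assms(2,1) d assms(3)] by (auto simp: weakly_less_def)
qed

section \<open>Functionals on the free Lie algebra\<close>

definition linear_ext :: "('a \<Rightarrow> 'k::comm_ring_1) \<Rightarrow> ('a \<Rightarrow>\<^sub>0 'k) \<Rightarrow> 'k" where
  "linear_ext g f = (\<Sum>x\<in>Poly_Mapping.keys f. Poly_Mapping.lookup f x * g x)"

lemma linear_ext_superset:
  "finite A \<Longrightarrow> Poly_Mapping.keys f \<subseteq> A \<Longrightarrow> linear_ext g f = (\<Sum>x\<in>A. Poly_Mapping.lookup f x * g x)"
  unfolding linear_ext_def by (intro sum.mono_neutral_left) (auto simp: in_keys_iff)

lemma linear_ext_add: "linear_ext g (x + y) = linear_ext g x + linear_ext g y"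
proof -
  let ?A = "Poly_Mapping.keys x \<union> Poly_Mapping.keys y"
  have "linear_ext g (x + y) = (\<Sum>k\<in>?A. Poly_Mapping.lookup (x + y) k * g k)"
    by (intro linear_ext_superset keys_add) simp
  also have "\<dots> = linear_ext g x + linear_ext g y"
    by (subst (1 2) linear_ext_superset[of ?A]) (simp_all add: lookup_add distrib_right sum.distrib)
  finally show ?thesis .
qed

lemma linear_ext_scale: "linear_ext g (pm_scale c x) = c * linear_ext g x"
proof -
  have "Poly_Mapping.keys (pm_scale c x) \<subseteq> Poly_Mapping.keys x" by (auto simp: in_keys_iff)
  then show ?thesis
    by (subst linear_ext_superset[of "Poly_Mapping.keys x"])
      (simp_all add: linear_ext_def sum_distrib_left mult.assoc)
qed

lemma linear_ext_single [simp]: "linear_ext g (Poly_Mapping.single x c) = c * g x"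
  by (subst linear_ext_superset[of "{x}"]) auto

lemma linear_ext_zero [simp]: "linear_ext g 0 = 0" "linear_ext (\<lambda>_. 0) f = 0"
  by (simp_all add: linear_ext_def)

lemma linear_ext_sum: "linear_ext g (\<Sum>i\<in>A. f i) = (\<Sum>i\<in>A. linear_ext g (f i))"
  by (induction A rule: infinite_finite_induct) (simp_all add: linear_ext_add)

lemma linear_ext_fun_add: "linear_ext (\<lambda>x. g x + h x) f = linear_ext g f + linear_ext h f"
  by (simp add: linear_ext_def distrib_left sum.distrib)

lemma linear_ext_fun_mult: "linear_ext (\<lambda>x. c * g x) f = c * linear_ext g f"
  by (simp add: linear_ext_def sum_distrib_left mult.left_commute)

lemma linear_ext_swap:
  "linear_ext (\<lambda>s. linear_ext (\<lambda>t. h s t) y) x = linear_ext (\<lambda>t. linear_ext (\<lambda>s. h s t) x) y"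
proof -
  have "linear_ext (\<lambda>s. linear_ext (\<lambda>t. h s t) y) x =
      (\<Sum>s\<in>Poly_Mapping.keys x. \<Sum>t\<in>Poly_Mapping.keys y. Poly_Mapping.lookup x s * Poly_Mapping.lookup y t * h s t)"
    by (simp add: linear_ext_def sum_distrib_left mult.assoc)
  also have "\<dots> = linear_ext (\<lambda>t. linear_ext (\<lambda>s. h s t) x) y"
    by (subst sum.swap) (simp add: linear_ext_def sum_distrib_left mult_ac)
  finally show ?thesis .
qed

text \<open>Antisymmetry alone leaves the diagonal terms undetermined when 2 is not invertible, so
  their vanishing is a separate hypothesis.\<close>

lemma linear_ext_alternating:
  assumes "\<And>s t. h s t = - h t s" "\<And>s. h s s = 0"
  shows "linear_ext (\<lambda>s. linear_ext (\<lambda>t. h s t) x) x = 0"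
proof -
  have *: "(\<Sum>s\<in>K. \<Sum>t\<in>K. f s t) = 0"
    if "finite K" "\<And>s t. f s t = - f t s" "\<And>s. f s s = 0" for K and f :: "'a \<Rightarrow> 'a \<Rightarrow> 'b"
    using that(1)
  proof (induction K)
    case (insert s K)
    have "(\<Sum>t\<in>K. f t s) = - (\<Sum>t\<in>K. f s t)" using that(2)[of _ s] by (simp add: sum_negf)
    with insert show ?case by (simp add: sum.distrib that(3))
  qed simp
  have "linear_ext (\<lambda>s. linear_ext (\<lambda>t. h s t) x) x =
      (\<Sum>s\<in>Poly_Mapping.keys x. \<Sum>t\<in>Poly_Mapping.keys x. Poly_Mapping.lookup x s * Poly_Mapping.lookup x t * h s t)"
    by (simp add: linear_ext_def sum_distrib_left mult.assoc)
  also have "\<dots> = 0"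
    by (rule *) (simp_all add: assms(2), subst assms(1), simp add: mult.commute)
  finally show ?thesis .
qed

lemma bracket_superset:
  assumes "finite A" "Poly_Mapping.keys x \<subseteq> A" "finite B" "Poly_Mapping.keys y \<subseteq> B"
  shows "bracket c x y = (\<Sum>s\<in>A. \<Sum>t\<in>B.
    Poly_Mapping.single (Node c s t) (Poly_Mapping.lookup x s * Poly_Mapping.lookup y t))"
proof -
  have "bracket c x y = (\<Sum>s\<in>A. \<Sum>t\<in>Poly_Mapping.keys y.
    Poly_Mapping.single (Node c s t) (Poly_Mapping.lookup x s * Poly_Mapping.lookup y t))"
    unfolding bracket_def using assms by (intro sum.mono_neutral_left) (auto simp: in_keys_iff)
  also have "\<dots> = (\<Sum>s\<in>A. \<Sum>t\<in>B.
    Poly_Mapping.single (Node c s t) (Poly_Mapping.lookup x s * Poly_Mapping.lookup y t))"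
    using assms by (intro sum.cong refl sum.mono_neutral_left) (auto simp: in_keys_iff)
  finally show ?thesis .
qed

lemma linear_ext_bracket:
  "linear_ext g (bracket c x y) = linear_ext (\<lambda>s. linear_ext (\<lambda>t. g (Node c s t)) y) x"
  unfolding bracket_def linear_ext_sum linear_ext_single
  by (simp add: linear_ext_def sum_distrib_left mult.assoc)

lemma bracket_add_left: "bracket c (x + x') y = bracket c x y + bracket c x' y"
proof -
  let ?A = "Poly_Mapping.keys x \<union> Poly_Mapping.keys x'"
  have "bracket c z y = (\<Sum>s\<in>?A. \<Sum>t\<in>Poly_Mapping.keys y.
      Poly_Mapping.single (Node c s t) (Poly_Mapping.lookup z s * Poly_Mapping.lookup y t))"
    if "Poly_Mapping.keys z \<subseteq> ?A" for z
    using that by (intro bracket_superset) auto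
  from this[of x] this[of x'] this[OF keys_add] show ?thesis
    by (simp add: lookup_add distrib_right single_add sum.distrib)
qed

lemma bracket_add_right: "bracket c x (y + y') = bracket c x y + bracket c x y'"
proof -
  let ?B = "Poly_Mapping.keys y \<union> Poly_Mapping.keys y'"
  have "bracket c x z = (\<Sum>s\<in>Poly_Mapping.keys x. \<Sum>t\<in>?B.
      Poly_Mapping.single (Node c s t) (Poly_Mapping.lookup x s * Poly_Mapping.lookup z t))"
    if "Poly_Mapping.keys z \<subseteq> ?B" for z
    using that by (intro bracket_superset) auto
  from this[of y] this[of y'] this[OF keys_add] show ?thesis
    by (simp add: lookup_add distrib_left single_add sum.distrib)
qed

lemma bracket_scale_left: "bracket c (pm_scale k x) y = pm_scale k (bracket c x y)"
proof -
  have "Poly_Mapping.keys (pm_scale k x) \<subseteq> Poly_Mapping.keys x" by (auto simp: in_keys_iff)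
  then have "bracket c (pm_scale k x) y = (\<Sum>s\<in>Poly_Mapping.keys x. \<Sum>t\<in>Poly_Mapping.keys y.
      Poly_Mapping.single (Node c s t) (Poly_Mapping.lookup (pm_scale k x) s * Poly_Mapping.lookup y t))"
    by (intro bracket_superset) auto
  then show ?thesis by (simp add: bracket_def pm_scale_sum mult.assoc)
qed

lemma bracket_scale_right: "bracket c x (pm_scale k y) = pm_scale k (bracket c x y)"
proof -
  have "Poly_Mapping.keys (pm_scale k y) \<subseteq> Poly_Mapping.keys y" by (auto simp: in_keys_iff)
  then have "bracket c x (pm_scale k y) = (\<Sum>s\<in>Poly_Mapping.keys x. \<Sum>t\<in>Poly_Mapping.keys y.
      Poly_Mapping.single (Node c s t) (Poly_Mapping.lookup x s * Poly_Mapping.lookup (pm_scale k y) t))"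
    by (intro bracket_superset) auto
  then show ?thesis by (simp add: bracket_def pm_scale_sum mult.left_commute)
qed

lemma bracket_single [simp]:
  "bracket c (Poly_Mapping.single s a) (Poly_Mapping.single t b) = Poly_Mapping.single (Node c s t) (a * b)"
  by (subst bracket_superset[of "{s}" _ "{t}"]) auto

lemma tree_bracket_eq_single: "tree_bracket T = Poly_Mapping.single T 1"
  by (induction T) simp_all

text \<open>Every antisymmetric matrix, here the signed adjacency matrix of a colored graph \<open>G\<close>, defines a functional:
  by bilinearity of \<open>edge_cut\<close> the Jacobi identities hold for the product of the values of \<open>edge_cut\<close> at the nodes.\<close>

definition orientation :: "(color \<times> nat \<times> nat) set \<Rightarrow> color \<Rightarrow> nat \<Rightarrow> nat \<Rightarrow> 'k::comm_ring_1" where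
  "orientation G c a b = (if (c, a, b) \<in> G then 1 else 0) - (if (c, b, a) \<in> G then 1 else 0)"

definition edge_cut :: "(color \<times> nat \<times> nat) set \<Rightarrow> color \<Rightarrow> nat multiset \<Rightarrow> nat multiset \<Rightarrow> 'k::comm_ring_1" where
  "edge_cut G c M N = (\<Sum>a\<in>#M. \<Sum>b\<in>#N. orientation G c a b)"

lemma edge_cut_add [simp]:
  "edge_cut G c (M + M') N = edge_cut G c M N + edge_cut G c M' N" "edge_cut G c M (N + N') = edge_cut G c M N + edge_cut G c M N'"
  by (simp_all add: edge_cut_def sum_mset.distrib)

lemma edge_cut_simps [simp]:
  "edge_cut G c {#} N = 0" "edge_cut G c (add_mset a M) N = (\<Sum>b\<in>#N. orientation G c a b) + edge_cut G c M N"
  by (simp_all add: edge_cut_def)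

lemma edge_cut_add_right:
  "edge_cut G c M {#} = 0" "edge_cut G c M (add_mset b N) = (\<Sum>a\<in>#M. orientation G c a b) + edge_cut G c M N"
  by (simp_all add: edge_cut_def sum_mset.distrib)

lemma orientation_antisym: "orientation G c b a = - orientation G c a b"
  by (simp add: orientation_def)

lemma sum_mset_neg: "(\<Sum>a\<in>#M. - f a) = - (\<Sum>a\<in>#M. f a :: 'k::comm_ring_1)"
  by (induction M) simp_all

lemma edge_cut_antisym: "edge_cut G c N M = - (edge_cut G c M N :: 'k::comm_ring_1)"
proof (induction M)
  case (add a M)
  have "(\<Sum>b\<in>#N. orientation G c b a) = - (\<Sum>b\<in>#N. orientation G c a b :: 'k)"
    by (simp add: orientation_antisym[of G c _ a] sum_mset_neg)
  with add show ?case by (simp add: edge_cut_add_right)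
qed (simp add: edge_cut_add_right)

lemma edge_cut_self: "edge_cut G c M M = (0 :: 'k::comm_ring_1)"
proof (induction M)
  case (add a M)
  have "(\<Sum>b\<in>#M. orientation G c b a) = - (\<Sum>b\<in>#M. orientation G c a b :: 'k)"
    by (simp add: orientation_antisym[of G c _ a] sum_mset_neg)
  with add show ?case by (simp add: edge_cut_add_right orientation_def)
qed simp

fun tree_weight :: "(color \<times> nat \<times> nat) set \<Rightarrow> ltree \<Rightarrow> 'k::comm_ring_1" where
  "tree_weight G (Leaf a) = 1"
| "tree_weight G (Node c l r) =
     tree_weight G l * tree_weight G r * edge_cut G c (mset (leaf_labels l)) (mset (leaf_labels r))"

text \<open>The factor at a node depends on the labels of both children, so for a fixed child it is
  not constant in the other. Restricting to label multiset \<open>\<gamma>\<close> lets one child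
  determine the labels of the other; the weight is then a constant times a graded weight of the
  other child, which is what passing to multiples in the ideal requires.\<close>

definition graded_weight :: "(color \<times> nat \<times> nat) set \<Rightarrow> nat multiset \<Rightarrow> ltree \<Rightarrow> 'k::comm_ring_1" where
  "graded_weight G \<gamma> T = (if mset (leaf_labels T) = \<gamma> then tree_weight G T else 0)"

lemma graded_weight_left:
  "graded_weight G \<gamma> (Node c s t) = (if mset (leaf_labels s) \<subseteq># \<gamma> then
     tree_weight G s * edge_cut G c (mset (leaf_labels s)) (\<gamma> - mset (leaf_labels s)) else 0) *
     graded_weight G (\<gamma> - mset (leaf_labels s)) t"
proof -
  have "mset (leaf_labels s) + mset (leaf_labels t) = \<gamma> \<longleftrightarrow>
      mset (leaf_labels s) \<subseteq># \<gamma> \<and> mset (leaf_labels t) = \<gamma> - mset (leaf_labels s)"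
    by (metis add_diff_cancel_left' mset_subset_eq_add_left subset_mset.add_diff_inverse)
  then show ?thesis by (simp add: graded_weight_def)
qed

lemma graded_weight_right:
  "graded_weight G \<gamma> (Node c s t) = (if mset (leaf_labels t) \<subseteq># \<gamma> then
     tree_weight G t * edge_cut G c (\<gamma> - mset (leaf_labels t)) (mset (leaf_labels t)) else 0) *
     graded_weight G (\<gamma> - mset (leaf_labels t)) s"
proof -
  have "mset (leaf_labels s) + mset (leaf_labels t) = \<gamma> \<longleftrightarrow>
      mset (leaf_labels t) \<subseteq># \<gamma> \<and> mset (leaf_labels s) = \<gamma> - mset (leaf_labels t)"
    by (metis add_diff_cancel_right' mset_subset_eq_add_right subset_mset.diff_add)
  then show ?thesis by (simp add: graded_weight_def)
qed

lemma graded_weight_antisym: "graded_weight G \<gamma> (Node c s t) = - (graded_weight G \<gamma> (Node c t s) :: 'k::comm_ring_1)"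
  using edge_cut_antisym[of G c "mset (leaf_labels t)" "mset (leaf_labels s)", where 'k = 'k]
  by (simp add: graded_weight_def add.commute mult_ac)

text \<open>After division by the common tree weights, bilinearity turns the cyclic sum into six
  products of a cut of color \<open>c\<close> with a cut of color \<open>d\<close> between the three
  label multisets. Their sum is antisymmetric in the two colors, which yields the plain and the
  mixed identity.\<close>

lemma graded_weight_jacobi:
  fixes s t u :: ltree and G :: "(color \<times> nat \<times> nat) set" and \<gamma> :: "nat multiset"
  defines "J \<equiv> \<lambda>c d. graded_weight G \<gamma> (Node c s (Node d t u)) + graded_weight G \<gamma> (Node c u (Node d s t))
    + graded_weight G \<gamma> (Node c t (Node d u s)) :: 'k::comm_ring_1"
  shows "J c c = 0" "J c d + J d c = 0"
proof -
  define S T U where "S = mset (leaf_labels s)" and "T = mset (leaf_labels t)" and "U = mset (leaf_labels u)"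
  note anti = edge_cut_antisym[of G _ T S, where 'k = 'k] edge_cut_antisym[of G _ U T, where 'k = 'k]
    edge_cut_antisym[of G _ U S, where 'k = 'k]
  show "J c c = 0"
    unfolding J_def graded_weight_def
    by (simp add: S_def[symmetric] T_def[symmetric] U_def[symmetric] anti add_ac algebra_simps)
  show "J c d + J d c = 0"
    unfolding J_def graded_weight_def
    by (simp add: S_def[symmetric] T_def[symmetric] U_def[symmetric] anti add_ac algebra_simps)
qed

lemma linear_ext_triple:
  fixes x y z :: "ltree \<Rightarrow>\<^sub>0 'k::comm_ring_1"
  shows "linear_ext g (bracket c x (bracket d y z) + bracket c z (bracket d x y) + bracket c y (bracket d z x)) =
    linear_ext (\<lambda>s. linear_ext (\<lambda>t. linear_ext (\<lambda>u.
      g (Node c s (Node d t u)) + g (Node c u (Node d s t)) + g (Node c t (Node d u s))) z) y) x"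
proof -
  have "linear_ext (\<lambda>u. linear_ext (\<lambda>s. linear_ext (\<lambda>t. g (Node c u (Node d s t))) y) x) z =
     linear_ext (\<lambda>s. linear_ext (\<lambda>t. linear_ext (\<lambda>u. g (Node c u (Node d s t))) z) y) x"
    by (subst linear_ext_swap, subst (2) linear_ext_swap) (rule refl)
  moreover have "linear_ext (\<lambda>t. linear_ext (\<lambda>u. linear_ext (\<lambda>s. g (Node c t (Node d u s))) x) z) y =
     linear_ext (\<lambda>s. linear_ext (\<lambda>t. linear_ext (\<lambda>u. g (Node c t (Node d u s))) z) y) x"
    by (subst (2) linear_ext_swap, subst linear_ext_swap) (rule refl)
  ultimately show ?thesis
    by (simp add: linear_ext_add linear_ext_bracket linear_ext_fun_add)
qed

lemma lie2_ideal_weight: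
  assumes "a \<in> lie2_ideal n"
  shows "linear_ext (graded_weight G \<gamma>) a = (0 :: 'k::comm_ring_1)"
  using assms
\<comment> \<open>A multiple of \<open>a\<close> is weighed at \<open>\<gamma>\<close> by weighing
  \<open>a\<close> at the multiset that remains after removing the labels of the other
  factor.\<close>
proof (induction arbitrary: \<gamma> rule: lie2_ideal.induct)
  case (left a x c)
  then show ?case unfolding linear_ext_bracket graded_weight_left linear_ext_fun_mult by simp
next
  case (right a x c)
  then show ?case
    unfolding linear_ext_bracket by (subst linear_ext_swap) (simp only: graded_weight_right linear_ext_fun_mult mult_zero_right linear_ext_zero)
next
  case (alternating x c)
  show ?case unfolding linear_ext_bracket
    by (rule linear_ext_alternating[OF graded_weight_antisym]) (simp add: graded_weight_def edge_cut_self)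
next
  case (jacobi x y z c)
  show ?case unfolding linear_ext_triple graded_weight_jacobi by simp
next
  case (mixed_jacobi x y z)
  have "linear_ext (graded_weight G \<gamma>)
      ((bracket Blue x (bracket Red y z) + bracket Blue z (bracket Red x y) + bracket Blue y (bracket Red z x))
       + (bracket Red x (bracket Blue y z) + bracket Red z (bracket Blue x y) + bracket Red y (bracket Blue z x))) = (0 :: 'k)"
    unfolding linear_ext_add[of _ "_ + _ + _"] linear_ext_triple linear_ext_fun_add[symmetric] graded_weight_jacobi by simp
  then show ?case by (simp add: add.assoc)
qed (simp_all add: linear_ext_add linear_ext_scale)

lemma crossed_if_weight_nonzero:
  "tree_weight G T \<noteq> (0 :: 'a::comm_ring_1) \<Longrightarrow> nd \<in> set (postorder T) \<Longrightarrow> crossed G nd"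
proof (induction T)
  case (Node c l r)
  have "crossed G (c, set (leaf_labels l), set (leaf_labels r))"
  proof (rule ccontr)
    assume *: "\<not> crossed G (c, set (leaf_labels l), set (leaf_labels r))"
    have "orientation G c a b = (0 :: 'a)" if "a \<in> set (leaf_labels l)" "b \<in> set (leaf_labels r)" for a b
      using * that unfolding crossed_def orientation_def by fastforce
    then have "(\<Sum>b\<in>#mset (leaf_labels r). orientation G c a b) = (0 :: 'a)" if "a \<in> set (leaf_labels l)" for a
      using that by (intro sum_mset.neutral) auto
    then have "edge_cut G c (mset (leaf_labels l)) (mset (leaf_labels r)) = (0 :: 'a)"
      unfolding edge_cut_def by (intro sum_mset.neutral) auto
    with Node.prems(1) show False by simp
  qed
  moreover have "tree_weight G l \<noteq> (0 :: 'a)" "tree_weight G r \<noteq> (0 :: 'a)" using Node.prems(1) by auto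
  ultimately show ?case using Node.prems(2) Node.IH by auto
qed simp

text \<open>Stated for a surrounding graph \<open>G\<close>, so that the hypotheses pass to
  subtrees. Each node is crossed by one edge of its color only, and this edge points from the left
  subtree to the right one, so every cut is 1 with positive sign.\<close>

lemma tree_weight_own_edges:
  assumes "distinct (leaf_labels T)" "set (tree_edges T) \<subseteq> G" "internal G (set (leaf_labels T)) \<subseteq> set (tree_edges T)"
  shows "tree_weight G T = (1 :: 'k::comm_ring_1)"
  using assms
proof (induction T)
  case (Node c l r)
  let ?e = "(c, end_vertex (word_of l), hd (leaf_labels r))"
  have ends: "end_vertex (word_of l) \<in> set (leaf_labels l)" "hd (leaf_labels r) \<in> set (leaf_labels r)"
    using end_vertex_in_labels[of "word_of l"] by simp_all
  have disj: "set (leaf_labels l) \<inter> set (leaf_labels r) = {}" using Node.prems(1) by simp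
  have e: "?e \<in> G" using Node.prems(2) by simp
  have "internal G (set (leaf_labels l)) \<subseteq> set (tree_edges l)"
    using Node.prems(3) ends disj tree_edges_labels[of _ _ _ r] unfolding internal_def by fastforce
  moreover have "internal G (set (leaf_labels r)) \<subseteq> set (tree_edges r)"
    using Node.prems(3) ends disj tree_edges_labels[of _ _ _ l] unfolding internal_def by fastforce
  moreover have "edge_cut G c (mset (leaf_labels l)) (mset (leaf_labels r)) = (1 :: 'k)"
  proof -
    have mem: "(c, a, b) = ?e" if "(c, a, b) \<in> G" "a \<in> set (leaf_labels l) \<and> b \<in> set (leaf_labels r) \<or>
        a \<in> set (leaf_labels r) \<and> b \<in> set (leaf_labels l)" for a b
    proof -
      have "(c, a, b) \<in> set (tree_edges (Node c l r))" using that Node.prems(3) by (auto simp: internal_def)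
      then show ?thesis using that(2) disj tree_edges_labels[of c a b l] tree_edges_labels[of c a b r] by auto
    qed
    have "orientation G c a b = (if a = end_vertex (word_of l) \<and> b = hd (leaf_labels r) then 1 else 0 :: 'k)"
      if "a \<in> set (leaf_labels l)" "b \<in> set (leaf_labels r)" for a b
    proof -
      have "(c, b, a) \<notin> G" using mem[of b a] that ends disj by auto
      moreover have "(c, a, b) \<in> G \<longleftrightarrow> a = end_vertex (word_of l) \<and> b = hd (leaf_labels r)"
        using mem[of a b] that e by auto
      ultimately show ?thesis by (simp add: orientation_def)
    qed
    then have "edge_cut G c (mset (leaf_labels l)) (mset (leaf_labels r)) =
      (\<Sum>a\<in>#mset (leaf_labels l). \<Sum>b\<in>#mset (leaf_labels r). if a = end_vertex (word_of l) \<and> b = hd (leaf_labels r) then 1 else 0 :: 'k)"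
      unfolding edge_cut_def by (intro arg_cong[of _ _ sum_mset] image_mset_cong) simp
    also have "\<dots> = (\<Sum>a\<in>set (leaf_labels l). \<Sum>b\<in>set (leaf_labels r). if a = end_vertex (word_of l) \<and> b = hd (leaf_labels r) then 1 else 0)"
      using Node.prems(1) by (simp add: sum_unfold_sum_mset mset_set_set)
    also have "\<dots> = (\<Sum>a\<in>set (leaf_labels l). if a = end_vertex (word_of l) then 1 else 0)"
      using ends(2) by (intro sum.cong refl) (auto simp: sum.delta)
    also have "\<dots> = 1" using ends(1) by simp
    finally show ?thesis .
  qed
  ultimately show ?case using Node by auto
qed simp

section \<open>The Lyndon basis of the free Lie algebra\<close>

lemma coset_module_carrier_update:
  "(coset_module Z N)\<lparr>carrier := coset N ` Z'\<rparr> = coset_module Z' N"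
  by (simp add: coset_module_def)

lemma pm_submodule_lie2_ideal: "pm_submodule (lie2_ideal n)"
  unfolding pm_submodule_def by (auto intro: lie2_ideal.intros)

lemma pm_submodule_free_module: "pm_submodule (carrier (free_module A))"
  unfolding pm_submodule_def
proof (intro conjI ballI allI)
  fix x y :: "'a \<Rightarrow>\<^sub>0 'b" assume "x \<in> carrier (free_module A)" "y \<in> carrier (free_module A)"
  then show "x + y \<in> carrier (free_module A)"
    using order_trans[OF keys_add[of x y]] by (simp add: free_module_def)
next
  fix x :: "'a \<Rightarrow>\<^sub>0 'b" and c assume "x \<in> carrier (free_module A)"
  moreover have "Poly_Mapping.keys (pm_scale c x) \<subseteq> Poly_Mapping.keys x" by (auto simp: in_keys_iff)
  ultimately show "pm_scale c x \<in> carrier (free_module A)" by (simp add: free_module_def)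
qed (simp add: free_module_def)

lemma pm_submodule_free_alg: "pm_submodule (carrier (free_alg n))"
  unfolding free_alg_def by (rule pm_submodule_free_module)

lemma single_in_free_module: "x \<in> A \<Longrightarrow> Poly_Mapping.single x c \<in> carrier (free_module A)"
  by (auto simp: free_module_def split: if_splits)

lemma bracket_in_free_alg:
  assumes "x \<in> carrier (free_alg n)" "y \<in> carrier (free_alg n)"
  shows "bracket c x y \<in> carrier (free_alg n)"
proof -
  have "Poly_Mapping.single (Node c s t) k \<in> carrier (free_alg n)"
    if "s \<in> Poly_Mapping.keys x" "t \<in> Poly_Mapping.keys y" for s t and k :: 'a
    unfolding free_alg_def
  proof (rule single_in_free_module)
    have "set (leaf_labels s) \<subseteq> {1..n}" "set (leaf_labels t) \<subseteq> {1..n}"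
      using assms that by (auto simp: free_alg_def free_module_def)
    then show "Node c s t \<in> {T. set (leaf_labels T) \<subseteq> {1..n}}" by simp
  qed
  then show ?thesis
    unfolding bracket_def free_alg_def by (intro pm_submodule_sum pm_submodule_free_module) simp
qed

lemma lie2_ideal_subset: "lie2_ideal n \<subseteq> carrier (free_alg n)"
proof
  note alg = pm_submoduleD[OF pm_submodule_free_alg[of n]]
  fix a assume "a \<in> lie2_ideal n"
  then show "a \<in> carrier (free_alg n)"
  proof induction
    case zero
    then show ?case by (rule alg(1))
  next
    case (add a b)
    then show ?case by (intro alg(2))
  next
    case (scale a k)
    then show ?case by (intro alg(3))
  next
    case (jacobi x y z c)
    then show ?case by (intro alg(2) bracket_in_free_alg)
  next
    case (mixed_jacobi x y z)
    then show ?case by (intro alg(2) bracket_in_free_alg)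
  qed (auto intro: bracket_in_free_alg)
qed

text \<open>Carries relations from a subtree to the surrounding tree: \<open>B\<close> will be the
  bracket with a fixed tree, under which the ideal is stable.\<close>

lemma combinations_map:
  assumes "pm_submodule N" "x \<in> combinations N F I"
    and "\<And>x y. B (x + y) = B x + B y" "\<And>c x. B (pm_scale c x) = pm_scale c (B x)"
    and "\<And>x. x \<in> N \<Longrightarrow> B x \<in> N" "\<And>t. t \<in> I \<Longrightarrow> B (F t) \<in> combinations N F J"
  shows "B x \<in> combinations N F J"
proof -
  note C = pm_submodule_combinations[OF assms(1), of F J]
  obtain A c where A: "finite A" "A \<subseteq> I" "x - (\<Sum>t\<in>A. pm_scale (c t) (F t)) \<in> N"
    using assms(2) unfolding combinations_def by blast
  have zero: "B 0 = 0" using assms(4)[of 0 0] by simp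
  have "B (\<Sum>t\<in>A. pm_scale (c t) (F t)) = (\<Sum>t\<in>A. pm_scale (c t) (B (F t)))"
    using A(1) by (induction A) (simp_all add: zero assms(3,4))
  also have "\<dots> \<in> combinations N F J"
    using A(2) assms(6) by (intro pm_submodule_sum[OF C] pm_submoduleD(3)[OF C]) auto
  finally have "B (\<Sum>t\<in>A. pm_scale (c t) (F t)) \<in> combinations N F J" .
  moreover have "B (x - (\<Sum>t\<in>A. pm_scale (c t) (F t))) \<in> combinations N F J"
    using assms(5)[OF A(3)] subset_combinations[of N F J] by (rule rev_subsetD)
  ultimately have "B (\<Sum>t\<in>A. pm_scale (c t) (F t)) + B (x - (\<Sum>t\<in>A. pm_scale (c t) (F t))) \<in> combinations N F J"
    by (rule pm_submoduleD(2)[OF C])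
  then show ?thesis by (simp add: assms(3)[symmetric])
qed

section \<open>Relations between bracketings\<close>

abbreviation tree_vec :: "ltree \<Rightarrow> (ltree \<Rightarrow>\<^sub>0 'k::comm_ring_1)" where
  "tree_vec T \<equiv> Poly_Mapping.single T 1"

lemma tree_vec_in_free_alg: "set (leaf_labels T) \<subseteq> {1..n} \<Longrightarrow> tree_vec T \<in> carrier (free_alg n)"
  unfolding free_alg_def by (rule single_in_free_module) simp

lemma tree_vec_antisym:
  assumes "set (leaf_labels l) \<subseteq> {1..n}" "set (leaf_labels r) \<subseteq> {1..n}"
  shows "tree_vec (Node c l r) + tree_vec (Node c r l) \<in> (lie2_ideal n :: (ltree \<Rightarrow>\<^sub>0 'k::comm_ring_1) set)"
proof -
  note I = pm_submoduleD[OF pm_submodule_lie2_ideal[of n]]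
  let ?l = "tree_vec l :: ltree \<Rightarrow>\<^sub>0 'k" and ?r = "tree_vec r :: ltree \<Rightarrow>\<^sub>0 'k"
  have x: "?l \<in> carrier (free_alg n)" "?r \<in> carrier (free_alg n)"
    by (intro tree_vec_in_free_alg assms)+
  then have "?l + ?r \<in> carrier (free_alg n)"
    by (intro pm_submoduleD(2)[OF pm_submodule_free_alg])
  from lie2_ideal.alternating[OF this, of c] lie2_ideal.alternating[OF x(1), of c] lie2_ideal.alternating[OF x(2), of c]
  have "tree_vec (Node c l r) + tree_vec (Node c r l) + tree_vec (Node c l l) + tree_vec (Node c r r)
      \<in> (lie2_ideal n :: (ltree \<Rightarrow>\<^sub>0 'k) set)"
    "tree_vec (Node c l l) \<in> (lie2_ideal n :: (ltree \<Rightarrow>\<^sub>0 'k) set)"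
    "tree_vec (Node c r r) \<in> (lie2_ideal n :: (ltree \<Rightarrow>\<^sub>0 'k) set)"
    by (simp_all add: bracket_add_left bracket_add_right add_ac)
  from I(5)[OF I(5)[OF this(1,3)] this(2)] show ?thesis by (simp add: algebra_simps)
qed

text \<open>Rewriting uses the derivation form of the Jacobi identity. Up to antisymmetry it is the
  negative of the cyclic sum, whatever the two colors are, so the plain and the mixed version are
  obtained together.\<close>

lemma tree_vec_jacobi:
  assumes a: "set (leaf_labels a) \<subseteq> {1..n}" and b: "set (leaf_labels b) \<subseteq> {1..n}" and d: "set (leaf_labels d) \<subseteq> {1..n}"
  defines "J \<equiv> \<lambda>c e. tree_vec (Node c (Node e a b) d) - tree_vec (Node c (Node e a d) b) - tree_vec (Node c a (Node e b d))
    :: ltree \<Rightarrow>\<^sub>0 'k::comm_ring_1"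
  shows "J c c \<in> lie2_ideal n" "J Red Blue + J Blue Red \<in> lie2_ideal n"
proof -
  note I = pm_submoduleD[OF pm_submodule_lie2_ideal[of n]]
  define K where "K c e = bracket c (tree_vec a) (bracket e (tree_vec b) (tree_vec d))
    + bracket c (tree_vec d) (bracket e (tree_vec a) (tree_vec b))
    + (bracket c (tree_vec b) (bracket e (tree_vec d) (tree_vec a)) :: ltree \<Rightarrow>\<^sub>0 'k)" for c e
  have node: "set (leaf_labels (Node e s t)) \<subseteq> {1..n}" if "set (leaf_labels s) \<subseteq> {1..n}" "set (leaf_labels t) \<subseteq> {1..n}" for e s t
    using that by simp
  \<comment> \<open>Three instances of antisymmetry: the outer bracket with \<open>d\<close>, the
    inner bracket of \<open>a\<close> and \<open>d\<close>, and the outer bracket with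
    \<open>b\<close>.\<close>
  have *: "J c e + K c e \<in> lie2_ideal n" for c e
  proof -
    have "bracket c (tree_vec b) (tree_vec (Node e d a) + tree_vec (Node e a d)) \<in> (lie2_ideal n :: (ltree \<Rightarrow>\<^sub>0 'k) set)"
      using tree_vec_antisym[OF d a] tree_vec_in_free_alg[OF b] by (rule lie2_ideal.left)
    from I(5)[OF I(2)[OF tree_vec_antisym[OF node[OF a b, of e] d, of c] this]
        tree_vec_antisym[OF node[OF a d, of e] b, of c]]
    show ?thesis by (simp add: J_def K_def bracket_add_right algebra_simps)
  qed
  note v = tree_vec_in_free_alg[OF a] tree_vec_in_free_alg[OF b] tree_vec_in_free_alg[OF d]
  have "K c c \<in> lie2_ideal n" unfolding K_def by (intro lie2_ideal.jacobi v)
  from I(5)[OF *[of c c] this] show "J c c \<in> lie2_ideal n" by simp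
  have "K Blue Red + K Red Blue \<in> lie2_ideal n"
    using lie2_ideal.mixed_jacobi[OF v] by (simp add: K_def add.assoc)
  from I(5)[OF I(2)[OF *[of Red Blue] *[of Blue Red]] this]
  show "J Red Blue + J Blue Red \<in> lie2_ideal n" by (simp add: algebra_simps)
qed

lemma rewrites_to_combinations:
  assumes "rewrites_to x ys" "set (leaf_labels x) \<subseteq> {1..n}"
  shows "tree_vec x \<in> combinations (lie2_ideal n :: (ltree \<Rightarrow>\<^sub>0 'k::comm_ring_1) set) tree_vec (set ys)"
  using assms
proof (induction rule: rewrites_to.induct)
  case (antisym c l r)
  note C = pm_submoduleD[OF pm_submodule_combinations[OF pm_submodule_lie2_ideal[of n, where 'a = 'k]]]
  let ?C = "combinations (lie2_ideal n :: (ltree \<Rightarrow>\<^sub>0 'k) set) tree_vec (set [Node c r l])"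
  have "tree_vec (Node c l r) + tree_vec (Node c r l) \<in> ?C"
    using antisym by (intro rev_subsetD[OF tree_vec_antisym subset_combinations]) auto
  moreover have "tree_vec (Node c r l) \<in> ?C"
    by (rule combinations_base[OF pm_submodule_lie2_ideal]) simp
  ultimately have "tree_vec (Node c l r) + tree_vec (Node c r l) - tree_vec (Node c r l) \<in> ?C" by (rule C(5))
  then show ?case by simp
next
  case (jacobi c a b d)
  let ?ys = "[Node c (Node c a d) b, Node c a (Node c b d)]"
  let ?C = "combinations (lie2_ideal n :: (ltree \<Rightarrow>\<^sub>0 'k) set) tree_vec (set ?ys)"
  note C = pm_submoduleD[OF pm_submodule_combinations[OF pm_submodule_lie2_ideal[of n, where 'a = 'k]]]
  have y: "tree_vec y \<in> ?C" if "y \<in> set ?ys" for y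
    using pm_submodule_lie2_ideal that by (rule combinations_base)
  have "tree_vec (Node c (Node c a b) d) - tree_vec (Node c (Node c a d) b) - tree_vec (Node c a (Node c b d)) \<in> ?C"
    using jacobi by (intro rev_subsetD[OF tree_vec_jacobi(1) subset_combinations]) auto
  from C(2)[OF this C(2)[OF y[of "Node c (Node c a d) b"] y[of "Node c a (Node c b d)"]]] show ?case by simp
next
  case (mixed_jacobi a b d)
  let ?ys = "[Node Blue (Node Red a b) d, Node Red (Node Blue a d) b, Node Blue (Node Red a d) b,
     Node Red a (Node Blue b d), Node Blue a (Node Red b d)]"
  let ?C = "combinations (lie2_ideal n :: (ltree \<Rightarrow>\<^sub>0 'k) set) tree_vec (set ?ys)"
  note C = pm_submoduleD[OF pm_submodule_combinations[OF pm_submodule_lie2_ideal[of n, where 'a = 'k]]]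
  have y: "tree_vec y \<in> ?C" if "y \<in> set ?ys" for y
    using pm_submodule_lie2_ideal that by (rule combinations_base)
  have "tree_vec (Node Red (Node Blue a b) d) - tree_vec (Node Red (Node Blue a d) b) - tree_vec (Node Red a (Node Blue b d))
    + (tree_vec (Node Blue (Node Red a b) d) - tree_vec (Node Blue (Node Red a d) b) - tree_vec (Node Blue a (Node Red b d))) \<in> ?C"
    using mixed_jacobi by (intro rev_subsetD[OF tree_vec_jacobi(2) subset_combinations]) auto
  from C(2)[OF C(2)[OF C(2)[OF C(2)[OF C(5)[OF this y[of "Node Blue (Node Red a b) d"]] y[of "Node Red (Node Blue a d) b"]]
    y[of "Node Blue (Node Red a d) b"]] y[of "Node Red a (Node Blue b d)"]] y[of "Node Blue a (Node Red b d)"]]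
  show ?case by simp
next
  case (left x ys c r)
  have B: "bracket c (tree_vec x) (tree_vec r) \<in> combinations (lie2_ideal n :: (ltree \<Rightarrow>\<^sub>0 'k) set) tree_vec (set (map (\<lambda>y. Node c y r) ys))"
  proof (rule combinations_map[OF pm_submodule_lie2_ideal left.IH])
    show "bracket c a (tree_vec r) \<in> lie2_ideal n" if "a \<in> lie2_ideal n" for a :: "ltree \<Rightarrow>\<^sub>0 'k"
      using that left.prems by (intro lie2_ideal.right tree_vec_in_free_alg) auto
    show "bracket c (tree_vec t) (tree_vec r) \<in> combinations (lie2_ideal n :: (ltree \<Rightarrow>\<^sub>0 'k) set) tree_vec (set (map (\<lambda>y. Node c y r) ys))"
      if "t \<in> set ys" for t
      using that by (simp, intro combinations_base pm_submodule_lie2_ideal) auto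
  qed (use left.prems in \<open>auto simp: bracket_add_left bracket_scale_left\<close>)
  then show ?case by simp
next
  case (right x ys c l)
  have B: "bracket c (tree_vec l) (tree_vec x) \<in> combinations (lie2_ideal n :: (ltree \<Rightarrow>\<^sub>0 'k) set) tree_vec (set (map (\<lambda>y. Node c l y) ys))"
  proof (rule combinations_map[OF pm_submodule_lie2_ideal right.IH])
    show "bracket c (tree_vec l) a \<in> lie2_ideal n" if "a \<in> lie2_ideal n" for a :: "ltree \<Rightarrow>\<^sub>0 'k"
      using that right.prems by (intro lie2_ideal.left tree_vec_in_free_alg) auto
    show "bracket c (tree_vec l) (tree_vec t) \<in> combinations (lie2_ideal n :: (ltree \<Rightarrow>\<^sub>0 'k) set) tree_vec (set (map (\<lambda>y. Node c l y) ys))"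
      if "t \<in> set ys" for t
      using that by (simp, intro combinations_base pm_submodule_lie2_ideal) auto
  qed (use right.prems in \<open>auto simp: bracket_add_right bracket_scale_right\<close>)
  then show ?case by simp
qed


text \<open>The component is given as a span inside a quotient; taking its preimage turns it into a
  quotient in its own right, to which the basis criterion applies.\<close>

lemma lie2_eq_coset_module:
  "lie2 n i = (coset_module (combinations (lie2_ideal n) tree_vec (bicolored_trees n i)) (lie2_ideal n)
     :: ('k::comm_ring_1, _) module)"
proof -
  interpret submodule_pair "carrier (free_alg n)" "lie2_ideal n :: (ltree \<Rightarrow>\<^sub>0 'k) set"
    by unfold_locales (rule pm_submodule_free_alg pm_submodule_lie2_ideal lie2_ideal_subset)+
  have free: "free_lie2 n = coset_module (carrier (free_alg n)) (lie2_ideal n :: (ltree \<Rightarrow>\<^sub>0 'k) set)"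
    unfolding free_lie2_def by (rule quotient_module_eq_coset_module) (simp_all add: free_alg_def free_module_def)
  have cls: "tree_bracket_class n = (\<lambda>T. coset (lie2_ideal n) (tree_vec T) :: (ltree \<Rightarrow>\<^sub>0 'k) set)"
    by (auto simp: tree_bracket_class_def fun_eq_iff tree_bracket_eq_single a_r_coset_defs coset_def free_alg_def free_module_def)
  have "LinearCombinations.module.span (class_ring :: 'k ring) (free_lie2 n) (tree_bracket_class n ` bicolored_trees n i) =
    coset (lie2_ideal n) ` combinations (lie2_ideal n) tree_vec (bicolored_trees n i)"
    unfolding free cls by (rule span_cosets) (auto simp: bicolored_trees_def intro!: tree_vec_in_free_alg)
  then show ?thesis unfolding lie2_def free by (simp add: coset_module_carrier_update)
qed

theorem lyndon_basis_lie2: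
  "module_basis class_ring (lie2 n i :: ('k::comm_ring_1, _) module) (tree_bracket_class n ` lyndon_trees n i)"
proof -
  let ?N = "lie2_ideal n :: (ltree \<Rightarrow>\<^sub>0 'k) set"
  let ?Z = "combinations ?N tree_vec (bicolored_trees n i)"
  let ?C = "combinations ?N tree_vec (lyndon_trees n i)"
  note N = pm_submodule_lie2_ideal[of n]
  interpret submodule_pair ?Z ?N
    by unfold_locales (rule pm_submodule_combinations N subset_combinations)+
  have cls: "tree_bracket_class n = (\<lambda>T. coset ?N (tree_vec T))"
    by (auto simp: tree_bracket_class_def fun_eq_iff tree_bracket_eq_single a_r_coset_defs coset_def free_alg_def free_module_def)
  have tree: "tree_vec T \<in> ?C" if T: "T \<in> bicolored_trees n i" for T
  proof -
    \<comment> \<open>The identities lie in the ideal only for labels in \<open>{1..n}\<close>. The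
      guard restricts to such trees and survives rewriting, because labels and number of red nodes
      are preserved.\<close>
    define Q where "Q t \<longleftrightarrow> (t \<in> bicolored_trees n i \<longrightarrow> tree_vec t \<in> ?C)" for t
    have same: "s \<in> bicolored_trees n i \<longleftrightarrow> t \<in> bicolored_trees n i" if "same_type s t" for s t
      using that unfolding bicolored_trees_def same_type_def
      by (metis (no_types, lifting) mem_Collect_eq mset_eq_imp_distinct_iff set_mset_mset)
    have "rewrite_closed Q"
      unfolding rewrite_closed_def
    proof (intro allI impI)
      fix x ys assume r: "rewrites_to x ys" and ys: "\<forall>y\<in>set ys. Q y"
      show "Q x" unfolding Q_def
      proof
        assume x: "x \<in> bicolored_trees n i"
        then have "tree_vec x \<in> combinations ?N tree_vec (set ys)"
          by (intro rewrites_to_combinations[OF r]) (simp add: bicolored_trees_def)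
        moreover have "combinations ?N tree_vec (set ys) \<subseteq> ?C"
        proof (rule combinations_subset[OF pm_submodule_combinations[OF N] subset_combinations])
          fix y assume y: "y \<in> set ys"
          then have "same_type y x" using rewrites_to_labels[OF r] by (simp add: same_type_def)
          then show "tree_vec y \<in> ?C" using ys y x same[of y x] by (auto simp: Q_def)
        qed
        ultimately show "tree_vec x \<in> ?C" by blast
      qed
    qed
    moreover have "Q s" if "bicolored_lyndon s" for s
      unfolding Q_def using that by (auto intro!: combinations_base[OF N] simp: lyndon_trees_def)
    ultimately have "Q T" using T by (intro straightening[of T Q]) (auto simp: bicolored_trees_def)
    then show ?thesis using T by (simp add: Q_def)
  qed
  have ly: "bicolored_lyndon T" "distinct (leaf_labels T)" "set (leaf_labels T) = {1..n}"
    "mset (leaf_labels T) = mset_set {1..n}"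
    if "T \<in> lyndon_trees n i" for T
    using that by (auto simp: lyndon_trees_def bicolored_trees_def mset_set_set[symmetric])
  define \<phi> :: "ltree \<Rightarrow> (ltree \<Rightarrow>\<^sub>0 'k) \<Rightarrow> 'k" where
    "\<phi> T = linear_ext (graded_weight (set (tree_edges T)) (mset_set {1..n}))" for T
  have "module_basis class_ring M ((\<lambda>T. coset ?N (tree_vec T)) ` lyndon_trees n i)"
  proof (rule module_basis_cosets[where \<phi> = \<phi> and rank = "\<lambda>T. val (Suc n) (word_of T)"])
    show "tree_vec T \<in> ?Z" if "T \<in> lyndon_trees n i" for T
      using that by (intro combinations_base[OF N]) (simp add: lyndon_trees_def)
    show "?Z \<subseteq> ?C"
      by (rule combinations_subset[OF pm_submodule_combinations[OF N] subset_combinations tree])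
    show "\<phi> T (x + y) = \<phi> T x + \<phi> T y" "\<phi> T (pm_scale c x) = c * \<phi> T x" for T x y c
      by (simp_all add: \<phi>_def linear_ext_add linear_ext_scale)
    show "\<phi> T x = 0" if "x \<in> ?N" for T x
      unfolding \<phi>_def using that by (rule lie2_ideal_weight)
    show "\<phi> T (tree_vec T) = 1" if "T \<in> lyndon_trees n i" for T
      using ly[OF that] by (simp add: \<phi>_def graded_weight_def tree_weight_own_edges internal_def subset_iff)
    show "S = T \<or> val (Suc n) (word_of S) < val (Suc n) (word_of T)"
      if S: "S \<in> lyndon_trees n i" and T: "T \<in> lyndon_trees n i" and "\<phi> T (tree_vec S) \<noteq> 0" for S T
    proof (rule tree_triangular)
      have "tree_weight (set (tree_edges T)) S \<noteq> (0 :: 'k)"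
        using that(3) ly[OF S] by (simp add: \<phi>_def graded_weight_def)
      then show "crossed (set (tree_edges T)) nd" if "nd \<in> set (postorder S)" for nd
        using that by (rule crossed_if_weight_nonzero)
      \<comment> \<open>The base \<open>Suc n\<close> exceeds both the labels and the number of
        leaves, the two bounds required of digits.\<close>
      show "bounded (Suc n) (word_of T)"
        unfolding bounded_def labels_word_of ly(4)[OF T] by auto
    qed (use ly[OF S] ly[OF T] in auto)
  qed
  then show ?thesis unfolding cls lie2_eq_coset_module .
qed

section \<open>Weighted partitions\<close>

lemma weighted_partitionsD:
  assumes "\<alpha> \<in> weighted_partitions n"
  shows "finite \<alpha>"
    and "p \<in> \<alpha> \<Longrightarrow> fst p \<noteq> {}" "p \<in> \<alpha> \<Longrightarrow> fst p \<subseteq> {1..n}" "p \<in> \<alpha> \<Longrightarrow> snd p < card (fst p)"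
    and "p \<in> \<alpha> \<Longrightarrow> q \<in> \<alpha> \<Longrightarrow> x \<in> fst p \<Longrightarrow> x \<in> fst q \<Longrightarrow> p = q"
    and "x \<in> {1..n} \<Longrightarrow> \<exists>p\<in>\<alpha>. x \<in> fst p"
proof -
  have P: "partition_on {1..n} (fst ` \<alpha>)" and inj: "inj_on fst \<alpha>" and w: "\<forall>(B, v) \<in> \<alpha>. v \<le> card B - 1"
    using assms by (auto simp: weighted_partitions_def)
  have "finite (fst ` \<alpha>)" using P by (rule finite_elements[rotated]) simp
  then show "finite \<alpha>" using inj by (rule finite_imageD)
  show ne: "p \<in> \<alpha> \<Longrightarrow> fst p \<noteq> {}" for p using partition_onD3[OF P] by (metis imageI)
  show sub: "p \<in> \<alpha> \<Longrightarrow> fst p \<subseteq> {1..n}" for p using partition_onD1[OF P] by auto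
  show "snd p < card (fst p)" if "p \<in> \<alpha>" for p
  proof -
    have "finite (fst p)" using sub[OF that] by (rule finite_subset) simp
    then have "0 < card (fst p)" using ne[OF that] by (simp add: card_gt_0_iff)
    moreover have "snd p \<le> card (fst p) - 1" using w that by (auto split: prod.splits)
    ultimately show ?thesis by simp
  qed
  show "p = q" if "p \<in> \<alpha>" "q \<in> \<alpha>" "x \<in> fst p" "x \<in> fst q" for p q x
  proof -
    have "fst p = fst q"
      using partition_onD2[OF P] that unfolding disjoint_def by (metis IntI empty_iff imageI)
    then show ?thesis using inj that by (auto dest: inj_onD)
  qed
  show "\<exists>p\<in>\<alpha>. x \<in> fst p" if "x \<in> {1..n}" for x using partition_onD1[OF P] that by auto
qed

lemma weighted_partitionsI:
  assumes "\<And>p. p \<in> \<alpha> \<Longrightarrow> fst p \<noteq> {}" "\<And>p. p \<in> \<alpha> \<Longrightarrow> fst p \<subseteq> {1..n}" "\<And>p. p \<in> \<alpha> \<Longrightarrow> snd p < card (fst p)"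
    and "\<And>p q x. p \<in> \<alpha> \<Longrightarrow> q \<in> \<alpha> \<Longrightarrow> x \<in> fst p \<Longrightarrow> x \<in> fst q \<Longrightarrow> p = q"
    and "\<And>x. x \<in> {1..n} \<Longrightarrow> \<exists>p\<in>\<alpha>. x \<in> fst p"
  shows "\<alpha> \<in> weighted_partitions n"
proof -
  have "partition_on {1..n} (fst ` \<alpha>)"
  proof (rule partition_onI)
    show "\<Union> (fst ` \<alpha>) = {1..n}"
    proof (intro equalityI Union_least subsetI)
      fix X assume "X \<in> fst ` \<alpha>"
      then obtain p where "p \<in> \<alpha>" "X = fst p" by blast
      then show "x \<in> {1..n}" if "x \<in> X" for x using assms(2) that by blast
    next
      fix x assume "x \<in> {1..n}"
      from assms(5)[OF this] show "x \<in> \<Union> (fst ` \<alpha>)" by blast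
    qed
    show "{} \<notin> fst ` \<alpha>" using assms(1) by auto
    show "disjnt A B" if AB: "A \<in> fst ` \<alpha>" "B \<in> fst ` \<alpha>" "A \<noteq> B" for A B
    proof -
      obtain p q where pq: "p \<in> \<alpha>" "q \<in> \<alpha>" "A = fst p" "B = fst q" using AB(1,2) by blast
      then have "p \<noteq> q" using AB(3) by auto
      then show ?thesis using assms(4)[OF pq(1,2)] pq(3,4) unfolding disjnt_def by blast
    qed
  qed
  moreover have "inj_on fst \<alpha>"
  proof (rule inj_onI)
    fix p q assume pq: "p \<in> \<alpha>" "q \<in> \<alpha>" "fst p = fst q"
    obtain x where "x \<in> fst p" using assms(1)[OF pq(1)] by blast
    then show "p = q" using assms(4)[OF pq(1,2)] pq(3) by simp
  qed
  moreover have "v \<le> card B - 1" if "(B, v) \<in> \<alpha>" for B v using assms(3)[OF that] by simp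
  ultimately show ?thesis by (auto simp: weighted_partitions_def)
qed

lemma same_block:
  assumes "\<alpha> \<in> weighted_partitions n" "p \<in> \<alpha>" "q \<in> \<alpha>" "fst p \<subseteq> fst q"
  shows "p = q"
  using weighted_partitionsD(2)[OF assms(1,2)] weighted_partitionsD(5)[OF assms(1-3)] assms(4) by blast

lemma finite_weighted_partitions: "finite (weighted_partitions n)"
proof (rule finite_subset)
  show "weighted_partitions n \<subseteq> Pow (Pow {1..n} \<times> {..n})"
  proof
    fix \<alpha> assume a: "\<alpha> \<in> weighted_partitions n"
    have "p \<in> Pow {1..n} \<times> {..n}" if "p \<in> \<alpha>" for p
    proof -
      have "snd p < card (fst p)" "card (fst p) \<le> card {1..n}"
        using weighted_partitionsD(4)[OF a that] card_mono[OF _ weighted_partitionsD(3)[OF a that]] by simp_all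
      then show ?thesis using weighted_partitionsD(3)[OF a that] by (cases p) auto
    qed
    then show "\<alpha> \<in> Pow (Pow {1..n} \<times> {..n})" by blast
  qed
qed simp

definition block_sum :: "wpartition \<Rightarrow> nat set \<Rightarrow> nat" where
  "block_sum \<alpha> B = (\<Sum>p\<in>blocks_in \<alpha> B. snd p)"

lemma in_blocks_in [simp]: "p \<in> blocks_in \<alpha> B \<longleftrightarrow> p \<in> \<alpha> \<and> fst p \<subseteq> B"
  by (cases p) (simp add: blocks_in_def)

lemma wp_le_iff:
  assumes a: "\<alpha> \<in> weighted_partitions n" and b: "\<beta> \<in> weighted_partitions n"
  shows "wp_le n \<alpha> \<beta> \<longleftrightarrow> (\<forall>p\<in>\<alpha>. \<exists>q\<in>\<beta>. fst p \<subseteq> fst q) \<and>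
    (\<forall>q\<in>\<beta>. block_sum \<alpha> (fst q) \<le> snd q \<and> snd q < block_sum \<alpha> (fst q) + card (blocks_in \<alpha> (fst q)))"
proof -
  have "refines {1..n} (fst ` \<alpha>) (fst ` \<beta>) \<longleftrightarrow> (\<forall>p\<in>\<alpha>. \<exists>q\<in>\<beta>. fst p \<subseteq> fst q)"
    using a b unfolding refines_def weighted_partitions_def by auto
  moreover have "(case q of (B, v) \<Rightarrow> int v - (\<Sum>(A, w) \<in> blocks_in \<alpha> B. int w)
      \<in> {0..int (card (blocks_in \<alpha> B)) - 1}) \<longleftrightarrow>
    block_sum \<alpha> (fst q) \<le> snd q \<and> snd q < block_sum \<alpha> (fst q) + card (blocks_in \<alpha> (fst q))" for q
  proof -
    have "(\<Sum>(A, w) \<in> blocks_in \<alpha> (fst q). int w) = int (block_sum \<alpha> (fst q))"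
      unfolding block_sum_def by (simp add: case_prod_unfold)
    then show ?thesis by (cases q) auto
  qed
  ultimately show ?thesis unfolding wp_le_def by auto
qed

text \<open>\<open>C\<close> will be a block of a partition above \<open>\<beta>\<close> or the
  whole ground set. In both cases it is the union of the blocks in \<open>\<gamma>\<close>, so
  numbers and weights of the blocks of \<open>\<alpha>\<close> inside \<open>C\<close> add
  up.\<close>

lemma blocks_in_refined:
  assumes "\<alpha> \<in> weighted_partitions n" "\<beta> \<in> weighted_partitions n" "wp_le n \<alpha> \<beta>" "\<gamma> \<subseteq> \<beta>"
    "\<And>p q. p \<in> \<alpha> \<Longrightarrow> q \<in> \<beta> \<Longrightarrow> fst p \<subseteq> fst q \<Longrightarrow> fst p \<subseteq> C \<Longrightarrow> q \<in> \<gamma>" "\<And>q. q \<in> \<gamma> \<Longrightarrow> fst q \<subseteq> C"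
  shows "card (blocks_in \<alpha> C) = (\<Sum>q\<in>\<gamma>. card (blocks_in \<alpha> (fst q)))"
    and "block_sum \<alpha> C = (\<Sum>q\<in>\<gamma>. block_sum \<alpha> (fst q))"
proof -
  note A = weighted_partitionsD[OF assms(1)] and B = weighted_partitionsD[OF assms(2)]
  have eq: "blocks_in \<alpha> C = (\<Union>q\<in>\<gamma>. blocks_in \<alpha> (fst q))"
  proof (intro equalityI subsetI)
    fix p assume "p \<in> blocks_in \<alpha> C"
    then have p: "p \<in> \<alpha>" "fst p \<subseteq> C" by simp_all
    obtain q where q: "q \<in> \<beta>" "fst p \<subseteq> fst q" using assms(3) p(1) unfolding wp_le_iff[OF assms(1,2)] by blast
    with p assms(5)[OF p(1) q p(2)] show "p \<in> (\<Union>q\<in>\<gamma>. blocks_in \<alpha> (fst q))" by auto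
  next
    fix p assume "p \<in> (\<Union>q\<in>\<gamma>. blocks_in \<alpha> (fst q))"
    then obtain q where "q \<in> \<gamma>" "p \<in> \<alpha>" "fst p \<subseteq> fst q" by auto
    with assms(6)[of q] show "p \<in> blocks_in \<alpha> C" by auto
  qed
  have fin: "finite \<gamma>" "finite (blocks_in \<alpha> X)" for X
    using B(1) A(1) assms(4) by (auto intro: finite_subset simp: blocks_in_def)
  have disj: "blocks_in \<alpha> (fst p) \<inter> blocks_in \<alpha> (fst q) = {}" if "p \<in> \<gamma>" "q \<in> \<gamma>" "p \<noteq> q" for p q
  proof (rule ccontr)
    assume "blocks_in \<alpha> (fst p) \<inter> blocks_in \<alpha> (fst q) \<noteq> {}"
    then obtain r where r: "r \<in> \<alpha>" "fst r \<subseteq> fst p" "fst r \<subseteq> fst q" by auto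
    then obtain x where "x \<in> fst r" using A(2) by blast
    then show False using B(5)[of p q x] that assms(4) r by blast
  qed
  show "card (blocks_in \<alpha> C) = (\<Sum>q\<in>\<gamma>. card (blocks_in \<alpha> (fst q)))"
    unfolding eq using fin disj by (intro card_UN_disjoint) auto
  show "block_sum \<alpha> C = (\<Sum>q\<in>\<gamma>. block_sum \<alpha> (fst q))"
    unfolding block_sum_def eq using fin disj by (intro sum.UNION_disjoint) auto
qed

text \<open>The permitted increments add up exactly: a block made of \<open>k\<close> blocks, the
  j-th of which is made of \<open>l_j\<close> blocks, may gain at most \<open>k - 1\<close> after
  gains of \<open>l_j - 1\<close>, and the total of these bounds is the sum of all
  \<open>l_j\<close> minus 1.\<close>

lemma wp_le_trans:
  assumes a: "\<alpha> \<in> weighted_partitions n" and b: "\<beta> \<in> weighted_partitions n" and c: "\<gamma> \<in> weighted_partitions n"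
    and ab: "wp_le n \<alpha> \<beta>" and bc: "wp_le n \<beta> \<gamma>"
  shows "wp_le n \<alpha> \<gamma>"
  unfolding wp_le_iff[OF a c]
proof (intro conjI ballI)
  fix p assume "p \<in> \<alpha>"
  then obtain q where "q \<in> \<beta>" "fst p \<subseteq> fst q" using ab unfolding wp_le_iff[OF a b] by blast
  then show "\<exists>r\<in>\<gamma>. fst p \<subseteq> fst r" using bc unfolding wp_le_iff[OF b c] by (meson subset_trans)
next
  fix r assume r: "r \<in> \<gamma>"
  have cl: "q \<in> blocks_in \<beta> (fst r)" if "p \<in> \<alpha>" "q \<in> \<beta>" "fst p \<subseteq> fst q" "fst p \<subseteq> fst r" for p q
  proof -
    obtain s where s: "s \<in> \<gamma>" "fst q \<subseteq> fst s" using bc \<open>q \<in> \<beta>\<close> unfolding wp_le_iff[OF b c] by blast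
    obtain x where "x \<in> fst p" using weighted_partitionsD(2)[OF a \<open>p \<in> \<alpha>\<close>] by blast
    then have "s = r" using weighted_partitionsD(5)[OF c s(1) r] that s by blast
    with s that show ?thesis by simp
  qed
  have sub: "blocks_in \<beta> (fst r) \<subseteq> \<beta>" by (simp add: subset_iff del: split_paired_All)
  have split: "card (blocks_in \<alpha> (fst r)) = (\<Sum>q\<in>blocks_in \<beta> (fst r). card (blocks_in \<alpha> (fst q)))"
    "block_sum \<alpha> (fst r) = (\<Sum>q\<in>blocks_in \<beta> (fst r). block_sum \<alpha> (fst q))"
    by (rule blocks_in_refined[OF a b ab sub], erule (3) cl, simp)+
  have fin: "finite (blocks_in \<beta> (fst r))"
    using weighted_partitionsD(1)[OF b] by (auto intro: finite_subset simp: blocks_in_def)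
  have step: "block_sum \<alpha> (fst q) \<le> snd q \<and> Suc (snd q) \<le> block_sum \<alpha> (fst q) + card (blocks_in \<alpha> (fst q))"
    if "q \<in> blocks_in \<beta> (fst r)" for q
    using ab that unfolding wp_le_iff[OF a b] by (simp add: Suc_le_eq)
  have r': "block_sum \<beta> (fst r) \<le> snd r" "snd r < block_sum \<beta> (fst r) + card (blocks_in \<beta> (fst r))"
    using bc r unfolding wp_le_iff[OF b c] by auto
  have "(\<Sum>q\<in>blocks_in \<beta> (fst r). block_sum \<alpha> (fst q)) \<le> block_sum \<beta> (fst r)"
    unfolding block_sum_def[of \<beta>] using step by (intro sum_mono) simp
  then show "block_sum \<alpha> (fst r) \<le> snd r" using r'(1) unfolding split by simp
  have "(\<Sum>q\<in>blocks_in \<beta> (fst r). Suc (snd q)) \<le>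
      (\<Sum>q\<in>blocks_in \<beta> (fst r). block_sum \<alpha> (fst q) + card (blocks_in \<alpha> (fst q)))"
    using step by (intro sum_mono) simp
  then have "block_sum \<beta> (fst r) + card (blocks_in \<beta> (fst r)) \<le> block_sum \<alpha> (fst r) + card (blocks_in \<alpha> (fst r))"
    using split by (simp add: sum_Suc sum.distrib block_sum_def[of \<beta>])
  with r'(2) show "snd r < block_sum \<alpha> (fst r) + card (blocks_in \<alpha> (fst r))" by linarith
qed

lemma blocks_in_pos:
  assumes "\<alpha> \<in> weighted_partitions n" "\<beta> \<in> weighted_partitions n" "wp_le n \<alpha> \<beta>" "q \<in> \<beta>"
  shows "\<Union> (fst ` blocks_in \<alpha> (fst q)) = fst q" "0 < card (blocks_in \<alpha> (fst q))"
proof -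
  show un: "\<Union> (fst ` blocks_in \<alpha> (fst q)) = fst q"
  proof (intro equalityI subsetI)
    fix x assume x: "x \<in> fst q"
    then obtain p where p: "p \<in> \<alpha>" "x \<in> fst p"
      using weighted_partitionsD(6)[OF assms(1)] weighted_partitionsD(3)[OF assms(2,4)] by blast
    then obtain r where r: "r \<in> \<beta>" "fst p \<subseteq> fst r" using assms(3) unfolding wp_le_iff[OF assms(1,2)] by blast
    then have "r = q" using weighted_partitionsD(5)[OF assms(2) _ assms(4)] p x by blast
    with p r show "x \<in> \<Union> (fst ` blocks_in \<alpha> (fst q))" by auto
  qed auto
  have "blocks_in \<alpha> (fst q) \<noteq> {}" using un weighted_partitionsD(2)[OF assms(2,4)] by auto
  moreover have "finite (blocks_in \<alpha> (fst q))"
    using weighted_partitionsD(1)[OF assms(1)] by (auto intro: finite_subset simp: blocks_in_def)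
  ultimately show "0 < card (blocks_in \<alpha> (fst q))" by (simp add: card_gt_0_iff)
qed

lemma card_eq_sum_blocks_in:
  assumes "\<alpha> \<in> weighted_partitions n" "\<beta> \<in> weighted_partitions n" "wp_le n \<alpha> \<beta>"
  shows "card \<alpha> = (\<Sum>q\<in>\<beta>. card (blocks_in \<alpha> (fst q)))"
proof -
  have eq: "blocks_in \<alpha> {1..n} = \<alpha>"
  proof (rule Set.set_eqI)
    fix p show "p \<in> blocks_in \<alpha> {1..n} \<longleftrightarrow> p \<in> \<alpha>"
      using weighted_partitionsD(3)[OF assms(1), of p] by (simp del: atLeastAtMost_iff) blast
  qed
  have "card (blocks_in \<alpha> {1..n}) = (\<Sum>q\<in>\<beta>. card (blocks_in \<alpha> (fst q)))"
    by (rule blocks_in_refined(1)[OF assms order.refl]) (assumption | rule weighted_partitionsD(3)[OF assms(2)])+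
  then show ?thesis by (simp only: eq)
qed

lemma block_sum_single:
  assumes "blocks_in \<alpha> (fst q) = {p}" "\<Union> (fst ` blocks_in \<alpha> (fst q)) = fst q"
    and "block_sum \<alpha> (fst q) \<le> snd q" "snd q < block_sum \<alpha> (fst q) + card (blocks_in \<alpha> (fst q))"
  shows "p = q"
  using assms by (simp add: block_sum_def prod_eq_iff)

text \<open>For a block consisting of one block below, the range of increments is reduced to 0, so
  its weight is unchanged too.\<close>

lemma unsplit_block:
  assumes "\<alpha> \<in> weighted_partitions n" "\<beta> \<in> weighted_partitions n" "wp_le n \<alpha> \<beta>" "q \<in> \<beta>"
    and "card (blocks_in \<alpha> (fst q)) = 1"
  shows "q \<in> \<alpha>"
proof -
  obtain p where p: "blocks_in \<alpha> (fst q) = {p}" using assms(5) by (auto simp: card_1_singleton_iff)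
  have "p = q"
    using p blocks_in_pos(1)[OF assms(1-4)] assms(3,4) unfolding wp_le_iff[OF assms(1,2)]
    by (intro block_sum_single) auto
  with p have "q \<in> blocks_in \<alpha> (fst q)" by simp
  then show ?thesis by simp
qed

text \<open>The number of blocks is the corank of the poset up to a constant: if it did not drop,
  every block would be unsplit and the two elements equal.\<close>

lemma card_less_if_wp_less:
  assumes a: "\<alpha> \<in> weighted_partitions n" and b: "\<beta> \<in> weighted_partitions n" and "wp_less n \<alpha> \<beta>"
  shows "card \<beta> < card \<alpha>"
proof (rule ccontr)
  have le: "wp_le n \<alpha> \<beta>" and ne: "\<alpha> \<noteq> \<beta>" using assms(3) by (auto simp: wp_less_def)
  note fb = weighted_partitionsD(1)[OF b]
  have pos: "1 \<le> card (blocks_in \<alpha> (fst q))" if "q \<in> \<beta>" for q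
    using blocks_in_pos(2)[OF a b le that] by simp
  assume "\<not> card \<beta> < card \<alpha>"
  then have "(\<Sum>q\<in>\<beta>. card (blocks_in \<alpha> (fst q))) \<le> (\<Sum>q\<in>\<beta>. 1)"
    using card_eq_sum_blocks_in[OF a b le] by simp
  moreover have "(\<Sum>q\<in>\<beta>. 1) \<le> (\<Sum>q\<in>\<beta>. card (blocks_in \<alpha> (fst q)))" using pos by (rule sum_mono)
  ultimately have eq: "(\<Sum>q\<in>\<beta>. 1) = (\<Sum>q\<in>\<beta>. card (blocks_in \<alpha> (fst q)))" by simp
  then have "card (blocks_in \<alpha> (fst q)) = 1" if "q \<in> \<beta>" for q
    using sum_mono_inv[OF eq pos that fb] by simp
  then have "\<beta> \<subseteq> \<alpha>" using unsplit_block[OF a b le] by blast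
  moreover have "card \<alpha> \<le> card \<beta>" using \<open>\<not> card \<beta> < card \<alpha>\<close> by simp
  ultimately have "\<beta> = \<alpha>" by (rule card_seteq[OF weighted_partitionsD(1)[OF a]])
  with ne show False by simp
qed

lemma wp_less_trans:
  assumes "\<alpha> \<in> weighted_partitions n" "\<beta> \<in> weighted_partitions n" "\<gamma> \<in> weighted_partitions n"
    and "wp_less n \<alpha> \<beta>" "wp_less n \<beta> \<gamma>"
  shows "wp_less n \<alpha> \<gamma>"
  using wp_le_trans[OF assms(1-3)] card_less_if_wp_less[OF assms(1,2,4)] card_less_if_wp_less[OF assms(2,3,5)] assms(4,5)
  by (auto simp: wp_less_def)

lemma merge_eq:
  assumes a: "\<alpha> \<in> weighted_partitions n" and "(A, v) \<in> \<alpha>" "(B, w) \<in> \<alpha>"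
  shows "merge u A B \<alpha> = insert (A \<union> B, v + w + u) (\<alpha> - {(A, v), (B, w)})"
proof -
  have A: "v' = v" if "(A, v') \<in> \<alpha>" for v' using same_block[OF a that assms(2)] by simp
  have B: "w' = w" if "(B, w') \<in> \<alpha>" for w' using same_block[OF a that assms(3)] by simp
  show ?thesis unfolding merge_def using assms(2,3) by (auto dest: A B)
qed

lemma merge_commute: "merge u A B \<alpha> = merge u B A \<alpha>"
proof -
  have "{(A \<union> B, a + b + u) | a b. (A, a) \<in> \<alpha> \<and> (B, b) \<in> \<alpha>} = {(B \<union> A, a + b + u) | a b. (B, a) \<in> \<alpha> \<and> (A, b) \<in> \<alpha>}"
    by (rule Set.set_eqI, simp add: Un_commute) (metis add.commute)
  then show ?thesis by (auto simp: merge_def)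
qed

lemma union_not_block:
  assumes a: "\<alpha> \<in> weighted_partitions n" and "p \<in> \<alpha>" "q \<in> \<alpha>" "p \<noteq> q"
  shows "(fst p \<union> fst q, v) \<notin> \<alpha>"
proof
  assume u: "(fst p \<union> fst q, v) \<in> \<alpha>"
  have "p = (fst p \<union> fst q, v)" by (rule same_block[OF a assms(2) u]) simp
  moreover have "q = (fst p \<union> fst q, v)" by (rule same_block[OF a assms(3) u]) simp
  ultimately have "p = q" by (rule trans[OF _ sym])
  with assms(4) show False ..
qed

lemma block_finite: "\<alpha> \<in> weighted_partitions n \<Longrightarrow> p \<in> \<alpha> \<Longrightarrow> finite (fst p)"
  by (rule finite_subset[OF weighted_partitionsD(3)]) (assumption | simp)+

lemma merge_in_weighted_partitions:
  assumes a: "\<alpha> \<in> weighted_partitions n" and A: "(A, v) \<in> \<alpha>" and B: "(B, w) \<in> \<alpha>" and "A \<noteq> B" "u \<le> 1"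
  shows "merge u A B \<alpha> \<in> weighted_partitions n"
proof (rule weighted_partitionsI)
  note D = weighted_partitionsD[OF a]
  note m = merge_eq[OF a A B]
  let ?q = "(A \<union> B, v + w + u)"
  have A': "A \<noteq> {}" "A \<subseteq> {1..n}" and B': "B \<subseteq> {1..n}"
    using D(2,3)[OF A] D(3)[OF B] by simp_all
  have disj: "A \<inter> B = {}" using D(5)[OF A B] assms(4) by auto
  have cases: "p = ?q \<or> p \<in> \<alpha> \<and> p \<noteq> (A, v) \<and> p \<noteq> (B, w)" if "p \<in> merge u A B \<alpha>" for p
    using that unfolding m by blast
  show "fst p \<noteq> {}" if "p \<in> merge u A B \<alpha>" for p
    using cases[OF that] D(2)[of p] A'(1) by auto
  show "fst p \<subseteq> {1..n}" if "p \<in> merge u A B \<alpha>" for p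
    using cases[OF that]
  proof
    assume "p = ?q" then show ?thesis using A'(2) B' by (metis Un_least fst_conv)
  next
    assume "p \<in> \<alpha> \<and> p \<noteq> (A, v) \<and> p \<noteq> (B, w)" then show ?thesis using D(3) by blast
  qed
  show "snd p < card (fst p)" if "p \<in> merge u A B \<alpha>" for p
    using cases[OF that]
  proof
    assume p: "p = ?q"
    have "v < card A" "w < card B" using D(4)[OF A] D(4)[OF B] by auto
    moreover have "card (A \<union> B) = card A + card B"
      using block_finite[OF a A] block_finite[OF a B] disj by (simp add: card_Un_disjoint)
    ultimately show ?thesis using p assms(5) by simp
  next
    assume "p \<in> \<alpha> \<and> p \<noteq> (A, v) \<and> p \<noteq> (B, w)" then show ?thesis using D(4) by blast
  qed
  show "\<exists>p\<in>merge u A B \<alpha>. x \<in> fst p" if x: "x \<in> {1..n}" for x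
  proof -
    obtain p where p: "p \<in> \<alpha>" "x \<in> fst p" using D(6)[OF x] by blast
    show ?thesis
    proof (cases "p = (A, v) \<or> p = (B, w)")
      case True
      then have "x \<in> fst ?q" using p(2) by auto
      then show ?thesis unfolding m by blast
    next
      case False
      then show ?thesis using p unfolding m by blast
    qed
  qed
  have other: "x \<notin> A \<union> B" if p: "p \<in> \<alpha> \<and> p \<noteq> (A, v) \<and> p \<noteq> (B, w)" and x: "x \<in> fst p" for p x
    using D(5)[of p "(A, v)" x] D(5)[of p "(B, w)" x] p x A B by auto
  show "p = q" if pq: "p \<in> merge u A B \<alpha>" "q \<in> merge u A B \<alpha>" and x: "x \<in> fst p" "x \<in> fst q" for p q x
  proof -
    have "x \<in> A \<union> B \<longleftrightarrow> p = ?q" using cases[OF pq(1)] other[of p x] x(1) by auto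
    moreover have "x \<in> A \<union> B \<longleftrightarrow> q = ?q" using cases[OF pq(2)] other[of q x] x(2) by auto
    ultimately show ?thesis using cases[OF pq(1)] cases[OF pq(2)] D(5)[of p q x] x by blast
  qed
qed

lemma card_merge:
  assumes a: "\<alpha> \<in> weighted_partitions n" and A: "(A, v) \<in> \<alpha>" and B: "(B, w) \<in> \<alpha>" and "A \<noteq> B"
  shows "Suc (card (merge u A B \<alpha>)) = card \<alpha>"
proof -
  have fin: "finite \<alpha>" by (rule weighted_partitionsD(1)[OF a])
  have "(A \<union> B, v + w + u) \<notin> \<alpha>" using union_not_block[OF a A B] assms(4) by simp
  then have "card (merge u A B \<alpha>) = Suc (card (\<alpha> - {(A, v), (B, w)}))"
    unfolding merge_eq[OF a A B] using fin by (intro card_insert_disjoint) auto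
  moreover have "card (\<alpha> - {(A, v), (B, w)}) = card \<alpha> - 2"
    using A B assms(4) fin by (subst card_Diff_subset) auto
  moreover have "2 \<le> card \<alpha>"
    using card_mono[OF fin, of "{(A, v), (B, w)}"] A B assms(4) by simp
  ultimately show ?thesis by simp
qed

lemma wp_less_merge:
  assumes a: "\<alpha> \<in> weighted_partitions n" and A: "(A, v) \<in> \<alpha>" and B: "(B, w) \<in> \<alpha>" and "A \<noteq> B" "u \<le> 1"
  shows "wp_less n \<alpha> (merge u A B \<alpha>)"
proof -
  note m = merge_eq[OF a A B] and mem = merge_in_weighted_partitions[OF assms]
  have AB: "blocks_in \<alpha> (A \<union> B) = {(A, v), (B, w)}"
  proof -
    have *: "p = (A, v) \<or> p = (B, w)" if p: "p \<in> \<alpha>" "fst p \<subseteq> A \<union> B" for p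
    proof -
      obtain x where "x \<in> fst p" using weighted_partitionsD(2)[OF a p(1)] by blast
      then show ?thesis using weighted_partitionsD(5)[OF a p(1) A, of x] weighted_partitionsD(5)[OF a p(1) B, of x] p(2) by auto
    qed
    show ?thesis
    proof (rule Set.set_eqI)
      fix p show "p \<in> blocks_in \<alpha> (A \<union> B) \<longleftrightarrow> p \<in> {(A, v), (B, w)}"
        using *[of p] A B by auto
    qed
  qed
  have single: "blocks_in \<alpha> (fst q) = {q}" if "q \<in> \<alpha>" for q
  proof (rule Set.set_eqI)
    fix p show "p \<in> blocks_in \<alpha> (fst q) \<longleftrightarrow> p \<in> {q}"
      using same_block[OF a _ that, of p] that by auto
  qed
  have "wp_le n \<alpha> (merge u A B \<alpha>)"
    unfolding wp_le_iff[OF a mem]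
  proof (intro conjI ballI)
    fix p assume "p \<in> \<alpha>"
    then show "\<exists>q\<in>merge u A B \<alpha>. fst p \<subseteq> fst q" unfolding m by (cases "p \<in> {(A, v), (B, w)}") auto
  next
    fix q assume "q \<in> merge u A B \<alpha>"
    then consider "q = (A \<union> B, v + w + u)" | "q \<in> \<alpha>" unfolding m by auto
    then have "block_sum \<alpha> (fst q) \<le> snd q \<and> snd q < block_sum \<alpha> (fst q) + card (blocks_in \<alpha> (fst q))"
    proof cases
      case 1
      then show ?thesis using assms(4,5) by (simp add: AB block_sum_def)
    next
      case 2
      then show ?thesis by (simp add: single block_sum_def)
    qed
    then show "block_sum \<alpha> (fst q) \<le> snd q" "snd q < block_sum \<alpha> (fst q) + card (blocks_in \<alpha> (fst q))" by auto
  qed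
  moreover have "\<alpha> \<noteq> merge u A B \<alpha>" using card_merge[OF a A B assms(4), of u] by auto
  ultimately show ?thesis by (simp add: wp_less_def)
qed

text \<open>One block less means that exactly one block of \<open>\<beta>\<close> consists of two
  blocks and all others are unsplit. Two blocks allow the increments 0 and 1, which are the two
  colors.\<close>

lemma cover_is_merge:
  assumes a: "\<alpha> \<in> weighted_partitions n" and b: "\<beta> \<in> weighted_partitions n" and less: "wp_less n \<alpha> \<beta>"
    and "card \<alpha> = Suc (card \<beta>)"
  obtains A v B w u where "(A, v) \<in> \<alpha>" "(B, w) \<in> \<alpha>" "A \<noteq> B" "u \<le> 1" "\<beta> = merge u A B \<alpha>"
proof -
  have le: "wp_le n \<alpha> \<beta>" using less by (simp add: wp_less_def)
  note fb = weighted_partitionsD(1)[OF b]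
  have pos: "1 \<le> card (blocks_in \<alpha> (fst q))" if "q \<in> \<beta>" for q
    using blocks_in_pos(2)[OF a b le that] by simp
  have sum: "(\<Sum>q\<in>\<beta>. card (blocks_in \<alpha> (fst q))) = Suc (card \<beta>)"
    using card_eq_sum_blocks_in[OF a b le] assms(4) by simp
  have "\<exists>q\<in>\<beta>. card (blocks_in \<alpha> (fst q)) \<noteq> 1"
  proof (rule ccontr)
    assume "\<not> ?thesis"
    then have "(\<Sum>q\<in>\<beta>. card (blocks_in \<alpha> (fst q))) = card \<beta>" by simp
    with sum show False by simp
  qed
  then obtain q where q: "q \<in> \<beta>" "2 \<le> card (blocks_in \<alpha> (fst q))" using pos by fastforce
  have split: "(\<Sum>r\<in>\<beta> - {q}. card (blocks_in \<alpha> (fst r))) + card (blocks_in \<alpha> (fst q)) = Suc (card (\<beta> - {q}) + 1)"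
    using sum sum.remove[OF fb q(1), of "\<lambda>r. card (blocks_in \<alpha> (fst r))"] card_Suc_Diff1[OF fb q(1)] by simp
  have ge: "card (\<beta> - {q}) \<le> (\<Sum>r\<in>\<beta> - {q}. card (blocks_in \<alpha> (fst r)))"
    using sum_mono[of "\<beta> - {q}" "\<lambda>_. 1" "\<lambda>r. card (blocks_in \<alpha> (fst r))"] pos by simp
  have two: "card (blocks_in \<alpha> (fst q)) = 2" and eq: "(\<Sum>r\<in>\<beta> - {q}. 1) = (\<Sum>r\<in>\<beta> - {q}. card (blocks_in \<alpha> (fst r)))"
    using split ge q(2) by auto
  have one: "card (blocks_in \<alpha> (fst r)) = 1" if "r \<in> \<beta> - {q}" for r
    using sum_mono_inv[OF eq pos that] fb that by simp
  obtain p p' where p: "blocks_in \<alpha> (fst q) = {p, p'}" "p \<noteq> p'" using two by (auto simp: card_2_iff)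
  obtain A v B w where pp: "p = (A, v)" "p' = (B, w)" by (cases p; cases p')
  have mem: "(A, v) \<in> \<alpha>" "(B, w) \<in> \<alpha>" using p pp by (metis in_blocks_in insertI1 insertI2)+
  have AB: "A \<noteq> B" using same_block[OF a mem] p(2) pp by auto
  have fq: "fst q = A \<union> B" using blocks_in_pos(1)[OF a b le q(1)] p pp by auto
  have "block_sum \<alpha> (fst q) \<le> snd q" "snd q < block_sum \<alpha> (fst q) + card (blocks_in \<alpha> (fst q))"
    using le q(1) unfolding wp_le_iff[OF a b] by auto
  moreover have "block_sum \<alpha> (fst q) = v + w" unfolding block_sum_def p(1) pp using p(2) pp by simp
  ultimately obtain u where u: "snd q = v + w + u" "u \<le> 1"
    using two by (intro that[of "snd q - (v + w)"]; simp) 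
  have m: "merge u A B \<alpha> = insert q (\<alpha> - {p, p'})"
    unfolding merge_eq[OF a mem] pp using u(1) fq by (metis prod.collapse)
  \<comment> \<open>One inclusion suffices, since both sides have the same number of blocks.\<close>
  have "\<beta> \<subseteq> merge u A B \<alpha>"
  proof
    fix r assume r: "r \<in> \<beta>"
    show "r \<in> merge u A B \<alpha>"
    proof (cases "r = q")
      case False
      then have "r \<in> \<alpha>" using unsplit_block[OF a b le r] one r by simp
      moreover have "r \<notin> {p, p'}"
      proof
        assume "r \<in> {p, p'}"
        then have "fst r = A \<or> fst r = B" unfolding pp by (metis fst_conv insertE singletonD)
        then have "fst r \<subseteq> fst q" unfolding fq by blast
        from same_block[OF b r q(1) this] False show False by simp
      qed
      ultimately show ?thesis unfolding m by blast
    qed (simp add: m)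
  qed
  moreover have "card (merge u A B \<alpha>) = card \<beta>" using card_merge[OF a mem AB, of u] assms(4) by simp
  ultimately have "\<beta> = merge u A B \<alpha>"
    using weighted_partitionsD(1)[OF merge_in_weighted_partitions[OF a mem AB u(2)]] by (simp add: card_subset_eq)
  with mem AB u(2) show thesis by (rule that)
qed

lemma color_weight_le: "color_weight c \<le> 1"
  by (cases c) simp_all

text \<open>A closed form that treats the three blocks symmetrically, so that different orders of
  merging can be compared by reordering a union and a sum.\<close>

lemma merge_merge_joined:
  assumes a: "\<alpha> \<in> weighted_partitions n" and A: "(A, v) \<in> \<alpha>" and B: "(B, w) \<in> \<alpha>" and Y: "(Y, q) \<in> \<alpha>"
    and ne: "A \<noteq> B" "A \<noteq> Y" "B \<noteq> Y" and c: "c \<le> 1"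
  shows "merge d (A \<union> B) Y (merge c A B \<alpha>) =
    insert (A \<union> B \<union> Y, v + w + q + c + d) (\<alpha> - {(A, v), (B, w), (Y, q)})"
proof -
  note m = merge_eq[OF a A B, of c]
  have mem: "(A \<union> B, v + w + c) \<in> merge c A B \<alpha>" "(Y, q) \<in> merge c A B \<alpha>"
    using Y ne by (simp_all add: m)
  have "(A \<union> B, v + w + c) \<notin> \<alpha>" using union_not_block[OF a A B] ne(1) by simp
  then have "merge c A B \<alpha> - {(A \<union> B, v + w + c), (Y, q)} = \<alpha> - {(A, v), (B, w), (Y, q)}"
    unfolding m by blast
  with merge_eq[OF merge_in_weighted_partitions[OF a A B ne(1) c] mem, of d] show ?thesis by (simp add: ac_simps)
qed

lemma merge_merge_disjoint:
  assumes a: "\<alpha> \<in> weighted_partitions n" and A: "(A, v) \<in> \<alpha>" and B: "(B, w) \<in> \<alpha>" and X: "(X, p) \<in> \<alpha>" and Y: "(Y, q) \<in> \<alpha>"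
    and ne: "A \<noteq> B" "X \<noteq> Y" "X \<noteq> A" "X \<noteq> B" "Y \<noteq> A" "Y \<noteq> B" and c: "c \<le> 1"
  shows "merge d X Y (merge c A B \<alpha>) =
    insert (X \<union> Y, p + q + d) (insert (A \<union> B, v + w + c) (\<alpha> - {(A, v), (B, w), (X, p), (Y, q)}))"
proof -
  note m = merge_eq[OF a A B, of c]
  have mem: "(X, p) \<in> merge c A B \<alpha>" "(Y, q) \<in> merge c A B \<alpha>"
    using X Y ne by (simp_all add: m)
  have "(A \<union> B, v + w + c) \<notin> \<alpha>" using union_not_block[OF a A B] ne(1) by simp
  then have "(A \<union> B, v + w + c) \<noteq> (X, p)" "(A \<union> B, v + w + c) \<noteq> (Y, q)" using X Y by metis+
  then have "merge c A B \<alpha> - {(X, p), (Y, q)} =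
      insert (A \<union> B, v + w + c) (\<alpha> - {(A, v), (B, w), (X, p), (Y, q)})"
    unfolding m by blast
  with merge_eq[OF merge_in_weighted_partitions[OF a A B ne(1) c] mem, of d] show ?thesis by simp
qed

section \<open>Contraction of edges\<close>

definition step :: "color \<times> nat \<times> nat \<Rightarrow> wpartition \<Rightarrow> wpartition \<Rightarrow> bool" where
  "step e \<alpha> \<beta> \<longleftrightarrow> (\<exists>A v B w. (A, v) \<in> \<alpha> \<and> (B, w) \<in> \<alpha> \<and> A \<noteq> B \<and>
     fst (snd e) \<in> A \<and> snd (snd e) \<in> B \<and> \<beta> = merge (color_weight (fst e)) A B \<alpha>)"

lemma stepI:
  "(A, v) \<in> \<alpha> \<Longrightarrow> (B, w) \<in> \<alpha> \<Longrightarrow> A \<noteq> B \<Longrightarrow> a \<in> A \<Longrightarrow> b \<in> B \<Longrightarrow> step (c, a, b) \<alpha> (merge (color_weight c) A B \<alpha>)"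
  unfolding step_def by (intro exI conjI) simp_all

lemma stepE:
  assumes "step (c, a, b) \<alpha> \<beta>"
  obtains A v B w where "(A, v) \<in> \<alpha>" "(B, w) \<in> \<alpha>" "A \<noteq> B" "a \<in> A" "b \<in> B" "\<beta> = merge (color_weight c) A B \<alpha>"
  using assms unfolding step_def by auto

lemma step_flip: "step (c, a, b) \<alpha> \<beta> \<Longrightarrow> step (c, b, a) \<alpha> \<beta>"
proof (elim stepE)
  fix A v B w assume "(A, v) \<in> \<alpha>" "(B, w) \<in> \<alpha>" "A \<noteq> B" "a \<in> A" "b \<in> B" "\<beta> = merge (color_weight c) A B \<alpha>"
  then show ?thesis using stepI[of B w \<alpha> A v b a c] by (simp add: merge_commute[of _ B A])
qed

lemma step_unique:
  assumes a: "\<alpha> \<in> weighted_partitions n" and "step e \<alpha> \<beta>" "step e \<alpha> \<gamma>"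
  shows "\<beta> = \<gamma>"
proof -
  obtain c a b where e: "e = (c, a, b)" by (cases e)
  from assms(2)[unfolded e] obtain A v B w where 1: "(A, v) \<in> \<alpha>" "(B, w) \<in> \<alpha>" "a \<in> A" "b \<in> B" "\<beta> = merge (color_weight c) A B \<alpha>"
    by (rule stepE)
  from assms(3)[unfolded e] obtain A' v' B' w' where 2: "(A', v') \<in> \<alpha>" "(B', w') \<in> \<alpha>" "a \<in> A'" "b \<in> B'" "\<gamma> = merge (color_weight c) A' B' \<alpha>"
    by (rule stepE)
  have "A = A'" using weighted_partitionsD(5)[OF a 1(1) 2(1), of a] 1 2 by simp
  moreover have "B = B'" using weighted_partitionsD(5)[OF a 1(2) 2(2), of b] 1 2 by simp
  ultimately show ?thesis using 1 2 by simp
qed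

lemma step_props:
  assumes a: "\<alpha> \<in> weighted_partitions n" and "step e \<alpha> \<beta>"
  shows "\<beta> \<in> weighted_partitions n" "wp_less n \<alpha> \<beta>"
proof -
  obtain c a b where e: "e = (c, a, b)" by (cases e)
  from assms(2)[unfolded e] obtain A v B w where 1: "(A, v) \<in> \<alpha>" "(B, w) \<in> \<alpha>" "A \<noteq> B" "\<beta> = merge (color_weight c) A B \<alpha>"
    by (rule stepE)
  show "\<beta> \<in> weighted_partitions n" "wp_less n \<alpha> \<beta>"
    unfolding 1(4) by (rule merge_in_weighted_partitions[OF a 1(1-3) color_weight_le] wp_less_merge[OF a 1(1-3) color_weight_le])+
qed

text \<open>The second edge touches the block created by the first. Contracting the second edge
  first enlarges whichever of \<open>A\<close> and \<open>B\<close> contains its end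
  \<open>x\<close>; the first edge then joins the enlarged block to the remaining one. The case that
  \<open>x\<close> is in \<open>B\<close> follows by turning the edge around.\<close>

lemma step_commute_joined:
  assumes a: "\<alpha> \<in> weighted_partitions n" and A: "(A, v) \<in> \<alpha>" and B: "(B, w) \<in> \<alpha>" and Y: "(Y, q) \<in> \<alpha>"
    and ne: "A \<noteq> B" "A \<noteq> Y" "B \<noteq> Y" and el: "a \<in> A" "b \<in> B" "y \<in> Y" "x \<in> A \<union> B"
  shows "\<exists>\<beta>. step (d, x, y) \<alpha> \<beta> \<and>
    step (c, a, b) \<beta> (merge (color_weight d) (A \<union> B) Y (merge (color_weight c) A B \<alpha>))"
proof -
  have main: "\<exists>\<beta>. step (d, x, y) \<alpha> \<beta> \<and>
      step (c, a, b) \<beta> (merge (color_weight d) (A \<union> B) Y (merge (color_weight c) A B \<alpha>))"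
    if A: "(A, v) \<in> \<alpha>" and B: "(B, w) \<in> \<alpha>" and ne: "A \<noteq> B" "A \<noteq> Y" "B \<noteq> Y" and el: "a \<in> A" "b \<in> B" "y \<in> Y" "x \<in> A"
    for A v B w a b
  proof -
    note m = merge_eq[OF a A Y, of "color_weight d"]
    let ?\<beta> = "merge (color_weight d) A Y \<alpha>"
    have mem: "(A \<union> Y, v + q + color_weight d) \<in> ?\<beta>" "(B, w) \<in> ?\<beta>" using B ne by (simp_all add: m)
    have neq: "A \<union> Y \<noteq> B" using union_not_block[OF a A Y, of w] ne(2) B by auto
    have "merge (color_weight c) (A \<union> Y) B ?\<beta> = merge (color_weight d) (A \<union> B) Y (merge (color_weight c) A B \<alpha>)"
    proof -
      have "(A \<union> Y \<union> B, v + q + w + color_weight d + color_weight c) = (A \<union> B \<union> Y, v + w + q + color_weight c + color_weight d)"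
        by auto
      moreover have "{(A, v), (Y, q), (B, w)} = {(A, v), (B, w), (Y, q)}" by auto
      ultimately show ?thesis
        unfolding merge_merge_joined[OF a A Y B ne(2,1) ne(3)[symmetric] color_weight_le[of d], of "color_weight c"]
          merge_merge_joined[OF a A B Y ne color_weight_le[of c], of "color_weight d"] by (simp only:)
    qed
    moreover have "step (c, a, b) ?\<beta> (merge (color_weight c) (A \<union> Y) B ?\<beta>)"
      using el by (intro stepI[OF mem neq]) auto
    moreover have "step (d, x, y) \<alpha> ?\<beta>" using A Y ne(2) el(4,3) by (rule stepI)
    ultimately show ?thesis by metis
  qed
  show ?thesis
  proof (cases "x \<in> A")
    case True
    then show ?thesis using main[OF A B ne el(1-3)] by simp
  next
    case False
    then have "x \<in> B" using el(4) by simp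
    from main[OF B A ne(1)[symmetric] ne(3,2) el(2,1,3) this]
    show ?thesis by (simp add: Un_commute merge_commute[of _ B A]) (metis step_flip)
  qed
qed

text \<open>An edge names vertices rather than blocks, so it can still be contracted after another
  one. Since both contractions join different blocks, the two edges form no cycle over the blocks of
  \<open>\<alpha>\<close>, and at most one end of the second lies in the newly created
  block.\<close>

lemma step_commute:
  assumes a: "\<alpha> \<in> weighted_partitions n" and "step e \<alpha> \<beta>" "step f \<beta> \<gamma>"
  shows "\<exists>\<beta>'. step f \<alpha> \<beta>' \<and> step e \<beta>' \<gamma>"
proof -
  obtain c a b where e: "e = (c, a, b)" by (cases e)
  obtain d x y where f: "f = (d, x, y)" by (cases f)
  from assms(2)[unfolded e] obtain A v B w where 1: "(A, v) \<in> \<alpha>" "(B, w) \<in> \<alpha>" "A \<noteq> B" "a \<in> A" "b \<in> B" "\<beta> = merge (color_weight c) A B \<alpha>"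
    by (rule stepE)
  from assms(3)[unfolded f] obtain X p Y q where 2: "(X, p) \<in> \<beta>" "(Y, q) \<in> \<beta>" "X \<noteq> Y" "x \<in> X" "y \<in> Y" "\<gamma> = merge (color_weight d) X Y \<beta>"
    by (rule stepE)
  have uniq: "r = s" if "(Z, r) \<in> \<alpha>" "(Z, s) \<in> \<alpha>" for Z r s using same_block[OF a that] by simp
  have mem: "(Z, r) = (A \<union> B, v + w + color_weight c) \<or> (Z, r) \<in> \<alpha> \<and> Z \<noteq> A \<and> Z \<noteq> B" if "(Z, r) \<in> \<beta>" for Z r
  proof -
    from that have "(Z, r) = (A \<union> B, v + w + color_weight c) \<or> (Z, r) \<in> \<alpha> \<and> (Z, r) \<noteq> (A, v) \<and> (Z, r) \<noteq> (B, w)"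
      unfolding 1(6) merge_eq[OF a 1(1,2)] by blast
    then show ?thesis
    proof
      assume Z: "(Z, r) \<in> \<alpha> \<and> (Z, r) \<noteq> (A, v) \<and> (Z, r) \<noteq> (B, w)"
      then have "Z \<noteq> A" using uniq[of A r v] 1(1) by blast
      moreover have "Z \<noteq> B" using Z uniq[of B r w] 1(2) by blast
      ultimately show ?thesis using Z by blast
    qed blast
  qed
  consider "(X, p) \<in> \<alpha>" "X \<noteq> A" "X \<noteq> B" "(Y, q) \<in> \<alpha>" "Y \<noteq> A" "Y \<noteq> B"
    | "X = A \<union> B" "(Y, q) \<in> \<alpha>" "Y \<noteq> A" "Y \<noteq> B" | "Y = A \<union> B" "(X, p) \<in> \<alpha>" "X \<noteq> A" "X \<noteq> B"
    using mem[OF 2(1)] mem[OF 2(2)] 2(3) by auto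
  then show ?thesis
  proof cases
    case c1: 1
    let ?\<beta> = "merge (color_weight d) X Y \<alpha>"
    note m = merge_eq[OF a c1(1,4), of "color_weight d"]
    have "(A, v) \<in> ?\<beta>" "(B, w) \<in> ?\<beta>" unfolding m using 1(1,2) c1 by auto
    then have "step e ?\<beta> (merge (color_weight c) A B ?\<beta>)" unfolding e using 1(3-5) by (rule stepI)
    moreover have "merge (color_weight c) A B ?\<beta> = \<gamma>"
    proof -
      have "{(X, p), (Y, q), (A, v), (B, w)} = {(A, v), (B, w), (X, p), (Y, q)}" by auto
      then show ?thesis unfolding 2(6) 1(6)
        using merge_merge_disjoint[OF a 1(1,2) c1(1,4) 1(3) 2(3) c1(2,3,5,6) color_weight_le[of c], of "color_weight d"]
          merge_merge_disjoint[OF a c1(1,4) 1(1,2) 2(3) 1(3) c1(2)[symmetric] c1(5)[symmetric] c1(3)[symmetric] c1(6)[symmetric] color_weight_le[of d], of "color_weight c"]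
        by (simp add: insert_commute)
    qed
    moreover have "step f \<alpha> ?\<beta>" unfolding f using c1(1,4) 2(3-5) by (rule stepI)
    ultimately show ?thesis by metis
  next
    case c2: 2
    show ?thesis
      using step_commute_joined[OF a 1(1,2) c2(2) 1(3) c2(3)[symmetric] c2(4)[symmetric] 1(4,5) 2(5), of x d c] 2(4)
      unfolding e f 2(6) 1(6) c2(1) by blast
  next
    case 3
    have "\<gamma> = merge (color_weight d) (A \<union> B) X (merge (color_weight c) A B \<alpha>)"
      unfolding 2(6) 1(6) 3(1) by (rule merge_commute)
    then show ?thesis
      using step_commute_joined[OF a 1(1,2) 3(2) 1(3) 3(3)[symmetric] 3(4)[symmetric] 1(4,5) 2(4), of y d c] 2(5) 3(1)
      unfolding e f by (metis step_flip)
  qed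
qed

section \<open>Functionals on maximal chains\<close>

text \<open>\<open>run es p xs\<close>: the chain \<open>xs\<close> arises by contracting the edges \<open>es\<close> in the order \<open>p\<close>. The functional
  \<open>chain_weight es\<close> is the fundamental cycle of the Boolean lattice of subforests of the graph \<open>es\<close>.\<close>

definition run :: "(color \<times> nat \<times> nat) list \<Rightarrow> (nat \<Rightarrow> nat) \<Rightarrow> wpartition list \<Rightarrow> bool" where
  "run es p xs \<longleftrightarrow> (\<forall>k < length es. step (es ! p k) (xs ! k) (xs ! Suc k))"

definition chain_weight :: "(color \<times> nat \<times> nat) list \<Rightarrow> wpartition list \<Rightarrow> 'k::comm_ring_1" where
  "chain_weight es xs = (\<Sum>p | p permutes {..<length es}. if run es p xs then of_int (sign p) else 0)"

text \<open>Reindexing by the transposition would only show that twice the sum vanishes. Splitting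
  the permutations by the order of their values at \<open>i\<close> and \<open>Suc i\<close> gives
  two classes that the transposition interchanges, and these cancel over every ring.\<close>

lemma sum_permutations_transpose_zero:
  fixes g :: "(nat \<Rightarrow> nat) \<Rightarrow> 'k::comm_ring_1"
  assumes "Suc i < N" "\<And>p. p permutes {..<N} \<Longrightarrow> g (p \<circ> Transposition.transpose i (Suc i)) = - g p"
  shows "(\<Sum>p | p permutes {..<N}. g p) = 0"
proof -
  let ?\<tau> = "Transposition.transpose i (Suc i)"
  let ?S = "{p. p permutes {..<N}}"
  define S1 where "S1 = {p \<in> ?S. p i < p (Suc i)}"
  define S2 where "S2 = {p \<in> ?S. p (Suc i) < p i}"
  have fin: "finite ?S" by (rule finite_permutations) simp
  have ne: "p i \<noteq> p (Suc i)" if "p \<in> ?S" for p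
  proof
    assume "p i = p (Suc i)"
    then have "i = Suc i" using permutes_inj[of p "{..<N}"] that by (simp add: inj_eq)
    then show False by simp
  qed
  have perm: "p \<circ> ?\<tau> \<in> ?S" if "p \<in> ?S" for p
  proof -
    have "?\<tau> permutes {..<N}" using assms(1) by (intro permutes_swap_id) simp_all
    then show ?thesis using that permutes_compose[of ?\<tau> "{..<N}" p] by simp
  qed
  have S: "?S = S1 \<union> S2"
  proof (intro equalityI subsetI)
    fix p assume "p \<in> ?S"
    then show "p \<in> S1 \<union> S2" using ne[of p] linorder_neqE_nat[of "p i" "p (Suc i)"] unfolding S1_def S2_def by blast
  qed (unfold S1_def S2_def, blast)
  have disj: "S1 \<inter> S2 = {}" unfolding S1_def S2_def by (blast dest: less_not_sym)
  have finS: "finite S1" "finite S2" using fin unfolding S1_def S2_def by simp_all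
  have "(\<Sum>p\<in>S2. g p) = (\<Sum>p\<in>S1. g (p \<circ> ?\<tau>))"
  proof (rule sum.reindex_bij_witness[of _ "\<lambda>p. p \<circ> ?\<tau>" "\<lambda>p. p \<circ> ?\<tau>"])
    show "p \<circ> ?\<tau> \<circ> ?\<tau> = p" for p :: "nat \<Rightarrow> nat" by (simp add: comp_assoc)
    show "p \<circ> ?\<tau> \<circ> ?\<tau> = p" for p :: "nat \<Rightarrow> nat" by (simp add: comp_assoc)
    show "p \<circ> ?\<tau> \<in> S1" if "p \<in> S2" for p using that perm[of p] unfolding S1_def S2_def by simp
    show "p \<circ> ?\<tau> \<in> S2" if "p \<in> S1" for p using that perm[of p] unfolding S1_def S2_def by simp
    show "g (p \<circ> ?\<tau> \<circ> ?\<tau>) = g p" for p by (simp add: comp_assoc)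
  qed
  also have "\<dots> = - (\<Sum>p\<in>S1. g p)"
    using assms(2) by (simp add: S1_def sum_negf)
  finally show ?thesis
    unfolding S sum.union_disjoint[OF finS disj] by simp
qed

text \<open>A given order of contraction fits at most one filler of the gap, so the sum over fillers
  becomes a sum over orders. Exchanging the two contractions inside the gap keeps a filler
  available, by \<open>closed\<close>, and reverses the sign.\<close>

lemma chain_weight_gap:
  fixes J :: "wpartition set"
  assumes x: "x \<in> weighted_partitions n" and len: "length es = length us + length vs + 2" and J: "finite J"
    and closed: "\<And>\<alpha> e f. \<alpha> \<in> J \<Longrightarrow> step e x \<alpha> \<Longrightarrow> step f \<alpha> y \<Longrightarrow> \<exists>\<alpha>'\<in>J. step f x \<alpha>' \<and> step e \<alpha>' y"
  shows "(\<Sum>\<alpha>\<in>J. chain_weight es (us @ [x, \<alpha>, y] @ vs)) = (0 :: 'k::comm_ring_1)"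
proof -
  let ?i = "length us" and ?\<tau> = "Transposition.transpose (length us) (Suc (length us))"
  define Z where "Z \<alpha> = us @ [x, \<alpha>, y] @ vs" for \<alpha>
  have Z: "Z \<alpha> ! ?i = x" "Z \<alpha> ! Suc ?i = \<alpha>" "Z \<alpha> ! Suc (Suc ?i) = y" for \<alpha>
    by (simp_all add: Z_def nth_append)
  \<comment> \<open>The empty set is a placeholder in the gap: all other entries are independent of
    the filler.\<close>
  have Z': "Z \<alpha> ! k = Z {} ! k" if "k \<noteq> Suc ?i" for \<alpha> k
    using that by (auto simp: Z_def nth_append nth_Cons split: nat.splits)
  define rest where "rest p \<longleftrightarrow> (\<forall>k < length es. k \<noteq> ?i \<longrightarrow> k \<noteq> Suc ?i \<longrightarrow> step (es ! p k) (Z {} ! k) (Z {} ! Suc k))" for p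
  define mid where "mid p \<alpha> \<longleftrightarrow> step (es ! p ?i) x \<alpha> \<and> step (es ! p (Suc ?i)) \<alpha> y" for p \<alpha>
  have run: "run es p (Z \<alpha>) \<longleftrightarrow> rest p \<and> mid p \<alpha>" for p \<alpha>
  proof
    assume r: "run es p (Z \<alpha>)"
    have "mid p \<alpha>" using r[unfolded run_def, rule_format, of ?i] r[unfolded run_def, rule_format, of "Suc ?i"] len
      by (simp add: mid_def Z)
    moreover have "rest p" unfolding rest_def
    proof (intro allI impI)
      fix k assume "k < length es" "k \<noteq> ?i" "k \<noteq> Suc ?i"
      then show "step (es ! p k) (Z {} ! k) (Z {} ! Suc k)"
        using r[unfolded run_def, rule_format, of k] Z'[of k \<alpha>] Z'[of "Suc k" \<alpha>] by simp
    qed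
    ultimately show "rest p \<and> mid p \<alpha>" by simp
  next
    assume r: "rest p \<and> mid p \<alpha>"
    show "run es p (Z \<alpha>)" unfolding run_def
    proof (intro allI impI)
      fix k assume k: "k < length es"
      consider "k = ?i" | "k = Suc ?i" | "k \<noteq> ?i" "k \<noteq> Suc ?i" by blast
      then show "step (es ! p k) (Z \<alpha> ! k) (Z \<alpha> ! Suc k)"
      proof cases
        case 3
        then show ?thesis using r k Z'[of k \<alpha>] Z'[of "Suc k" \<alpha>] by (simp add: rest_def)
      qed (use r in \<open>simp_all add: mid_def Z\<close>)
    qed
  qed
  define g :: "(nat \<Rightarrow> nat) \<Rightarrow> 'k" where "g p = (if rest p \<and> (\<exists>\<alpha>\<in>J. mid p \<alpha>) then of_int (sign p) else 0)" for p
  have g: "(\<Sum>\<alpha>\<in>J. if run es p (Z \<alpha>) then of_int (sign p) else 0) = g p" for p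
  proof (cases "rest p \<and> (\<exists>\<alpha>\<in>J. mid p \<alpha>)")
    case True
    then obtain \<beta> where \<beta>: "\<beta> \<in> J" "mid p \<beta>" by blast
    have "run es p (Z \<alpha>) \<longleftrightarrow> \<alpha> = \<beta>" for \<alpha>
      using run True \<beta>(2) step_unique[OF x] unfolding mid_def by metis
    then show ?thesis using True J \<beta>(1) by (simp add: g_def)
  next
    case False
    then have "\<not> run es p (Z \<alpha>)" if "\<alpha> \<in> J" for \<alpha> using run that by blast
    moreover have "g p = 0" unfolding g_def using False by (rule if_not_P)
    ultimately show ?thesis by (simp add: sum.neutral)
  qed
  have "(\<Sum>\<alpha>\<in>J. chain_weight es (Z \<alpha>)) = (\<Sum>p | p permutes {..<length es}. g p)"
    unfolding chain_weight_def g[symmetric] by (rule sum.swap)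
  also have "\<dots> = 0"
  proof (rule sum_permutations_transpose_zero[of ?i])
    show "Suc ?i < length es" using len by simp
    fix p assume p: "p permutes {..<length es}"
    have 1: "rest (p \<circ> ?\<tau>) \<longleftrightarrow> rest p"
      unfolding rest_def by (intro all_cong1 imp_cong refl) (simp add: transpose_apply_other)
    have 2: "(\<exists>\<alpha>\<in>J. mid (p \<circ> ?\<tau>) \<alpha>) \<longleftrightarrow> (\<exists>\<alpha>\<in>J. mid p \<alpha>)"
    proof -
      have "mid (p \<circ> ?\<tau>) \<alpha> \<longleftrightarrow> step (es ! p (Suc ?i)) x \<alpha> \<and> step (es ! p ?i) \<alpha> y" for \<alpha>
        by (simp add: mid_def)
      then show ?thesis unfolding mid_def using closed by meson
    qed
    have 3: "sign (p \<circ> ?\<tau>) = - sign p"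
    proof -
      have "permutation p" using p unfolding permutation_permutes by blast
      then show ?thesis by (simp add: sign_compose permutation_swap_id sign_swap_id)
    qed
    show "g (p \<circ> ?\<tau>) = - g p"
      unfolding g_def 1 2 3 by (simp only: of_int_minus if_distrib[of uminus] minus_zero)
  qed
  finally show ?thesis by (simp add: Z_def)
qed

section \<open>The interval below a maximal element\<close>

lemma wp_bot_in: "wp_bot n \<in> weighted_partitions n"
proof -
  have "fst ` wp_bot n = (\<lambda>j. {j}) ` {1..n}" unfolding wp_bot_def by force
  then show ?thesis
    unfolding weighted_partitions_def using partition_on_singletons[of "{1..n}"]
    by (auto simp: wp_bot_def inj_on_def)
qed

lemma wp_top_in: "1 \<le> n \<Longrightarrow> i \<le> n - 1 \<Longrightarrow> wp_top n i \<in> weighted_partitions n"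
  unfolding weighted_partitions_def using partition_on_space[of "{1..n}"] by (auto simp: wp_top_def)

lemma card_wp_bot: "card (wp_bot n) = n"
  unfolding wp_bot_def by (subst card_image) (auto simp: inj_on_def)

lemma card_wp_top: "card (wp_top n i) = 1"
  by (simp add: wp_top_def)

text \<open>For \<open>n = 1\<close> the two ends coincide and cohomology follows the convention for
  degenerate intervals, so that case is treated apart.\<close>

locale max_interval =
  fixes n i :: nat
  assumes n: "2 \<le> n" and i: "i \<le> n - 1"
begin

abbreviation "P \<equiv> weighted_partitions n"
abbreviation "lt \<equiv> wp_less n"
abbreviation "I \<equiv> open_interval P lt (wp_bot n) (wp_top n i)"
abbreviation "whole zs \<equiv> wp_bot n # zs @ [wp_top n i]"

lemma bot_in: "wp_bot n \<in> P" and top_in: "wp_top n i \<in> P"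
  using wp_bot_in wp_top_in n i by auto

lemma I_subset: "I \<subseteq> P"
  by (auto simp: open_interval_def)

lemma lt_trans: "\<alpha> \<in> P \<Longrightarrow> \<beta> \<in> P \<Longrightarrow> \<gamma> \<in> P \<Longrightarrow> lt \<alpha> \<beta> \<Longrightarrow> lt \<beta> \<gamma> \<Longrightarrow> lt \<alpha> \<gamma>"
  by (rule wp_less_trans)

lemma whole_in: "set ys \<subseteq> I \<Longrightarrow> set (whole ys) \<subseteq> P"
  using I_subset bot_in top_in by auto

lemma bot_less_top: "lt (wp_bot n) (wp_top n i)"
proof -
  have "blocks_in (wp_bot n) {1..n} = wp_bot n" by (auto simp: blocks_in_def wp_bot_def)
  moreover have "(\<Sum>p\<in>wp_bot n. snd p) = 0" by (auto simp: wp_bot_def)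
  moreover have "\<forall>p\<in>wp_bot n. fst p \<subseteq> {1..n}" by (auto simp: wp_bot_def)
  ultimately have "wp_le n (wp_bot n) (wp_top n i)"
    unfolding wp_le_iff[OF bot_in top_in] using n i by (simp add: wp_top_def block_sum_def card_wp_bot)
  moreover have "wp_bot n \<noteq> wp_top n i"
  proof
    assume "wp_bot n = wp_top n i"
    from arg_cong[OF this, of card] show False using n by (simp add: card_wp_bot card_wp_top)
  qed
  ultimately show ?thesis by (simp add: wp_less_def)
qed

text \<open>The adjoined minimum and maximum of the open interval are realized by its two ends. Once
  they are written into the chain, the first and the last gap are gaps like all others.\<close>

lemma gap_set:
  assumes ys: "set ys \<subseteq> I" and j: "j \<le> length ys"
  shows "{\<alpha> \<in> I. (0 < j \<longrightarrow> lt (ys ! (j - 1)) \<alpha>) \<and> (j < length ys \<longrightarrow> lt \<alpha> (ys ! j))} =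
     {\<alpha> \<in> P. lt (whole ys ! j) \<alpha> \<and> lt \<alpha> (whole ys ! Suc j)}"
proof (rule Set.set_eqI)
  fix \<alpha>
  have lo: "lt (wp_bot n) \<alpha> \<and> (0 < j \<longrightarrow> lt (ys ! (j - 1)) \<alpha>) \<longleftrightarrow> lt (whole ys ! j) \<alpha>" if "\<alpha> \<in> P"
  proof (cases j)
    case (Suc k)
    then have y: "ys ! k \<in> I" using j ys by (intro subsetD[OF ys] nth_mem) simp
    then have "ys ! k \<in> P" "lt (wp_bot n) (ys ! k)" by (simp_all add: open_interval_def)
    then show ?thesis using lt_trans[OF bot_in _ that, of "ys ! k"] Suc j by (auto simp: nth_append)
  qed simp
  have hi: "lt \<alpha> (wp_top n i) \<and> (j < length ys \<longrightarrow> lt \<alpha> (ys ! j)) \<longleftrightarrow> lt \<alpha> (whole ys ! Suc j)" if "\<alpha> \<in> P"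
  proof (cases "j < length ys")
    case True
    then have y: "ys ! j \<in> I" using ys by (intro subsetD[OF ys] nth_mem) simp
    then have "ys ! j \<in> P" "lt (ys ! j) (wp_top n i)" by (simp_all add: open_interval_def)
    then show ?thesis using lt_trans[OF that _ top_in, of "ys ! j"] True by (auto simp: nth_append)
  next
    case False
    then have "j = length ys" using j by simp
    then show ?thesis by (simp add: nth_append)
  qed
  show "\<alpha> \<in> {\<alpha> \<in> I. (0 < j \<longrightarrow> lt (ys ! (j - 1)) \<alpha>) \<and> (j < length ys \<longrightarrow> lt \<alpha> (ys ! j))} \<longleftrightarrow>
      \<alpha> \<in> {\<alpha> \<in> P. lt (whole ys ! j) \<alpha> \<and> lt \<alpha> (whole ys ! Suc j)}"
    using lo hi unfolding open_interval_def by blast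
qed

lemma whole_split:
  assumes "j \<le> length ys"
  shows "whole (take j ys @ \<alpha> # drop j ys) =
    take j (whole ys) @ [whole ys ! j, \<alpha>, whole ys ! Suc j] @ drop (Suc (Suc j)) (whole ys)"
proof -
  have "whole (take j ys @ \<alpha> # drop j ys) = take (Suc j) (whole ys) @ \<alpha> # drop (Suc j) (whole ys)"
    using assms by simp
  also have "take (Suc j) (whole ys) = take j (whole ys) @ [whole ys ! j]"
    using assms by (intro take_Suc_conv_app_nth) simp
  also have "drop (Suc j) (whole ys) = whole ys ! Suc j # drop (Suc (Suc j)) (whole ys)"
    using assms by (intro Cons_nth_drop_Suc[symmetric]) simp
  finally show ?thesis by simp
qed

text \<open>Here \<open>ys\<close> has \<open>n - 3\<close> entries, so a filled chain with both
  ends has \<open>n\<close> entries and \<open>n - 1\<close> steps, one for each edge. Every gap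
  contributes 0 separately, so the alternating signs of the coboundary do not interfere.\<close>

lemma coboundary_weight:
  assumes ys: "ys \<in> chains I lt (int n - 4)" and es: "length es = n - 1"
  shows "linear_ext (\<lambda>zs. chain_weight es (whole zs)) (coboundary_chain I lt ys) = (0 :: 'k::comm_ring_1)"
proof -
  have ysI: "set ys \<subseteq> I" and len: "int (length ys) = int n - 3"
    using ys by (auto simp: chains_def)
  have "(\<Sum>\<alpha> | \<alpha> \<in> I \<and> (0 < j \<longrightarrow> lt (ys ! (j - 1)) \<alpha>) \<and> (j < length ys \<longrightarrow> lt \<alpha> (ys ! j)).
      chain_weight es (whole (take j ys @ \<alpha> # drop j ys))) = (0 :: 'k)" if j: "j \<le> length ys" for j
    unfolding gap_set[OF ysI j] whole_split[OF j]
  proof (rule chain_weight_gap)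
    have "whole ys ! k \<in> P" if "k < length (whole ys)" for k
      using whole_in[OF ysI] that by (meson nth_mem subsetD)
    then show x: "whole ys ! j \<in> P" using j by simp
    show "length es = length (take j (whole ys)) + length (drop (Suc (Suc j)) (whole ys)) + 2"
      using es len j n by simp
    show "finite {\<alpha> \<in> P. lt (whole ys ! j) \<alpha> \<and> lt \<alpha> (whole ys ! Suc j)}"
      using finite_weighted_partitions by simp
    fix \<alpha> e f
    assume "\<alpha> \<in> {\<alpha> \<in> P. lt (whole ys ! j) \<alpha> \<and> lt \<alpha> (whole ys ! Suc j)}" "step e (whole ys ! j) \<alpha>" "step f \<alpha> (whole ys ! Suc j)"
    then obtain \<beta> where \<beta>: "step f (whole ys ! j) \<beta>" "step e \<beta> (whole ys ! Suc j)" using step_commute[OF x] by blast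
    then show "\<exists>\<alpha>'\<in>{\<alpha> \<in> P. lt (whole ys ! j) \<alpha> \<and> lt \<alpha> (whole ys ! Suc j)}. step f (whole ys ! j) \<alpha>' \<and> step e \<alpha>' (whole ys ! Suc j)"
      using step_props[OF x \<beta>(1)] step_props(2)[OF _ \<beta>(2)] by blast
  qed
  then show ?thesis
    unfolding coboundary_chain_def linear_ext_sum linear_ext_single
    by (simp add: sum_distrib_left[symmetric])
qed

end

section \<open>Merge sequences\<close>

type_synonym node = "color \<times> nat set \<times> nat set"

text \<open>\<open>merge\<close> is total: if one of the two blocks is absent, the other simply
  disappears. Legality of a merge is therefore recorded separately.\<close>

fun mergeable :: "node \<Rightarrow> wpartition \<Rightarrow> bool" where
  "mergeable (c, A, B) \<alpha> \<longleftrightarrow> A \<in> fst ` \<alpha> \<and> B \<in> fst ` \<alpha> \<and> A \<noteq> B"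

fun apply_node :: "node \<Rightarrow> wpartition \<Rightarrow> wpartition" where
  "apply_node (c, A, B) \<alpha> = merge (color_weight c) A B \<alpha>"

fun valid_nodes :: "wpartition \<Rightarrow> node list \<Rightarrow> bool" where
  "valid_nodes \<alpha> [] \<longleftrightarrow> True"
| "valid_nodes \<alpha> (x # xs) \<longleftrightarrow> mergeable x \<alpha> \<and> valid_nodes (apply_node x \<alpha>) xs"

abbreviation final :: "wpartition \<Rightarrow> node list \<Rightarrow> wpartition" where
  "final \<alpha> ns \<equiv> fold apply_node ns \<alpha>"

lemma merge_chain_Cons [simp]: "merge_chain \<alpha> (x # xs) = \<alpha> # merge_chain (apply_node x \<alpha>) xs"
  by (cases x) simp

declare merge_chain.simps(2) [simp del]

lemma valid_nodes_append: "valid_nodes \<alpha> (xs @ ys) \<longleftrightarrow> valid_nodes \<alpha> xs \<and> valid_nodes (final \<alpha> xs) ys"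
  by (induction xs arbitrary: \<alpha>) auto

lemma merge_chain_nonempty [simp]: "merge_chain \<alpha> ns \<noteq> []"
  by (cases ns) auto

lemma length_merge_chain [simp]: "length (merge_chain \<alpha> ns) = Suc (length ns)"
  by (induction ns arbitrary: \<alpha>) auto

lemma hd_merge_chain: "hd (merge_chain \<alpha> ns) = \<alpha>"
  by (cases ns) auto

lemma merge_chain_append: "merge_chain \<alpha> (xs @ ys) = butlast (merge_chain \<alpha> xs) @ merge_chain (final \<alpha> xs) ys"
  by (induction xs arbitrary: \<alpha>) auto

lemma last_merge_chain: "last (merge_chain \<alpha> ns) = final \<alpha> ns"
  by (induction ns arbitrary: \<alpha>) auto

lemma nth_merge_chain: "k \<le> length ns \<Longrightarrow> merge_chain \<alpha> ns ! k = final \<alpha> (take k ns)"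
proof (induction ns arbitrary: \<alpha> k)
  case (Cons x ns)
  then show ?case by (cases k) auto
qed simp

lemma mergeableE:
  assumes "mergeable x \<alpha>"
  obtains c A v B w where "x = (c, A, B)" "(A, v) \<in> \<alpha>" "(B, w) \<in> \<alpha>" "A \<noteq> B"
  using assms by (cases x) force

lemma apply_node_props:
  assumes a: "\<alpha> \<in> weighted_partitions n" and "mergeable x \<alpha>"
  shows "apply_node x \<alpha> \<in> weighted_partitions n" "wp_less n \<alpha> (apply_node x \<alpha>)" "Suc (card (apply_node x \<alpha>)) = card \<alpha>"
proof -
  from assms(2) obtain c A v B w where x: "x = (c, A, B)" and 1: "(A, v) \<in> \<alpha>" "(B, w) \<in> \<alpha>" "A \<noteq> B"
    by (rule mergeableE)
  show "apply_node x \<alpha> \<in> weighted_partitions n" "wp_less n \<alpha> (apply_node x \<alpha>)" "Suc (card (apply_node x \<alpha>)) = card \<alpha>"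
    unfolding x apply_node.simps
    by (rule merge_in_weighted_partitions[OF a 1 color_weight_le] wp_less_merge[OF a 1 color_weight_le] card_merge[OF a 1])+
qed

lemma final_props:
  assumes "\<alpha> \<in> weighted_partitions n" "valid_nodes \<alpha> ns"
  shows "final \<alpha> ns \<in> weighted_partitions n" "card (final \<alpha> ns) + length ns = card \<alpha>"
proof -
  have "final \<alpha> ns \<in> weighted_partitions n \<and> card (final \<alpha> ns) + length ns = card \<alpha>"
    using assms
  proof (induction ns arbitrary: \<alpha>)
    case (Cons x ns)
    have x: "mergeable x \<alpha>" and v: "valid_nodes (apply_node x \<alpha>) ns" using Cons.prems(2) by simp_all
    note p = apply_node_props[OF Cons.prems(1) x]
    show ?case using Cons.IH[OF p(1) v] p(3) by simp
  qed simp
  then show "final \<alpha> ns \<in> weighted_partitions n" "card (final \<alpha> ns) + length ns = card \<alpha>" by simp_all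
qed

lemma sorted_merge_chain:
  assumes "\<alpha> \<in> weighted_partitions n" "valid_nodes \<alpha> ns"
  shows "set (merge_chain \<alpha> ns) \<subseteq> weighted_partitions n \<and> sorted_wrt (wp_less n) (merge_chain \<alpha> ns)"
  using assms
proof (induction ns arbitrary: \<alpha>)
  case (Cons x ns)
  let ?\<beta> = "apply_node x \<alpha>"
  have x: "mergeable x \<alpha>" and v: "valid_nodes ?\<beta> ns" using Cons.prems(2) by auto
  note p = apply_node_props[OF Cons.prems(1) x]
  note IH = Cons.IH[OF p(1) v]
  have \<beta>: "merge_chain ?\<beta> ns = ?\<beta> # tl (merge_chain ?\<beta> ns)"
    using hd_merge_chain[of ?\<beta> ns] merge_chain_nonempty[of ?\<beta> ns] by (metis list.collapse)
  have "wp_less n \<alpha> \<gamma>" if "\<gamma> \<in> set (merge_chain ?\<beta> ns)" for \<gamma>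
  proof (cases "\<gamma> = ?\<beta>")
    case False
    then have "\<gamma> \<in> set (tl (merge_chain ?\<beta> ns))" using that \<beta> by (metis set_ConsD)
    moreover have "sorted_wrt (wp_less n) (?\<beta> # tl (merge_chain ?\<beta> ns))" using IH \<beta> by metis
    ultimately have "wp_less n ?\<beta> \<gamma>" by simp
    then show ?thesis using wp_less_trans[OF Cons.prems(1) p(1) _ p(2)] IH that by blast
  qed (simp add: p(2))
  then show ?case using IH Cons.prems(1) by simp
qed simp

lemma fst_apply_node:
  assumes a: "\<alpha> \<in> weighted_partitions n" and "mergeable (c, A, B) \<alpha>"
  shows "fst ` apply_node (c, A, B) \<alpha> = insert (A \<union> B) (fst ` \<alpha> - {A, B})"
proof -
  obtain v w where 1: "(A, v) \<in> \<alpha>" "(B, w) \<in> \<alpha>" using assms(2) by force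
  have "fst ` (\<alpha> - {(A, v), (B, w)}) = fst ` \<alpha> - {A, B}"
  proof -
    have "p = q" if "p \<in> \<alpha>" "q \<in> \<alpha>" "fst p = fst q" for p q
      using same_block[OF a that(1,2)] that(3) by simp
    then have "inj_on fst \<alpha>" by (rule inj_onI)
    then have "fst ` (\<alpha> - {(A, v), (B, w)}) = fst ` \<alpha> - fst ` {(A, v), (B, w)}"
      using 1 by (intro inj_on_image_set_diff[of fst \<alpha>]) auto
    then show ?thesis by simp
  qed
  then show ?thesis unfolding apply_node.simps merge_eq[OF a 1] by simp
qed

text \<open>Counts the red merges performed so far; this ties the number of red nodes to the weight
  \<open>i\<close> of the top element.\<close>

definition total_weight :: "wpartition \<Rightarrow> nat" where
  "total_weight \<alpha> = (\<Sum>p\<in>\<alpha>. snd p)"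

lemma total_weight_apply:
  assumes a: "\<alpha> \<in> weighted_partitions n" and "mergeable x \<alpha>"
  shows "total_weight (apply_node x \<alpha>) = total_weight \<alpha> + color_weight (fst x)"
proof -
  from assms(2) obtain c A v B w where x: "x = (c, A, B)" and 1: "(A, v) \<in> \<alpha>" "(B, w) \<in> \<alpha>" "A \<noteq> B"
    by (rule mergeableE)
  have fin: "finite \<alpha>" by (rule weighted_partitionsD(1)[OF a])
  have "(A \<union> B, v + w + color_weight c) \<notin> \<alpha>" using union_not_block[OF a 1(1,2)] 1(3) by simp
  then have "total_weight (apply_node x \<alpha>) = v + w + color_weight c + (\<Sum>p\<in>\<alpha> - {(A, v), (B, w)}. snd p)"
    unfolding x apply_node.simps merge_eq[OF a 1(1,2)] total_weight_def using fin by (subst sum.insert) auto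
  moreover have "total_weight \<alpha> = (\<Sum>p\<in>\<alpha> - {(A, v), (B, w)}. snd p) + (\<Sum>p\<in>{(A, v), (B, w)}. snd p)"
    unfolding total_weight_def using fin 1 by (intro sum.subset_diff) auto
  ultimately show ?thesis using 1(3) by (simp add: x)
qed

lemma total_weight_final:
  assumes "\<alpha> \<in> weighted_partitions n" "valid_nodes \<alpha> ns"
  shows "total_weight (final \<alpha> ns) = total_weight \<alpha> + (\<Sum>x\<leftarrow>ns. color_weight (fst x))"
  using assms
proof (induction ns arbitrary: \<alpha>)
  case (Cons x ns)
  then show ?case using apply_node_props(1)[OF Cons.prems(1), of x] total_weight_apply[OF Cons.prems(1), of x] by simp
qed simp

lemma sum_color_weight_postorder: "(\<Sum>x\<leftarrow>postorder T. color_weight (fst x)) = red_count T"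
proof (induction T)
  case (Node c l r)
  then show ?case by (cases c) simp_all
qed simp

lemma length_postorder: "Suc (length (postorder T)) = length (leaf_labels T)"
  by (induction T) simp_all

abbreviation leaf_set :: "ltree \<Rightarrow> nat set" where
  "leaf_set T \<equiv> set (leaf_labels T)"

text \<open>The start is an arbitrary partition in which the leaves are singletons, because the
  right subtree begins with the partition left behind by the left one.\<close>

lemma postorder_valid:
  assumes "\<alpha> \<in> weighted_partitions n" "distinct (leaf_labels T)" "\<And>a. a \<in> leaf_set T \<Longrightarrow> {a} \<in> fst ` \<alpha>"
  shows "valid_nodes \<alpha> (postorder T) \<and>
    fst ` final \<alpha> (postorder T) = insert (leaf_set T) (fst ` \<alpha> - (\<lambda>a. {a}) ` leaf_set T)"
  using assms
proof (induction T arbitrary: \<alpha>)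
  case (Leaf a)
  then show ?case by auto
next
  case (Node c l r)
  let ?L = "leaf_set l" and ?R = "leaf_set r"
  let ?s = "\<lambda>a :: nat. {a}"
  have disj: "?L \<inter> ?R = {}" and d: "distinct (leaf_labels l)" "distinct (leaf_labels r)" using Node.prems(2) by auto
  have ne: "?L \<noteq> {}" "?R \<noteq> {}" by simp_all
  have sing: "{a} \<in> fst ` \<alpha>" if "a \<in> ?L \<union> ?R" for a using Node.prems(3)[of a] that by simp
  have l: "valid_nodes \<alpha> (postorder l)" "fst ` final \<alpha> (postorder l) = insert ?L (fst ` \<alpha> - ?s ` ?L)"
    using Node.IH(1)[OF Node.prems(1) d(1)] sing by auto
  let ?\<beta> = "final \<alpha> (postorder l)"
  have \<beta>: "?\<beta> \<in> weighted_partitions n" by (rule final_props(1)[OF Node.prems(1) l(1)])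
  have "{a} \<in> fst ` ?\<beta>" if "a \<in> ?R" for a
    unfolding l(2) using sing[of a] that disj by auto
  then have r: "valid_nodes ?\<beta> (postorder r)" "fst ` final ?\<beta> (postorder r) = insert ?R (insert ?L (fst ` \<alpha> - ?s ` ?L) - ?s ` ?R)"
    using Node.IH(2)[OF \<beta> d(2)] unfolding l(2) by auto
  let ?\<gamma> = "final ?\<beta> (postorder r)"
  have \<gamma>: "?\<gamma> \<in> weighted_partitions n" by (rule final_props(1)[OF \<beta> r(1)])
  have "?L \<notin> ?s ` ?R" using disj by auto
  then have g: "fst ` ?\<gamma> = insert ?R (insert ?L (fst ` \<alpha> - ?s ` ?L - ?s ` ?R))" unfolding r(2) by auto
  have LR: "?L \<noteq> ?R" using disj ne by auto
  have m: "mergeable (c, ?L, ?R) ?\<gamma>" using LR by (simp add: g)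
  \<comment> \<open>The other blocks of \<open>\<alpha>\<close> are disjoint from the leaves
    concerned, so removing the two subtree blocks removes none of them.\<close>
  have block: "X \<notin> fst ` \<alpha> - ?s ` ?L - ?s ` ?R" if X: "X \<subseteq> ?L \<union> ?R" "X \<noteq> {}" for X
  proof
    assume X': "X \<in> fst ` \<alpha> - ?s ` ?L - ?s ` ?R"
    obtain a where a: "a \<in> X" using X(2) by blast
    obtain v w where "({a}, v) \<in> \<alpha>" "(X, w) \<in> \<alpha>" using X' sing[of a] a X(1) by force
    then have "X = {a}" using weighted_partitionsD(5)[OF Node.prems(1), of "({a}, v)" "(X, w)" a] a by simp
    then show False using X' a X(1) by blast
  qed
  have "fst ` final \<alpha> (postorder (Node c l r)) = insert (?L \<union> ?R) (fst ` ?\<gamma> - {?L, ?R})"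
    using fst_apply_node[OF \<gamma> m] by simp
  also have "\<dots> = insert (?L \<union> ?R) (fst ` \<alpha> - ?s ` ?L - ?s ` ?R)"
    unfolding g using block[of ?L] block[of ?R] ne by blast
  also have "\<dots> = insert (leaf_set (Node c l r)) (fst ` \<alpha> - ?s ` leaf_set (Node c l r))" by (simp add: image_Un Diff_eq ac_simps)
  finally have "fst ` final \<alpha> (postorder (Node c l r)) = insert (leaf_set (Node c l r)) (fst ` \<alpha> - ?s ` leaf_set (Node c l r))" .
  moreover have "valid_nodes \<alpha> (postorder (Node c l r))"
    using l(1) r(1) m by (simp add: valid_nodes_append)
  ultimately show ?case by blast
qed

text \<open>A merge can be read off from its result: the only new block is the union, the blocks of
  \<open>\<alpha>\<close> inside it are the two that were merged, and the increment of the weight is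
  the color.\<close>

lemma crossed_nodeE:
  assumes a: "\<alpha> \<in> weighted_partitions n" and "mergeable nd \<alpha>" "step e \<alpha> (apply_node nd \<alpha>)"
  shows "crossed {e} nd"
proof -
  from assms(2) obtain c L l R r where nd: "nd = (c, L, R)" and 1: "(L, l) \<in> \<alpha>" "(R, r) \<in> \<alpha>" "L \<noteq> R"
    by (rule mergeableE)
  obtain d a b where e: "e = (d, a, b)" by (cases e)
  from assms(3)[unfolded e] obtain A v B w where 2: "(A, v) \<in> \<alpha>" "(B, w) \<in> \<alpha>" "A \<noteq> B" "a \<in> A" "b \<in> B"
    "apply_node nd \<alpha> = merge (color_weight d) A B \<alpha>" by (rule stepE)
  have eq: "insert (A \<union> B, v + w + color_weight d) (\<alpha> - {(A, v), (B, w)}) =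
      insert (L \<union> R, l + r + color_weight c) (\<alpha> - {(L, l), (R, r)})"
    using 2(6) unfolding nd apply_node.simps merge_eq[OF a 1(1,2)] merge_eq[OF a 2(1,2)] by simp
  have "(A \<union> B, v + w + color_weight d) \<notin> \<alpha>" using union_not_block[OF a 2(1,2)] 2(3) by simp
  then have new: "A \<union> B = L \<union> R" "v + w + color_weight d = l + r + color_weight c"
    using insertI1[of "(A \<union> B, v + w + color_weight d)" "\<alpha> - {(A, v), (B, w)}", unfolded eq] by auto
  have part: "(X, x) = (L, l) \<or> (X, x) = (R, r)" if X: "(X, x) \<in> \<alpha>" "X \<subseteq> L \<union> R" for X x
  proof -
    obtain y where "y \<in> X" using weighted_partitionsD(2)[OF a X(1)] by auto
    then show ?thesis
      using weighted_partitionsD(5)[OF a X(1) 1(1), of y] weighted_partitionsD(5)[OF a X(1) 1(2), of y] X(2) by auto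
  qed
  have "(A, v) = (L, l) \<or> (A, v) = (R, r)" "(B, w) = (L, l) \<or> (B, w) = (R, r)"
    using part[OF 2(1)] part[OF 2(2)] new(1) by auto
  then consider "A = L" "v = l" "B = R" "w = r" | "A = R" "v = r" "B = L" "w = l" using 2(3) by auto
  then show ?thesis
  proof cases
    case c1: 1
    then have "color_weight d = color_weight c" using new(2) by simp
    then have "d = c" by (cases c; cases d) simp_all
    then show ?thesis using c1 2(4,5) by (simp add: crossed_def e nd)
  next
    case c2: 2
    then have "color_weight d = color_weight c" using new(2) by simp
    then have "d = c" by (cases c; cases d) simp_all
    then show ?thesis using c2 2(4,5) by (simp add: crossed_def e nd)
  qed
qed

lemma step_if_crossed:
  assumes "mergeable nd \<alpha>" "crossed {e} nd"
  shows "step e \<alpha> (apply_node nd \<alpha>)"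
proof -
  from assms(1) obtain c L l R r where nd: "nd = (c, L, R)" and 1: "(L, l) \<in> \<alpha>" "(R, r) \<in> \<alpha>" "L \<noteq> R"
    by (rule mergeableE)
  obtain a b where e: "e = (c, a, b)" "a \<in> L \<and> b \<in> R \<or> a \<in> R \<and> b \<in> L"
    using assms(2) unfolding crossed_def nd by auto
  from e(2) show ?thesis
  proof
    assume "a \<in> L \<and> b \<in> R" then show ?thesis unfolding e(1) nd apply_node.simps using 1 by (intro stepI) auto
  next
    assume "a \<in> R \<and> b \<in> L" then show ?thesis
      unfolding e(1) nd apply_node.simps using stepI[OF 1, of b a c] by (intro step_flip[of c b a]) auto
  qed
qed

lemma crossed_Collect: "crossed {e} nd \<Longrightarrow> e \<in> G \<Longrightarrow> crossed G nd"
  unfolding crossed_def by auto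

lemma tree_edges_cross: "list_all2 (\<lambda>e nd. crossed {e} nd) (tree_edges T) (postorder T)"
proof (induction T)
  case (Node c l r)
  have "end_vertex (word_of l) \<in> leaf_set l" "hd (leaf_labels r) \<in> leaf_set r"
    using end_vertex_in_labels[of "word_of l"] by simp_all
  then have "crossed {(c, end_vertex (word_of l), hd (leaf_labels r))} (c, leaf_set l, leaf_set r)"
    by (simp add: crossed_def)
  then show ?case using Node by (simp add: list_all2_appendI)
qed simp

lemma postorder_labels: "(c, A, B) \<in> set (postorder T) \<Longrightarrow> A \<subseteq> leaf_set T \<and> B \<subseteq> leaf_set T"
  by (induction T) auto

text \<open>An edge can cross only the lowest node above both of its ends.\<close>

lemma postorder_crossed_unique:
  "distinct (leaf_labels T) \<Longrightarrow> sorted_wrt (\<lambda>nd nd'. \<not> (\<exists>e. crossed {e} nd \<and> crossed {e} nd')) (postorder T)"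
proof (induction T)
  case (Node c l r)
  have disj: "leaf_set l \<inter> leaf_set r = {}" using Node.prems by simp
  have in_labels: "fst (snd e) \<in> leaf_set t \<and> snd (snd e) \<in> leaf_set t" if "nd \<in> set (postorder t)" "crossed {e} nd" for t nd e
    using that postorder_labels[of "fst nd" "fst (snd nd)" "snd (snd nd)" t] unfolding crossed_def by auto
  have root: "fst (snd e) \<in> leaf_set l \<and> snd (snd e) \<in> leaf_set r \<or> fst (snd e) \<in> leaf_set r \<and> snd (snd e) \<in> leaf_set l"
    if "crossed {e} (c, leaf_set l, leaf_set r)" for e
    using that unfolding crossed_def by auto
  have 1: "\<not> (crossed {e} nd \<and> crossed {e} nd')" if "nd \<in> set (postorder l)" "nd' \<in> set (postorder r)" for nd nd' e
    using in_labels[OF that(1), of e] in_labels[OF that(2), of e] disj by blast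
  have 2: "\<not> (crossed {e} nd \<and> crossed {e} (c, leaf_set l, leaf_set r))" if "nd \<in> set (postorder l)" for nd e
    using in_labels[OF that, of e] root[of e] disj by blast
  have 3: "\<not> (crossed {e} nd \<and> crossed {e} (c, leaf_set l, leaf_set r))" if "nd \<in> set (postorder r)" for nd e
    using in_labels[OF that, of e] root[of e] disj by blast
  show ?case using Node 1 2 3 by (simp only: postorder.simps sorted_wrt_append sorted_wrt1 list.set) (auto simp: ball_Un)
qed simp

context max_interval
begin

definition complete :: "node list \<Rightarrow> bool" where
  "complete ns \<longleftrightarrow> valid_nodes (wp_bot n) ns \<and> final (wp_bot n) ns = wp_top n i"

definition inner :: "node list \<Rightarrow> wpartition list" where
  "inner ns = butlast (tl (merge_chain (wp_bot n) ns))"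

lemma length_complete: "complete ns \<Longrightarrow> Suc (length ns) = n"
  using final_props(2)[OF bot_in, of ns] by (simp add: complete_def card_wp_bot card_wp_top)

lemma whole_inner:
  assumes "complete ns"
  shows "merge_chain (wp_bot n) ns = whole (inner ns)"
proof -
  have "ns \<noteq> []" using length_complete[OF assms] n by auto
  then obtain x xs where ns: "ns = x # xs" by (cases ns) auto
  then have "tl (merge_chain (wp_bot n) ns) \<noteq> []" by simp
  then have "tl (merge_chain (wp_bot n) ns) = inner ns @ [last (tl (merge_chain (wp_bot n) ns))]"
    unfolding inner_def by simp
  also have "last (tl (merge_chain (wp_bot n) ns)) = wp_top n i"
    using last_merge_chain[of "wp_bot n" ns] assms by (simp add: ns complete_def)
  finally show ?thesis by (simp add: ns)
qed

lemma inner_chain: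
  assumes "complete ns"
  shows "inner ns \<in> chains I lt (int n - 3)"
proof -
  note w = whole_inner[OF assms]
  have s: "set (whole (inner ns)) \<subseteq> P \<and> sorted_wrt lt (whole (inner ns))"
    using sorted_merge_chain[OF bot_in, of ns] assms unfolding w[symmetric] complete_def by blast
  have "length (whole (inner ns)) = n" using length_complete[OF assms] unfolding w[symmetric] by simp
  then show ?thesis using s unfolding chains_def open_interval_def by (auto simp: sorted_wrt_append)
qed

text \<open>Translates a condition on partitions into the condition on edges and nodes that
  triangularity is based on.\<close>

lemma run_iff_crossed:
  assumes "complete ns" "length es = length ns"
  shows "run es p (whole (inner ns)) \<longleftrightarrow> (\<forall>k < length ns. crossed {es ! p k} (ns ! k))"
proof -
  have "step (es ! p k) (merge_chain (wp_bot n) ns ! k) (merge_chain (wp_bot n) ns ! Suc k) \<longleftrightarrow> crossed {es ! p k} (ns ! k)"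
    if k: "k < length ns" for k
  proof -
    let ?\<alpha> = "final (wp_bot n) (take k ns)"
    have "valid_nodes (wp_bot n) (take k ns @ ns ! k # drop (Suc k) ns)"
      using assms(1) k by (simp add: complete_def id_take_nth_drop[symmetric])
    then have v: "valid_nodes (wp_bot n) (take k ns)" and m: "mergeable (ns ! k) ?\<alpha>" by (simp_all add: valid_nodes_append)
    have "merge_chain (wp_bot n) ns ! Suc k = apply_node (ns ! k) ?\<alpha>"
      using k by (simp add: nth_merge_chain take_Suc_conv_app_nth)
    moreover have "merge_chain (wp_bot n) ns ! k = ?\<alpha>" using k by (simp add: nth_merge_chain)
    moreover have "step (es ! p k) ?\<alpha> (apply_node (ns ! k) ?\<alpha>) \<longleftrightarrow> crossed {es ! p k} (ns ! k)"
      using crossed_nodeE[OF final_props(1)[OF bot_in v] m, of "es ! p k"] step_if_crossed[OF m, of "es ! p k"] by (rule iffI)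
    ultimately show ?thesis by (simp only:)
  qed
  then show ?thesis unfolding run_def whole_inner[OF assms(1), symmetric] assms(2) by blast
qed

lemma crossed_if_chain_weight_nonzero:
  assumes "complete ns" "length es = length ns" "chain_weight es (whole (inner ns)) \<noteq> (0 :: 'k::comm_ring_1)" "nd \<in> set ns"
  shows "crossed (set es) nd"
proof -
  have "\<exists>p. p permutes {..<length es} \<and> run es p (whole (inner ns))"
  proof (rule ccontr)
    assume "\<not> ?thesis"
    then have "chain_weight es (whole (inner ns)) = (0 :: 'k)" unfolding chain_weight_def by (intro sum.neutral) auto
    with assms(3) show False by simp
  qed
  then obtain p where p: "p permutes {..<length es}" "run es p (whole (inner ns))" by blast
  obtain k where k: "k < length ns" "nd = ns ! k" using assms(4) by (metis in_set_conv_nth)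
  have "p k < length es" using permutes_in_image[OF p(1), of k] k(1) assms(2) by simp
  then have "es ! p k \<in> set es" by (rule nth_mem)
  moreover have "crossed {es ! p k} nd" using p(2) k unfolding run_iff_crossed[OF assms(1,2)] by blast
  ultimately show ?thesis using crossed_Collect by blast
qed

lemma complete_postorder:
  assumes "T \<in> bicolored_trees n i"
  shows "complete (postorder T)"
proof -
  have T: "distinct (leaf_labels T)" "leaf_set T = {1..n}" "red_count T = i"
    using assms by (auto simp: bicolored_trees_def)
  have fb: "fst ` wp_bot n = (\<lambda>a. {a}) ` {1..n}" unfolding wp_bot_def by force
  have v: "valid_nodes (wp_bot n) (postorder T)" and f: "fst ` final (wp_bot n) (postorder T) = {{1..n}}"
    using postorder_valid[OF bot_in T(1)] T(2) by (simp_all add: fb)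
  have "card (final (wp_bot n) (postorder T)) = 1"
    using final_props(2)[OF bot_in v] length_postorder[of T] distinct_card[OF T(1)] T(2) by (simp add: card_wp_bot)
  then obtain p where p: "final (wp_bot n) (postorder T) = {p}" by (auto simp: card_1_singleton_iff)
  have "fst p = {1..n}" using f p by simp
  \<comment> \<open>All weights start at 0 and grow by 1 at each red node.\<close>
  moreover have "snd p = i"
    using total_weight_final[OF bot_in v] unfolding sum_color_weight_postorder p
    by (auto simp: total_weight_def T(3) wp_bot_def)
  ultimately show ?thesis using v p by (simp add: complete_def wp_top_def prod_eq_iff)
qed

text \<open>The k-th edge crosses the k-th node and no other, so the identity is the only order of
  contraction that produces this chain.\<close>

lemma chain_weight_own_edges:
  assumes T: "T \<in> bicolored_trees n i"
  shows "chain_weight (tree_edges T) (whole (inner (postorder T))) = (1 :: 'k::comm_ring_1)"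
proof -
  let ?es = "tree_edges T" and ?ns = "postorder T"
  have d: "distinct (leaf_labels T)" using T by (simp add: bicolored_trees_def)
  have len: "length ?es = length ?ns" by (rule list_all2_lengthD[OF tree_edges_cross])
  have own: "crossed {?es ! k} (?ns ! k)" if "k < length ?ns" for k
    using tree_edges_cross[of T] that len by (simp add: list_all2_conv_all_nth)
  have uniq: "k = l" if "k < length ?ns" "l < length ?ns" "crossed {e} (?ns ! k)" "crossed {e} (?ns ! l)" for k l e
    using that sorted_wrt_nth_less[OF postorder_crossed_unique[OF d]] by (metis linorder_neqE_nat)
  have "run ?es p (whole (inner ?ns)) \<longleftrightarrow> p = id" if p: "p permutes {..<length ?es}" for p
  proof
    assume r: "run ?es p (whole (inner ?ns))"
    show "p = id"
    proof
      fix k show "p k = id k"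
      proof (cases "k < length ?ns")
        case True
        then have "p k < length ?ns" using permutes_in_image[OF p, of k] len by simp
        then show ?thesis
          using uniq[OF _ True own, of "p k"] r run_iff_crossed[OF complete_postorder[OF T] len] True by auto
      next
        case False
        then show ?thesis using permutes_not_in[OF p, of k] len by simp
      qed
    qed
  next
    assume "p = id"
    then show "run ?es p (whole (inner ?ns))"
      using run_iff_crossed[OF complete_postorder[OF T] len] own by simp
  qed
  then have "chain_weight ?es (whole (inner ?ns)) = (\<Sum>p | p permutes {..<length ?es}. if p = id then of_int (sign p) else (0 :: 'k))"
    unfolding chain_weight_def by (intro sum.cong) auto
  also have "\<dots> = 1" using finite_permutations[of "{..<length ?es}"] by (simp add: permutes_id)
  finally show ?thesis .
qed

end

section \<open>Relations between maximal chains\<close>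

lemma blocks_in_Union:
  assumes a: "\<alpha> \<in> weighted_partitions n" and "F \<subseteq> \<alpha>"
  shows "blocks_in \<alpha> (\<Union> (fst ` F)) = F"
proof (intro equalityI subsetI)
  fix p assume "p \<in> blocks_in \<alpha> (\<Union> (fst ` F))"
  then have p: "p \<in> \<alpha>" "fst p \<subseteq> \<Union> (fst ` F)" by simp_all
  obtain x where x: "x \<in> fst p" using weighted_partitionsD(2)[OF a p(1)] by blast
  then obtain q where q: "q \<in> F" "x \<in> fst q" using p(2) by blast
  have "p = q" by (rule weighted_partitionsD(5)[OF a p(1) _ x q(2)]) (use q(1) assms(2) in blast)
  with q(1) show "p \<in> F" by simp
next
  fix p assume "p \<in> F"
  then show "p \<in> blocks_in \<alpha> (\<Union> (fst ` F))" using assms(2) by auto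
qed

lemma color_weight_cases:
  assumes "u \<le> 1" obtains c where "u = color_weight c"
proof (cases "u = 0")
  case True then show ?thesis using that[of Blue] by simp
next
  case False then show ?thesis using that[of Red] assms by simp
qed

text \<open>A filler of a gap of two ranks is a merge inside one block \<open>q\<close> of
  \<open>y\<close>. The inequalities say that the weight still missing lies between 0 and the number
  of blocks then left in \<open>q\<close> minus 1. For two blocks in \<open>q\<close> this
  determines the color; for three it leaves 0 or 1 for the second merge.\<close>

lemma filler:
  assumes x: "x \<in> weighted_partitions n" and z: "z \<in> weighted_partitions n" and y: "y \<in> weighted_partitions n"
    and less: "wp_less n x z" "wp_less n z y" and card: "card x = card y + 2"
  obtains c S s T t q where "z = apply_node (c, S, T) x" "(S, s) \<in> x" "(T, t) \<in> x" "S \<noteq> T"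
    "q \<in> y" "S \<union> T \<subseteq> fst q" "block_sum x (fst q) + color_weight c \<le> snd q"
    "snd q + 1 < block_sum x (fst q) + color_weight c + card (blocks_in x (fst q))"
proof -
  have "card x = Suc (card z)"
    using card_less_if_wp_less[OF x z less(1)] card_less_if_wp_less[OF z y less(2)] card by simp
  from cover_is_merge[OF x z less(1) this] obtain S s T t u
    where 1: "(S, s) \<in> x" "(T, t) \<in> x" "S \<noteq> T" "u \<le> 1" "z = merge u S T x" by metis
  obtain c where c: "u = color_weight c" using color_weight_cases[OF 1(4)] by metis
  note m = merge_eq[OF x 1(1,2), of u, folded 1(5)]
  let ?b = "(S \<union> T, s + t + u)"
  have b: "?b \<in> z" unfolding m by simp
  have le: "wp_le n z y" using less(2) by (simp add: wp_less_def)
  obtain q where q: "q \<in> y" "S \<union> T \<subseteq> fst q"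
    using le b unfolding wp_le_iff[OF z y] by (metis fst_conv)
  let ?B = "blocks_in x (fst q)"
  have fin: "finite ?B" using weighted_partitionsD(1)[OF x] by (rule rev_finite_subset) (auto simp: blocks_in_def)
  have new: "?b \<notin> x" using union_not_block[OF x 1(1,2)] 1(3) by simp
  have B: "blocks_in z (fst q) = insert ?b (?B - {(S, s), (T, t)})"
  proof (rule Set.set_eqI)
    fix p show "p \<in> blocks_in z (fst q) \<longleftrightarrow> p \<in> insert ?b (?B - {(S, s), (T, t)})"
      unfolding in_blocks_in m insert_iff Diff_iff empty_iff using q(2) by (cases "p = ?b") (simp_all add: conj_ac)
  qed
  have mem: "(S, s) \<in> ?B" "(T, t) \<in> ?B" using 1 q(2) by simp_all
  have nb: "?b \<notin> ?B - {(S, s), (T, t)}" using new by simp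
  have ST: "(S, s) \<noteq> (T, t)" using 1(3) by simp
  have "block_sum x (fst q) = (\<Sum>p\<in>?B - {(S, s), (T, t)}. snd p) + (\<Sum>p\<in>{(S, s), (T, t)}. snd p)"
    unfolding block_sum_def using mem fin by (intro sum.subset_diff) auto
  moreover have "block_sum z (fst q) = s + t + u + (\<Sum>p\<in>?B - {(S, s), (T, t)}. snd p)"
    unfolding block_sum_def B using fin nb by (subst sum.insert) auto
  ultimately have sum: "block_sum z (fst q) = block_sum x (fst q) + u" using ST by simp
  have "card (?B - {(S, s), (T, t)}) = card ?B - 2" using mem ST fin by (subst card_Diff_subset) auto
  moreover have "2 \<le> card ?B" using card_mono[OF fin, of "{(S, s), (T, t)}"] mem ST by simp
  ultimately have "card (blocks_in z (fst q)) + 1 = card ?B" unfolding B using fin nb by simp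
  moreover have "block_sum z (fst q) \<le> snd q \<and> snd q < block_sum z (fst q) + card (blocks_in z (fst q))"
    using le q(1) unfolding wp_le_iff[OF z y] by blast
  ultimately have "block_sum x (fst q) + color_weight c \<le> snd q"
    "snd q + 1 < block_sum x (fst q) + color_weight c + card ?B" using sum c by simp_all
  moreover have "z = apply_node (c, S, T) x" using 1(5) c by simp
  ultimately show thesis using that 1(1-3) q by metis
qed

text \<open>\<open>C\<close> will be generated by the coboundaries and the Lyndon chains. Kept
  abstract, it allows relations to be used as implications between memberships, without tracking
  signs.\<close>

locale coboundary_submodule = max_interval n i for n i +
  fixes C :: "(wpartition list \<Rightarrow>\<^sub>0 'k::comm_ring_1) set"
  assumes C: "pm_submodule C"
    and coboundary_in: "ys \<in> chains I lt (int n - 4) \<Longrightarrow> coboundary_chain I lt ys \<in> C"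
begin

text \<open>The chain is zero modulo \<open>C\<close>. Node lists that are not complete satisfy this
  vacuously, so relations can be stated without hypotheses of validity.\<close>

definition vanishes :: "node list \<Rightarrow> bool" where
  "vanishes ns \<longleftrightarrow> (complete ns \<longrightarrow> Poly_Mapping.single (inner ns) 1 \<in> C)"

lemma completeD:
  assumes "complete (pre @ ns)"
  shows "valid_nodes (wp_bot n) pre" "valid_nodes (final (wp_bot n) pre) ns"
    "final (wp_bot n) pre \<in> P" "final (final (wp_bot n) pre) ns = wp_top n i"
  using assms final_props(1)[OF bot_in, of pre] by (auto simp: complete_def valid_nodes_append)

text \<open>The coboundary of the chain with the element between the merges \<open>s\<close> and \<open>t\<close> removed is, up to sign,
  the sum over all ways to fill this gap, since the other ranks are saturated.\<close>

lemma vanishes_pair: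
  assumes comp: "complete (pre @ s # t # post)"
    and others: "\<And>z. z \<in> P \<Longrightarrow> lt (final (wp_bot n) pre) z \<Longrightarrow> lt z (final (wp_bot n) (pre @ [s, t])) \<Longrightarrow>
      z \<noteq> apply_node s (final (wp_bot n) pre) \<Longrightarrow>
      \<exists>s' t'. mergeable s' (final (wp_bot n) pre) \<and> z = apply_node s' (final (wp_bot n) pre) \<and>
        mergeable t' z \<and> apply_node t' z = final (wp_bot n) (pre @ [s, t]) \<and> vanishes (pre @ s' # t' # post)"
  shows "Poly_Mapping.single (inner (pre @ s # t # post)) 1 \<in> C"
proof -
  let ?x = "final (wp_bot n) pre" and ?p = "length pre"
  let ?y = "apply_node t (apply_node s ?x)"
  let ?W = "merge_chain (wp_bot n) pre @ merge_chain ?y post"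
  note D = completeD[OF comp]
  note x = D(3)
  have s: "mergeable s ?x" and t: "mergeable t (apply_node s ?x)" and vy: "valid_nodes ?y post" using D(2) by auto
  note sx = apply_node_props[OF x s]
  note ty = apply_node_props[OF sx(1) t]
  have top: "final ?y post = wp_top n i" using D(4) by simp
  have N: "?p + length post + 3 = n" using length_complete[OF comp] by simp
  have mc: "merge_chain (wp_bot n) (pre @ s' # t' # post) = merge_chain (wp_bot n) pre @ apply_node s' ?x # merge_chain ?y post"
    if "apply_node t' (apply_node s' ?x) = ?y" for s' t'
  proof -
    have "butlast (merge_chain (wp_bot n) pre) @ [?x] = merge_chain (wp_bot n) pre"
      by (metis append_butlast_last_id last_merge_chain merge_chain_nonempty)
    then show ?thesis using that by (simp add: merge_chain_append)
  qed
  define ys where "ys = butlast (tl ?W)"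
  have W: "whole ys = ?W"
  proof -
    have "tl ?W = tl (merge_chain (wp_bot n) pre) @ merge_chain ?y post" by simp
    then have "ys @ [wp_top n i] = tl ?W"
      unfolding ys_def using last_merge_chain[of ?y post] top append_butlast_last_id[of "tl ?W"] by simp
    moreover have "wp_bot n # tl ?W = ?W" using hd_merge_chain[of "wp_bot n" pre]
      by (metis append_is_Nil_conv hd_append2 list.collapse merge_chain_nonempty)
    ultimately show ?thesis by simp
  qed
  have lys: "length ys + 3 = n"
  proof -
    have "length (whole ys) = length ?W" using W by simp
    then show ?thesis using N by simp
  qed
  have sorted: "set ?W \<subseteq> P \<and> sorted_wrt lt ?W"
    using sorted_merge_chain[OF bot_in, of "pre @ s # t # post"] comp mc[OF refl]
    unfolding complete_def by (auto simp: sorted_wrt_append)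
  have ysI: "ys \<in> chains I lt (int n - 4)"
  proof -
    have "set (whole ys) \<subseteq> P \<and> sorted_wrt lt (whole ys)" using sorted W by simp
    moreover have "int (length ys) = int n - 3" using lys by simp
    ultimately show ?thesis unfolding chains_def open_interval_def by (auto simp: sorted_wrt_append)
  qed
  then have ysI': "set ys \<subseteq> I" by (simp add: chains_def)
  have at: "whole ys ! ?p = ?x" "whole ys ! Suc ?p = ?y"
    unfolding W by (simp_all add: nth_append nth_merge_chain)
  \<comment> \<open>The number of blocks falls by one at each step and by two across the gap, so
    nothing fits in anywhere else.\<close>
  have card: "card (whole ys ! j) = (if j \<le> ?p then n - j else n - Suc j)" if j: "j < length (whole ys)" for j
  proof (cases "j \<le> ?p")
    case True
    have "valid_nodes (wp_bot n) (take j pre)"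
      using D(1) valid_nodes_append[of "wp_bot n" "take j pre" "drop j pre"] by simp
    from final_props(2)[OF bot_in this] have "card (final (wp_bot n) (take j pre)) + j = n"
      using True by (simp add: card_wp_bot)
    moreover have "whole ys ! j = final (wp_bot n) (take j pre)" unfolding W using True by (simp add: nth_append nth_merge_chain)
    ultimately show ?thesis using True by simp
  next
    case False
    let ?k = "j - Suc ?p"
    have k: "?k \<le> length post" using j lys N by simp
    have "valid_nodes ?y (take ?k post)"
      using vy valid_nodes_append[of ?y "take ?k post" "drop ?k post"] by simp
    from final_props(2)[OF ty(1) this] have "card (final ?y (take ?k post)) + ?k = card ?y"
      using k by simp
    moreover have "card ?y + ?p + 2 = n" using ty(3) sx(3) final_props(2)[OF bot_in D(1)] by (simp add: card_wp_bot)
    moreover have "whole ys ! j = final ?y (take ?k post)" unfolding W using False k by (simp add: nth_append nth_merge_chain)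
    ultimately show ?thesis using False by simp
  qed
  let ?J = "\<lambda>j. {z \<in> P. lt (whole ys ! j) z \<and> lt z (whole ys ! Suc j)}"
  let ?Z = "\<lambda>j z. take j ys @ z # drop j ys"
  have inP: "whole ys ! j \<in> P" if "j < length (whole ys)" for j
    using nth_mem[OF that] sorted W by auto
  have J: "?J j = {}" if j: "j \<le> length ys" "j \<noteq> ?p" for j
  proof (rule ccontr)
    assume "?J j \<noteq> {}"
    then obtain z where z: "z \<in> P" "lt (whole ys ! j) z" "lt z (whole ys ! Suc j)" by blast
    have jl: "j < length (whole ys)" "Suc j < length (whole ys)" using j by simp_all
    have "card z < card (whole ys ! j)" by (rule card_less_if_wp_less[OF inP[OF jl(1)] z(1,2)])
    moreover have "card (whole ys ! Suc j) < card z" by (rule card_less_if_wp_less[OF z(1) inP[OF jl(2)] z(3)])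
    ultimately show False unfolding card[OF jl(1)] card[OF jl(2)] using j(2) jl(2) lys by (simp split: if_splits)
  qed
  have p: "?p \<le> length ys" using lys N by simp
  let ?S = "\<Sum>z\<in>?J ?p. Poly_Mapping.single (?Z ?p z) (1 :: 'k)"
  have "coboundary_chain I lt ys = (\<Sum>j = 0..length ys. \<Sum>z\<in>?J j. Poly_Mapping.single (?Z j z) ((- 1 :: 'k) ^ j))"
    unfolding coboundary_chain_def by (intro sum.cong gap_set[OF ysI'] refl) simp
  also have "\<dots> = (\<Sum>j = 0..length ys. if j = ?p then \<Sum>z\<in>?J j. Poly_Mapping.single (?Z j z) ((- 1 :: 'k) ^ j) else 0)"
  proof (intro sum.cong refl)
    fix j assume j: "j \<in> {0..length ys}"
    show "(\<Sum>z\<in>?J j. Poly_Mapping.single (?Z j z) ((- 1 :: 'k) ^ j)) =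
        (if j = ?p then \<Sum>z\<in>?J j. Poly_Mapping.single (?Z j z) ((- 1 :: 'k) ^ j) else 0)"
    proof (cases "j = ?p")
      case False
      then have "?J j = {}" using j J[of j] by simp
      with False show ?thesis by (simp only: if_False sum.empty)
    next
      case True
      show ?thesis unfolding if_P[OF True] by (rule refl)
    qed
  qed
  also have "\<dots> = (\<Sum>z\<in>?J ?p. Poly_Mapping.single (?Z ?p z) ((- 1 :: 'k) ^ ?p))"
    using p by (subst sum.delta) auto
  finally have cob: "coboundary_chain I lt ys = (\<Sum>z\<in>?J ?p. Poly_Mapping.single (?Z ?p z) ((- 1 :: 'k) ^ ?p))" .
  \<comment> \<open>A single gap contributes, so all terms carry the same sign, which can be
    removed.\<close>
  have S: "?S \<in> C"
  proof (cases "even ?p")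
    case True
    then show ?thesis using coboundary_in[OF ysI] cob by simp
  next
    case False
    then have "coboundary_chain I lt ys = - ?S" using cob by (simp add: single_uminus sum_negf)
    then show ?thesis using pm_submoduleD(4)[OF C coboundary_in[OF ysI]] by simp
  qed
  have Z: "inner (pre @ s' # t' # post) = ?Z ?p (apply_node s' ?x)"
    if c: "complete (pre @ s' # t' # post)" and "apply_node t' (apply_node s' ?x) = ?y" for s' t'
  proof -
    have "whole (inner (pre @ s' # t' # post)) = merge_chain (wp_bot n) pre @ apply_node s' ?x # merge_chain ?y post"
      using whole_inner[OF c] mc[OF that(2)] by simp
    also have "\<dots> = take (Suc ?p) (whole ys) @ apply_node s' ?x # drop (Suc ?p) (whole ys)" unfolding W by simp
    also have "\<dots> = whole (?Z ?p (apply_node s' ?x))" using p by simp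
    finally show ?thesis by simp
  qed
  have fin: "finite (?J ?p)" using finite_weighted_partitions by simp
  have y: "final (wp_bot n) (pre @ [s, t]) = ?y" by simp
  have mem: "apply_node s ?x \<in> ?J ?p" using sx(1,2) ty(2) at by (simp only: mem_Collect_eq)
  have rest: "Poly_Mapping.single (?Z ?p z) 1 \<in> C" if "z \<in> ?J ?p - {apply_node s ?x}" for z
  proof -
    have z: "z \<in> P" "lt ?x z" "lt z ?y" "z \<noteq> apply_node s ?x" using that unfolding at by simp_all
    from others[OF z(1,2) _ z(4)] z(3) obtain s' t' where st: "mergeable s' ?x" "z = apply_node s' ?x" "mergeable t' z"
      "apply_node t' z = ?y" "vanishes (pre @ s' # t' # post)" unfolding y by blast
    have c: "complete (pre @ s' # t' # post)"
      using st(1-4) D(1) vy top by (simp add: complete_def valid_nodes_append)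
    show ?thesis using st(5) c Z[OF c] st(2,4) unfolding vanishes_def by simp
  qed
  have "?S - (\<Sum>z\<in>?J ?p - {apply_node s ?x}. Poly_Mapping.single (?Z ?p z) 1) \<in> C"
    by (rule pm_submoduleD(5)[OF C S pm_submodule_sum[OF C rest]])
  moreover have "?S = Poly_Mapping.single (?Z ?p (apply_node s ?x)) 1 + (\<Sum>z\<in>?J ?p - {apply_node s ?x}. Poly_Mapping.single (?Z ?p z) 1)"
    by (rule sum.remove[OF fin mem])
  ultimately show ?thesis using Z[OF comp refl] by simp
qed

end

section \<open>From relations in a gap to all maximal chains\<close>

lemma mergeable_blocks:
  assumes "mergeable (c, A, B) \<alpha>"
  obtains v w where "(A, v) \<in> \<alpha>" "(B, w) \<in> \<alpha>" "A \<noteq> B"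
  using mergeableE[OF assms] by (metis Pair_inject)

lemma mergeableI: "(A, v) \<in> \<alpha> \<Longrightarrow> (B, w) \<in> \<alpha> \<Longrightarrow> A \<noteq> B \<Longrightarrow> mergeable (c, A, B) \<alpha>"
  using imageI[of "(A, v)" \<alpha> fst] imageI[of "(B, w)" \<alpha> fst] by simp

definition support :: "node list \<Rightarrow> nat set" where
  "support ns = (\<Union>x\<in>set ns. fst (snd x) \<union> snd (snd x))"

lemma support_simps [simp]:
  "support [] = {}" "support ((c, A, B) # ns) = A \<union> B \<union> support ns" "support (ns @ ms) = support ns \<union> support ms"
  by (simp_all add: support_def Un_assoc)

lemma support_postorder: "support (postorder T) \<subseteq> leaf_set T"
  by (induction T) auto

lemma support_forest: "support (concat (map postorder F)) \<subseteq> set (concat (map leaf_labels F))"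
proof (induction F)
  case (Cons T F)
  then show ?case using support_postorder[of T] by auto
qed simp

lemma forest_valid:
  assumes "\<alpha> \<in> weighted_partitions n" "distinct (concat (map leaf_labels F))"
    "\<And>a. a \<in> set (concat (map leaf_labels F)) \<Longrightarrow> {a} \<in> fst ` \<alpha>"
  shows "valid_nodes \<alpha> (concat (map postorder F)) \<and> fst ` final \<alpha> (concat (map postorder F)) =
    leaf_set ` set F \<union> (fst ` \<alpha> - (\<lambda>a. {a}) ` set (concat (map leaf_labels F)))"
  using assms
proof (induction F arbitrary: \<alpha>)
  case (Cons T F)
  let ?s = "\<lambda>a :: nat. {a}" and ?M = "set (concat (map leaf_labels F))"
  have d: "distinct (leaf_labels T)" "distinct (concat (map leaf_labels F))" "leaf_set T \<inter> ?M = {}"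
    using Cons.prems(2) by auto
  have T: "valid_nodes \<alpha> (postorder T)" "fst ` final \<alpha> (postorder T) = insert (leaf_set T) (fst ` \<alpha> - ?s ` leaf_set T)"
    using postorder_valid[OF Cons.prems(1) d(1)] Cons.prems(3) by auto
  have "{a} \<in> fst ` final \<alpha> (postorder T)" if "a \<in> ?M" for a
    unfolding T(2) using Cons.prems(3)[of a] that d(3) by auto
  with Cons.IH[OF final_props(1)[OF Cons.prems(1) T(1)] d(2)]
  have F: "valid_nodes (final \<alpha> (postorder T)) (concat (map postorder F))"
    "fst ` final (final \<alpha> (postorder T)) (concat (map postorder F)) =
      leaf_set ` set F \<union> (insert (leaf_set T) (fst ` \<alpha> - ?s ` leaf_set T) - ?s ` ?M)"
    unfolding T(2) by blast+
  have "leaf_set T \<notin> ?s ` ?M" using d(3) by auto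
  then have "leaf_set ` set F \<union> (insert (leaf_set T) (fst ` \<alpha> - ?s ` leaf_set T) - ?s ` ?M) =
      leaf_set ` set (T # F) \<union> (fst ` \<alpha> - ?s ` set (concat (map leaf_labels (T # F))))"
    by auto
  then show ?case using T(1) F by (simp add: valid_nodes_append)
qed simp

lemma length_forest: "length (concat (map postorder F)) + length F = length (concat (map leaf_labels F))"
proof (induction F)
  case (Cons T F)
  then show ?case using length_postorder[of T] by simp
qed simp

lemma card_last_le:
  assumes "sorted_wrt (wp_less n) (\<gamma> # vs)" "set (\<gamma> # vs) \<subseteq> weighted_partitions n"
  shows "card (last (\<gamma> # vs)) + length vs \<le> card \<gamma>"
  using assms
proof (induction vs arbitrary: \<gamma>)
  case (Cons \<delta> vs)
  then have "card (last (\<delta> # vs)) + length vs \<le> card \<delta>" by (intro Cons.IH) simp_all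
  moreover have "card \<delta> < card \<gamma>" using Cons.prems by (intro card_less_if_wp_less[of \<gamma> n]) simp_all
  ultimately show ?case by simp
qed simp

lemma saturated_chain_is_merge_chain:
  assumes "sorted_wrt (wp_less n) (\<alpha> # ws)" "set (\<alpha> # ws) \<subseteq> weighted_partitions n"
    "card \<alpha> = card (last (\<alpha> # ws)) + length ws"
  shows "\<exists>ns. valid_nodes \<alpha> ns \<and> merge_chain \<alpha> ns = \<alpha> # ws"
  using assms
proof (induction ws arbitrary: \<alpha>)
  case Nil
  have "valid_nodes \<alpha> [] \<and> merge_chain \<alpha> [] = [\<alpha>]" by simp
  then show ?case by blast
next
  case (Cons \<beta> ws)
  have P: "\<alpha> \<in> weighted_partitions n" "\<beta> \<in> weighted_partitions n" and less: "wp_less n \<alpha> \<beta>" using Cons.prems by simp_all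
  have "card (last (\<beta> # ws)) + length ws \<le> card \<beta>" using Cons.prems by (intro card_last_le[where n = n]) simp_all
  moreover have "card \<beta> < card \<alpha>" by (rule card_less_if_wp_less[OF P less])
  ultimately have c: "card \<alpha> = Suc (card \<beta>)" "card \<beta> = card (last (\<beta> # ws)) + length ws" using Cons.prems(3) by simp_all
  from Cons.IH[OF _ _ c(2)] Cons.prems obtain ns where ns: "valid_nodes \<beta> ns" "merge_chain \<beta> ns = \<beta> # ws" by auto
  from cover_is_merge[OF P less c(1)] obtain A v B w u
    where m: "(A, v) \<in> \<alpha>" "(B, w) \<in> \<alpha>" "A \<noteq> B" "u \<le> 1" "\<beta> = merge u A B \<alpha>" by metis
  obtain d where "u = color_weight d" using color_weight_cases[OF m(4)] by metis
  then have "valid_nodes \<alpha> ((d, A, B) # ns) \<and> merge_chain \<alpha> ((d, A, B) # ns) = \<alpha> # \<beta> # ws"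
    using mergeableI[OF m(1-3), of d] ns m(5) by simp
  then show ?case by blast
qed

lemma apply_node_pair:
  assumes "p \<in> {a, b}" "q \<in> {a, b}" "fst p \<noteq> fst q"
  shows "apply_node (c, fst p, fst q) x = apply_node (c, fst a, fst b) x"
  using assms merge_commute[of "color_weight c" "fst b" "fst a"] by auto

lemma two_of_three:
  assumes "p \<in> {a, b, c}" "q \<in> {a, b, c}"
  obtains "p \<in> {a, b}" "q \<in> {a, b}" | "p \<in> {a, c}" "q \<in> {a, c}" | "p \<in> {b, c}" "q \<in> {b, c}"
  using assms by auto

context coboundary_submodule
begin

text \<open>Merges inside two different blocks of the upper element leave exactly two fillers, one
  for each order; modulo coboundaries the two chains are negatives of each other.\<close>

lemma vanishes_swap_nodes:
  assumes disj: "(A \<union> B) \<inter> (X \<union> Y) = {}" and van: "vanishes (pre @ (e, X, Y) # (c, A, B) # post)"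
  shows "vanishes (pre @ (c, A, B) # (e, X, Y) # post)"
  unfolding vanishes_def
proof
  assume comp: "complete (pre @ (c, A, B) # (e, X, Y) # post)"
  let ?x = "final (wp_bot n) pre" and ?c = "color_weight c" and ?e = "color_weight e"
  note D = completeD[OF comp]
  note x = D(3)
  have m1: "mergeable (c, A, B) ?x" and m2: "mergeable (e, X, Y) (apply_node (c, A, B) ?x)" using D(2) by simp_all
  obtain v w where 1: "(A, v) \<in> ?x" "(B, w) \<in> ?x" "A \<noteq> B" using m1 by (rule mergeable_blocks)
  note p1 = apply_node_props[OF x m1]
  note p2 = apply_node_props[OF p1(1) m2]
  let ?y = "apply_node (e, X, Y) (apply_node (c, A, B) ?x)"
  obtain p q where 2: "(X, p) \<in> apply_node (c, A, B) ?x" "(Y, q) \<in> apply_node (c, A, B) ?x" "X \<noteq> Y"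
    using m2 by (rule mergeable_blocks)
  have ne: "A \<noteq> {}" "B \<noteq> {}" "X \<noteq> {}" "Y \<noteq> {}"
    using weighted_partitionsD(2)[OF x 1(1)] weighted_partitionsD(2)[OF x 1(2)]
      weighted_partitionsD(2)[OF p1(1) 2(1)] weighted_partitionsD(2)[OF p1(1) 2(2)] by simp_all
  have sub: "U \<noteq> V" if "U \<noteq> {}" "U \<subseteq> X \<union> Y" "V \<subseteq> A \<union> B" for U V using disj that by blast
  have neq: "X \<noteq> A" "X \<noteq> B" "Y \<noteq> A" "Y \<noteq> B" "X \<noteq> A \<union> B" "Y \<noteq> A \<union> B"
    by (rule sub[OF ne(3) Un_upper1] sub[OF ne(4) Un_upper2] | simp)+
  have X: "(X, p) \<in> ?x" "(Y, q) \<in> ?x"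
    using 2(1,2) neq unfolding apply_node.simps merge_eq[OF x 1(1,2)] by simp_all
  let ?rest = "?x - {(A, v), (B, w), (X, p), (Y, q)}"
  have y: "?y = insert (X \<union> Y, p + q + ?e) (insert (A \<union> B, v + w + ?c) ?rest)"
    unfolding apply_node.simps
    by (rule merge_merge_disjoint[OF x 1(1,2) X 1(3) 2(3) neq(1-4) color_weight_le])
  have y': "apply_node (c, A, B) (apply_node (e, X, Y) ?x) = ?y"
  proof -
    have "{(X, p), (Y, q), (A, v), (B, w)} = {(A, v), (B, w), (X, p), (Y, q)}" by auto
    moreover have "apply_node (c, A, B) (apply_node (e, X, Y) ?x) =
        insert (A \<union> B, v + w + ?c) (insert (X \<union> Y, p + q + ?e) (?x - {(X, p), (Y, q), (A, v), (B, w)}))"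
      unfolding apply_node.simps
      by (rule merge_merge_disjoint[OF x X 1(1,2) 2(3) 1(3) neq(1)[symmetric] neq(3)[symmetric] neq(2)[symmetric] neq(4)[symmetric] color_weight_le])
    ultimately show ?thesis unfolding y using insert_commute by (simp only:)
  qed
  have card: "card ?x = card ?y + 2" using p1(3) p2(3) by simp
  have AB: "blocks_in ?x (A \<union> B) = {(A, v), (B, w)}" using blocks_in_Union[OF x, of "{(A, v), (B, w)}"] 1 by simp
  have XY: "blocks_in ?x (X \<union> Y) = {(X, p), (Y, q)}" using blocks_in_Union[OF x, of "{(X, p), (Y, q)}"] X by simp
  show "Poly_Mapping.single (inner (pre @ (c, A, B) # (e, X, Y) # post)) 1 \<in> C"
  proof (rule vanishes_pair[OF comp])
    fix z
    assume z: "z \<in> P" "lt ?x z" "lt z (final (wp_bot n) (pre @ [(c, A, B), (e, X, Y)]))" "z \<noteq> apply_node (c, A, B) ?x"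
    then have zy: "lt z ?y" by simp
    from filler[OF x z(1) p2(1) z(2) zy card] obtain d S s T t r where f:
      "z = apply_node (d, S, T) ?x" "(S, s) \<in> ?x" "(T, t) \<in> ?x" "S \<noteq> T" "r \<in> ?y" "S \<union> T \<subseteq> fst r"
      "block_sum ?x (fst r) + color_weight d \<le> snd r"
      "snd r + 1 < block_sum ?x (fst r) + color_weight d + card (blocks_in ?x (fst r))" by metis
    have b: "(S, s) \<in> blocks_in ?x (fst r)" "(T, t) \<in> blocks_in ?x (fst r)" using f by simp_all
    \<comment> \<open>The blocks \<open>S\<close> and \<open>T\<close> lie in one block of the upper
      element. A block taken over from below has a single part, so it is one of the two new blocks,
      whose parts and weight fix the merge including its color.\<close>
    consider "r = (X \<union> Y, p + q + ?e)" | "r = (A \<union> B, v + w + ?c)" | "r \<in> ?x" using f(5) unfolding y by blast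
    then have "z = apply_node (e, X, Y) ?x"
    proof cases
      case c1: 1
      have "z = apply_node (d, X, Y) ?x"
        using apply_node_pair[of "(S, s)" "(X, p)" "(Y, q)" "(T, t)" d ?x] b f(1,4) unfolding c1 fst_conv XY by simp
      moreover have "color_weight d = ?e" using f(7,8) 2(3) unfolding c1 fst_conv snd_conv block_sum_def XY by simp
      ultimately show ?thesis by simp
    next
      case c2: 2
      have "z = apply_node (d, A, B) ?x"
        using apply_node_pair[of "(S, s)" "(A, v)" "(B, w)" "(T, t)" d ?x] b f(1,4) unfolding c2 fst_conv AB by simp
      moreover have "color_weight d = ?c" using f(7,8) 1(3) unfolding c2 fst_conv snd_conv block_sum_def AB by simp
      ultimately show ?thesis using z(4) by simp
    next
      case 3
      then have "blocks_in ?x (fst r) = {r}" using blocks_in_Union[OF x, of "{r}"] by simp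
      then show ?thesis using b f(4) by auto
    qed
    moreover have "mergeable (e, X, Y) ?x" using X 2(3) by (rule mergeableI)
    moreover have "mergeable (c, A, B) (apply_node (e, X, Y) ?x)"
    proof -
      have "(A, v) \<in> apply_node (e, X, Y) ?x" "(B, w) \<in> apply_node (e, X, Y) ?x"
        unfolding apply_node.simps merge_eq[OF x X] using 1 neq by auto
      then show ?thesis using 1(3) by (rule mergeableI)
    qed
    ultimately show "\<exists>s' t'. mergeable s' ?x \<and> z = apply_node s' ?x \<and> mergeable t' z \<and>
        apply_node t' z = final (wp_bot n) (pre @ [(c, A, B), (e, X, Y)]) \<and> vanishes (pre @ s' # t' # post)"
      using van y' by (intro exI[of _ "(e, X, Y)"] exI[of _ "(c, A, B)"]) simp
  qed
qed

text \<open>Three blocks become one. A filler chooses a pair to be merged first and its color; the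
  total weight then forces the color of the second merge. Total increment 0 or 2 leaves three
  fillers, the terms of a Jacobi identity, and increment 1 leaves six, the terms of the mixed
  one.\<close>

lemma vanishes_triple:
  assumes 1: "\<And>c' e'. color_weight c' + color_weight e' = color_weight c + color_weight e \<Longrightarrow> (c', e') \<noteq> (c, e) \<Longrightarrow>
      vanishes (pre @ (c', A, B) # (e', A \<union> B, D) # post)"
    and 2: "\<And>c' e'. color_weight c' + color_weight e' = color_weight c + color_weight e \<Longrightarrow>
      vanishes (pre @ (c', A, D) # (e', A \<union> D, B) # post)"
    and 3: "\<And>c' e'. color_weight c' + color_weight e' = color_weight c + color_weight e \<Longrightarrow>
      vanishes (pre @ (c', B, D) # (e', B \<union> D, A) # post)"
  shows "vanishes (pre @ (c, A, B) # (e, A \<union> B, D) # post)"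
  unfolding vanishes_def
proof
  assume comp: "complete (pre @ (c, A, B) # (e, A \<union> B, D) # post)"
  let ?x = "final (wp_bot n) pre" and ?c = "color_weight c" and ?e = "color_weight e"
  note D = completeD[OF comp]
  note x = D(3)
  have m1: "mergeable (c, A, B) ?x" and m2: "mergeable (e, A \<union> B, D) (apply_node (c, A, B) ?x)" using D(2) by simp_all
  obtain v w where A: "(A, v) \<in> ?x" and B: "(B, w) \<in> ?x" and AB: "A \<noteq> B" using m1 by (rule mergeable_blocks)
  note p1 = apply_node_props[OF x m1]
  note p2 = apply_node_props[OF p1(1) m2]
  let ?y = "apply_node (e, A \<union> B, D) (apply_node (c, A, B) ?x)"
  obtain q where q: "(D, q) \<in> apply_node (c, A, B) ?x" "D \<noteq> A \<union> B"
    using m2 by (metis mergeable_blocks)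
  then have Dq: "(D, q) \<in> ?x" "(D, q) \<noteq> (A, v)" "(D, q) \<noteq> (B, w)"
    unfolding apply_node.simps merge_eq[OF x A B] by simp_all
  have AD: "A \<noteq> D" and BD: "B \<noteq> D"
    using same_block[OF x Dq(1) A] same_block[OF x Dq(1) B] Dq(2,3) by auto
  let ?rest = "?x - {(A, v), (B, w), (D, q)}"
  have y: "?y = insert (A \<union> B \<union> D, v + w + q + ?c + ?e) ?rest"
    unfolding apply_node.simps by (rule merge_merge_joined[OF x A B Dq(1) AB AD BD color_weight_le])
  have card: "card ?x = card ?y + 2" using p1(3) p2(3) by simp
  have ABD: "blocks_in ?x (A \<union> B \<union> D) = {(A, v), (B, w), (D, q)}"
    using blocks_in_Union[OF x, of "{(A, v), (B, w), (D, q)}"] A B Dq(1) by (simp add: Un_assoc)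
  show "Poly_Mapping.single (inner (pre @ (c, A, B) # (e, A \<union> B, D) # post)) 1 \<in> C"
  proof (rule vanishes_pair[OF comp])
    fix z
    assume z: "z \<in> P" "lt ?x z" "lt z (final (wp_bot n) (pre @ [(c, A, B), (e, A \<union> B, D)]))" "z \<noteq> apply_node (c, A, B) ?x"
    then have zy: "lt z ?y" by simp
    from filler[OF x z(1) p2(1) z(2) zy card] obtain d S s T t r where f:
      "z = apply_node (d, S, T) ?x" "(S, s) \<in> ?x" "(T, t) \<in> ?x" "S \<noteq> T" "r \<in> ?y" "S \<union> T \<subseteq> fst r"
      "block_sum ?x (fst r) + color_weight d \<le> snd r"
      "snd r + 1 < block_sum ?x (fst r) + color_weight d + card (blocks_in ?x (fst r))" by metis
    have b: "(S, s) \<in> blocks_in ?x (fst r)" "(T, t) \<in> blocks_in ?x (fst r)" using f by simp_all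
    have r: "r = (A \<union> B \<union> D, v + w + q + ?c + ?e)"
    proof (rule ccontr)
      assume "\<not> ?thesis"
      then have "r \<in> ?x" using f(5) unfolding y by blast
      then have "blocks_in ?x (fst r) = {r}" using blocks_in_Union[OF x, of "{r}"] by simp
      then show False using b f(4) by auto
    qed
    have "color_weight d \<le> ?c + ?e \<and> ?c + ?e \<le> color_weight d + 1"
      using f(7,8) AB AD BD unfolding r fst_conv snd_conv block_sum_def ABD by simp
    then have d: "?c + ?e - color_weight d \<le> 1" "color_weight d \<le> ?c + ?e" by arith+
    \<comment> \<open>The second merge supplies the missing weight, which is 0 or 1 and thus a
      color.\<close>
    obtain e' where "?c + ?e - color_weight d = color_weight e'" using color_weight_cases[OF d(1)] by metis
    then have e': "color_weight d + color_weight e' = ?c + ?e" using d(2) by simp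
    have main: "\<exists>s' t'. mergeable s' ?x \<and> z = apply_node s' ?x \<and> mergeable t' z \<and>
        apply_node t' z = final (wp_bot n) (pre @ [(c, A, B), (e, A \<union> B, D)]) \<and> vanishes (pre @ s' # t' # post)"
      if m: "(A1, v1) \<in> ?x" "(B1, w1) \<in> ?x" "(D1, q1) \<in> ?x" and ne: "A1 \<noteq> B1" "A1 \<noteq> D1" "B1 \<noteq> D1"
        and eq: "A1 \<union> B1 \<union> D1 = A \<union> B \<union> D" "v1 + w1 + q1 = v + w + q"
          "{(A1, v1), (B1, w1), (D1, q1)} = {(A, v), (B, w), (D, q)}"
        and z1: "z = apply_node (d, A1, B1) ?x" and van: "vanishes (pre @ (d, A1, B1) # (e', A1 \<union> B1, D1) # post)"
      for A1 v1 B1 w1 D1 q1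
    proof -
      have "apply_node (e', A1 \<union> B1, D1) z = insert (A1 \<union> B1 \<union> D1, v1 + w1 + q1 + color_weight d + color_weight e') (?x - {(A1, v1), (B1, w1), (D1, q1)})"
        unfolding z1 apply_node.simps by (rule merge_merge_joined[OF x m ne color_weight_le])
      also have "\<dots> = ?y" unfolding y eq using e' by (simp add: add.assoc)
      finally have 4: "apply_node (e', A1 \<union> B1, D1) z = ?y" .
      have "(D1, q1) \<noteq> (A1, v1)" "(D1, q1) \<noteq> (B1, w1)" using ne by auto
      then have "(A1 \<union> B1, v1 + w1 + color_weight d) \<in> z" "(D1, q1) \<in> z"
        unfolding z1 apply_node.simps merge_eq[OF x m(1,2)] using m(3) by simp_all
      moreover have "A1 \<union> B1 \<noteq> D1" using union_not_block[OF x m(1,2), of q1] ne(1) m(3) by auto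
      ultimately have 5: "mergeable (e', A1 \<union> B1, D1) z" by (rule mergeableI)
      have 6: "mergeable (d, A1, B1) ?x" using m(1,2) ne(1) by (rule mergeableI)
      show ?thesis using 4 5 6 z1 van by (intro exI[of _ "(d, A1, B1)"] exI[of _ "(e', A1 \<union> B1, D1)"]) simp
    qed
    have mem: "(S, s) \<in> {(A, v), (B, w), (D, q)}" "(T, t) \<in> {(A, v), (B, w), (D, q)}" using b unfolding r fst_conv ABD .
    have pair: "z = apply_node (d, fst a, fst b) ?x" if "(S, s) \<in> {a, b}" "(T, t) \<in> {a, b}" for a b
      using apply_node_pair[OF that, of d ?x] f(1,4) by simp
    from mem show "\<exists>s' t'. mergeable s' ?x \<and> z = apply_node s' ?x \<and> mergeable t' z \<and>
        apply_node t' z = final (wp_bot n) (pre @ [(c, A, B), (e, A \<union> B, D)]) \<and> vanishes (pre @ s' # t' # post)"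
    proof (cases rule: two_of_three)
      case c1: 1
      note z1 = pair[OF c1, unfolded fst_conv]
      have "(d, e') \<noteq> (c, e)"
      proof
        assume "(d, e') = (c, e)"
        then have "d = c" by simp
        with z1 z(4) show False by metis
      qed
      then show ?thesis by (rule main[OF A B Dq(1) AB AD BD refl refl refl z1 1[OF e']])
    next
      case c2: 2
      note z2 = pair[OF c2, unfolded fst_conv]
      have "A \<union> D \<union> B = A \<union> B \<union> D" "v + q + w = v + w + q" "{(A, v), (D, q), (B, w)} = {(A, v), (B, w), (D, q)}" by auto
      then show ?thesis by (rule main[OF A Dq(1) B AD AB BD[symmetric] _ _ _ z2 2[OF e']])
    next
      case c3: 3
      note z3 = pair[OF c3, unfolded fst_conv]
      have "B \<union> D \<union> A = A \<union> B \<union> D" "w + q + v = v + w + q" "{(B, w), (D, q), (A, v)} = {(A, v), (B, w), (D, q)}" by auto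
      then show ?thesis by (rule main[OF B Dq(1) A BD AB[symmetric] AD[symmetric] _ _ _ z3 3[OF e']])
    qed
  qed
qed

lemma vanishes_move:
  assumes "(A \<union> B) \<inter> support vs = {}" "vanishes (pre @ vs @ (c, A, B) # post)"
  shows "vanishes (pre @ (c, A, B) # vs @ post)"
  using assms
proof (induction vs arbitrary: pre)
  case (Cons x vs)
  obtain e X Y where x: "x = (e, X, Y)" by (cases x)
  have dj: "(A \<union> B) \<inter> (X \<union> Y) = {}" "(A \<union> B) \<inter> support vs = {}"
    using Cons.prems(1) unfolding x support_simps by blast+
  have "vanishes ((pre @ [x]) @ (c, A, B) # vs @ post)"
    by (rule Cons.IH[OF dj(2)]) (use Cons.prems(2) in simp)
  then have "vanishes (pre @ (e, X, Y) # (c, A, B) # vs @ post)" by (simp add: x)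
  from vanishes_swap_nodes[OF dj(1) this] show ?case by (simp add: x)
qed simp

text \<open>Merge sequences on disjoint sets of labels are exchanged by successive exchanges of
  adjacent merges.\<close>

lemma vanishes_swap:
  assumes "support us \<inter> support vs = {}" "vanishes (pre @ vs @ us @ post)"
  shows "vanishes (pre @ us @ vs @ post)"
  using assms
proof (induction us arbitrary: pre)
  case (Cons x us)
  obtain c A B where x: "x = (c, A, B)" by (cases x)
  have dj: "(A \<union> B) \<inter> support vs = {}" "support us \<inter> support vs = {}"
    using Cons.prems(1) unfolding x support_simps by blast+
  have "vanishes (pre @ vs @ (c, A, B) # us @ post)" using Cons.prems(2) by (simp add: x)
  from vanishes_move[OF dj(1) this] have "vanishes ((pre @ [x]) @ vs @ us @ post)" by (simp add: x)
  from Cons.IH[OF dj(2) this] show ?case by simp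
qed simp

lemma vanishes_flip: "vanishes (pre @ (c, B, A) # post) \<Longrightarrow> vanishes (pre @ (c, A, B) # post)"
proof -
  have f: "apply_node (c, B, A) x = apply_node (c, A, B) x" for x using merge_commute by simp
  have m: "mergeable (c, B, A) x \<longleftrightarrow> mergeable (c, A, B) x" for x by auto
  have "merge_chain (wp_bot n) (pre @ (c, B, A) # post) = merge_chain (wp_bot n) (pre @ (c, A, B) # post)"
    by (simp only: merge_chain_append merge_chain_Cons f)
  moreover have "complete (pre @ (c, B, A) # post) \<longleftrightarrow> complete (pre @ (c, A, B) # post)"
    unfolding complete_def by (simp only: valid_nodes_append valid_nodes.simps f m fold_append fold_simps o_apply)
  ultimately show "vanishes (pre @ (c, B, A) # post) \<Longrightarrow> vanishes (pre @ (c, A, B) # post)"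
    by (simp only: vanishes_def inner_def)
qed

text \<open>The merges of the three subtrees act on disjoint sets and can be carried out first. The
  two remaining merges are then adjacent and form the gap of \<open>vanishes_triple\<close>.\<close>

lemma vanishes_node:
  assumes d: "distinct (leaf_labels (Node e (Node c a b) d))"
    and 1: "\<And>c' e'. color_weight c' + color_weight e' = color_weight c + color_weight e \<Longrightarrow> (c', e') \<noteq> (c, e) \<Longrightarrow>
      vanishes (pre @ postorder (Node e' (Node c' a b) d) @ post)"
    and 2: "\<And>c' e'. color_weight c' + color_weight e' = color_weight c + color_weight e \<Longrightarrow>
      vanishes (pre @ postorder (Node e' (Node c' a d) b) @ post)"
    and 3: "\<And>c' e'. color_weight c' + color_weight e' = color_weight c + color_weight e \<Longrightarrow>
      vanishes (pre @ postorder (Node e' a (Node c' b d)) @ post)"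
  shows "vanishes (pre @ postorder (Node e (Node c a b) d) @ post)"
proof -
  let ?a = "leaf_set a" and ?b = "leaf_set b" and ?d = "leaf_set d"
  let ?pre = "pre @ postorder a @ postorder b @ postorder d"
  have disj: "?a \<inter> ?b = {}" "?a \<inter> ?d = {}" "?b \<inter> ?d = {}" using d by auto
  note s = support_postorder[of a] support_postorder[of b] support_postorder[of d]
  have d_ab: "support (postorder d) \<inter> support [(c', ?a, ?b)] = {}" for c'
    using disj s unfolding support_simps by blast
  have b_da: "support (postorder b) \<inter> support (postorder d @ [(c', ?a, ?d)]) = {}" for c'
    using disj s unfolding support_simps by blast
  have "vanishes (?pre @ (c, ?a, ?b) # (e, ?a \<union> ?b, ?d) # post)"
  proof (rule vanishes_triple)
    fix c' e' assume e: "color_weight c' + color_weight e' = color_weight c + color_weight e"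
    show "vanishes (?pre @ (c', ?a, ?b) # (e', ?a \<union> ?b, ?d) # post)" if "(c', e') \<noteq> (c, e)"
      using vanishes_swap[OF d_ab, of "pre @ postorder a @ postorder b" c' "(e', ?a \<union> ?b, ?d) # post"] 1[OF e that] by simp
    show "vanishes (?pre @ (c', ?a, ?d) # (e', ?a \<union> ?d, ?b) # post)"
      using vanishes_swap[OF b_da, of "pre @ postorder a" c' "(e', ?a \<union> ?d, ?b) # post"] 2[OF e] by simp
    show "vanishes (?pre @ (c', ?b, ?d) # (e', ?b \<union> ?d, ?a) # post)"
      using vanishes_flip[of "?pre @ [(c', ?b, ?d)]" e' ?a "?b \<union> ?d" post] 3[OF e] by simp
  qed
  moreover have "support [(c, ?a, ?b)] \<inter> support (postorder d) = {}" using d_ab[of c] by blast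
  ultimately show ?thesis
    using vanishes_swap[of "[(c, ?a, ?b)]" "postorder d" "pre @ postorder a @ postorder b" "(e, ?a \<union> ?b, ?d) # post"] by simp
qed

lemma color_weight_add_self: "color_weight c' + color_weight e' = color_weight c + color_weight c \<Longrightarrow> c' = c \<and> e' = c"
  by (cases c; cases c'; cases e') simp_all

lemma color_weight_add_mixed:
  "color_weight c' + color_weight e' = color_weight Blue + color_weight Red \<Longrightarrow> c' = Blue \<and> e' = Red \<or> c' = Red \<and> e' = Blue"
  by (cases c'; cases e') simp_all

lemma vanishes_rewrite:
  assumes "rewrites_to x ys" "distinct (leaf_labels x)" "\<And>y. y \<in> set ys \<Longrightarrow> vanishes (pre @ postorder y @ post)"
  shows "vanishes (pre @ postorder x @ post)"
  using assms
\<comment> \<open>The postorder of a subtree is a segment of that of the tree, so the surroundings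
  change along the induction.\<close>
proof (induction arbitrary: pre post rule: rewrites_to.induct)
  case (antisym c l r)
  have "leaf_set l \<inter> leaf_set r = {}" using antisym(1) by simp
  then have "support (postorder l) \<inter> support (postorder r) = {}"
    using support_postorder[of l] support_postorder[of r] by blast
  moreover have "vanishes (pre @ postorder r @ postorder l @ (c, leaf_set r, leaf_set l) # post)" using antisym(2) by simp
  ultimately have "vanishes (pre @ postorder l @ postorder r @ (c, leaf_set r, leaf_set l) # post)" by (rule vanishes_swap)
  then show ?case using vanishes_flip[of "pre @ postorder l @ postorder r" c "leaf_set r" "leaf_set l" post] by simp
next
  case (jacobi c a b d)
  show ?case by (rule vanishes_node[OF jacobi(1)]) (auto dest!: color_weight_add_self intro!: jacobi(2) simp del: postorder.simps)
next
  case (mixed_jacobi a b d)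
  show ?case
  proof (rule vanishes_node[OF mixed_jacobi(1)])
    fix c' e' assume "color_weight c' + color_weight e' = color_weight Blue + color_weight Red"
    note ce = color_weight_add_mixed[OF this]
    show "vanishes (pre @ postorder (Node e' (Node c' a b) d) @ post)" if "(c', e') \<noteq> (Blue, Red)"
      by (rule mixed_jacobi(2)) (use ce that in auto)
    show "vanishes (pre @ postorder (Node e' (Node c' a d) b) @ post)"
      by (rule mixed_jacobi(2)) (use ce in auto)
    show "vanishes (pre @ postorder (Node e' a (Node c' b d)) @ post)"
      by (rule mixed_jacobi(2)) (use ce in auto)
  qed
next
  case (left x ys c r)
  have "vanishes (pre @ postorder x @ postorder r @ (c, leaf_set x, leaf_set r) # post)"
  proof (rule left.IH)
    show "distinct (leaf_labels x)" using left.prems(1) by simp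
    fix y assume y: "y \<in> set ys"
    have "leaf_set y = leaf_set x" using rewrites_to_labels[OF left.hyps y] by (metis set_mset_mset)
    then show "vanishes (pre @ postorder y @ postorder r @ (c, leaf_set x, leaf_set r) # post)"
      using left.prems(2)[of "Node c y r"] y by simp
  qed
  then show ?case by simp
next
  case (right x ys c l)
  have "vanishes ((pre @ postorder l) @ postorder x @ (c, leaf_set l, leaf_set x) # post)"
  proof (rule right.IH)
    show "distinct (leaf_labels x)" using right.prems(1) by simp
    fix y assume y: "y \<in> set ys"
    have "leaf_set y = leaf_set x" using rewrites_to_labels[OF right.hyps y] by (metis set_mset_mset)
    then show "vanishes ((pre @ postorder l) @ postorder y @ (c, leaf_set l, leaf_set x) # post)"
      using right.prems(2)[of "Node c l y"] y by simp
  qed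
  then show ?case by simp
qed

lemma vanishes_tree_last:
  assumes "distinct (concat (map leaf_labels (F @ T # G)))"
    and "vanishes (concat (map postorder (F @ G)) @ postorder T @ ns)"
  shows "vanishes (concat (map postorder (F @ T # G)) @ ns)"
proof -
  have "leaf_set T \<inter> set (concat (map leaf_labels G)) = {}" using assms(1) by auto
  then have "support (postorder T) \<inter> support (concat (map postorder G)) = {}"
    using support_postorder[of T] support_forest[of G] by blast
  from vanishes_swap[OF this, of "concat (map postorder F)" ns] assms(2) show ?thesis by simp
qed

text \<open>Up to commutation every complete merge sequence is the postorder of a tree. The merges
  already read form a forest; the next merge joins the leaf sets of two of its trees, whose
  postorders are moved to the end, where they combine with the merge into the postorder of a larger
  tree.\<close>

lemma vanishes_forest:
  assumes trees: "\<And>T. T \<in> bicolored_trees n i \<Longrightarrow> vanishes (postorder T)"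
    and "distinct (concat (map leaf_labels F))" "set (concat (map leaf_labels F)) = {1..n}"
  shows "vanishes (concat (map postorder F) @ ns)"
  using assms(2,3)
proof (induction ns arbitrary: F)
  case Nil
  show ?case unfolding vanishes_def
  proof
    assume comp: "complete (concat (map postorder F) @ [])"
    have "length (concat (map leaf_labels F)) = n" using distinct_card[OF Nil.prems(1)] Nil.prems(2) by simp
    \<comment> \<open>All \<open>n - 1\<close> merges have been read, and a forest with
      \<open>n\<close> leaves and \<open>n - 1\<close> internal nodes is a single tree.\<close>
    then have "length F = 1" using length_complete[OF comp] length_forest[of F] by simp
    then obtain T where F: "F = [T]" by (cases F) auto
    have c: "complete (postorder T)" using comp by (simp add: F)
    have "total_weight (wp_top n i) = total_weight (wp_bot n) + red_count T"
      using total_weight_final[OF bot_in, of "postorder T"] c by (simp add: complete_def sum_color_weight_postorder)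
    then have "red_count T = i" by (auto simp: total_weight_def wp_top_def wp_bot_def)
    then have "T \<in> bicolored_trees n i" using Nil.prems F by (simp add: bicolored_trees_def)
    from trees[OF this] c show "Poly_Mapping.single (inner (concat (map postorder F) @ [])) 1 \<in> C"
      by (simp add: F vanishes_def)
  qed
next
  case (Cons x ns)
  obtain c A B where x: "x = (c, A, B)" by (cases x)
  show ?case
  proof (cases "complete (concat (map postorder F) @ x # ns)")
    case True
    have bot: "fst ` wp_bot n = (\<lambda>a. {a}) ` set (concat (map leaf_labels F))"
      unfolding Cons.prems(2) wp_bot_def by force
    have "{a} \<in> fst ` wp_bot n" if "a \<in> set (concat (map leaf_labels F))" for a
      unfolding bot using that by (rule imageI)
    from forest_valid[OF bot_in Cons.prems(1) this]
    have "fst ` final (wp_bot n) (concat (map postorder F)) = leaf_set ` set F"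
      unfolding bot by blast
    moreover have "mergeable x (final (wp_bot n) (concat (map postorder F)))"
      using completeD(2)[OF True] by simp
    ultimately have AB: "A \<in> leaf_set ` set F" "B \<in> leaf_set ` set F" "A \<noteq> B" unfolding x by simp_all
    obtain S where S: "S \<in> set F" "A = leaf_set S" using AB(1) by (rule imageE)
    obtain T where T: "T \<in> set F" "B = leaf_set T" using AB(2) by (rule imageE)
    have ST: "S \<in> set F" "T \<in> set F" "A = leaf_set S" "B = leaf_set T" "S \<noteq> T" using S T AB(3) by metis+
    obtain F1 F2 where F: "F = F1 @ T # F2" using split_list[OF ST(2)] by blast
    have "S \<in> set (F1 @ F2)" using ST(1,5) F by simp
    then obtain G1 G2 where G: "F1 @ F2 = G1 @ S # G2" using split_list by metis
    have mset: "mset (concat (map leaf_labels (G1 @ G2 @ [Node c S T]))) = mset (concat (map leaf_labels F))"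
    proof -
      have "mset (concat (map leaf_labels (F1 @ F2))) = mset (concat (map leaf_labels (G1 @ S # G2)))" by (simp only: G)
      then show ?thesis unfolding F by simp
    qed
    have dG: "distinct (concat (map leaf_labels (G1 @ S # G2)))"
      using Cons.prems(1) unfolding G[symmetric] F by auto
    have "vanishes (concat (map postorder (G1 @ G2 @ [Node c S T])) @ ns)"
    proof (rule Cons.IH)
      show "distinct (concat (map leaf_labels (G1 @ G2 @ [Node c S T])))"
        using mset Cons.prems(1) mset_eq_imp_distinct_iff by metis
      show "set (concat (map leaf_labels (G1 @ G2 @ [Node c S T]))) = {1..n}"
        using mset Cons.prems(2) mset_eq_setD by metis
    qed
    then have "vanishes (concat (map postorder (G1 @ G2)) @ postorder S @ postorder T @ x # ns)"
      by (simp add: x ST(3,4))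
    from vanishes_tree_last[OF dG this]
    have "vanishes (concat (map postorder (F1 @ F2)) @ postorder T @ x # ns)" by (simp only: G)
    from vanishes_tree_last[OF Cons.prems(1)[unfolded F] this] show ?thesis by (simp only: F)
  qed (simp add: vanishes_def)
qed

lemma all_vanish:
  assumes "\<And>T. T \<in> lyndon_trees n i \<Longrightarrow> vanishes (postorder T)"
  shows "vanishes ns"
proof -
  have "vanishes (postorder T)" if T: "T \<in> bicolored_trees n i" for T
  proof -
    have d: "distinct (leaf_labels T)" using T by (simp add: bicolored_trees_def)
    let ?Q = "\<lambda>t. distinct (leaf_labels t) \<longrightarrow> vanishes (postorder t)"
    have cl: "rewrite_closed ?Q" unfolding rewrite_closed_def
    proof (intro allI impI)
      fix x ys assume x: "rewrites_to x ys" "\<forall>y\<in>set ys. ?Q y" "distinct (leaf_labels x)"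
      have "vanishes ([] @ postorder y @ [])" if y: "y \<in> set ys" for y
      proof -
        have "distinct (leaf_labels y)" using rewrites_to_labels[OF x(1) y] x(3) mset_eq_imp_distinct_iff by metis
        then show ?thesis using x(2) y by simp
      qed
      from vanishes_rewrite[OF x(1,3) this] show "vanishes (postorder x)" by simp
    qed
    have lyn: "?Q s" if s: "bicolored_lyndon s" "same_type s T" for s
    proof -
      have "mset (leaf_labels s) = mset (leaf_labels T)" "red_count s = red_count T" using s(2) by (simp_all add: same_type_def)
      then have "s \<in> bicolored_trees n i"
        using T mset_eq_imp_distinct_iff[of "leaf_labels s" "leaf_labels T"] mset_eq_setD[of "leaf_labels s" "leaf_labels T"]
        by (simp add: bicolored_trees_def)
      then show ?thesis using assms s(1) by (simp add: lyndon_trees_def)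
    qed
    from straightening[OF d cl lyn] d show ?thesis by blast
  qed
  moreover have "concat (map leaf_labels (map Leaf xs)) = xs" for xs by (induction xs) simp_all
  moreover have "concat (map postorder (map Leaf xs)) = []" for xs by (induction xs) simp_all
  moreover have "set [1..<Suc n] = {1..n}" by auto
  \<comment> \<open>The reading starts from the forest of single leaves, which accounts for no
    merge.\<close>
  ultimately show ?thesis using vanishes_forest[of "map Leaf [1..<Suc n]" ns] distinct_upt by (simp only: append_Nil)
qed

lemma top_chain_in:
  assumes "\<And>T. T \<in> lyndon_trees n i \<Longrightarrow> vanishes (postorder T)" and zs: "zs \<in> chains I lt (int n - 3)"
  shows "Poly_Mapping.single zs 1 \<in> C"
proof -
  have zsI: "set zs \<subseteq> I" and s: "sorted_wrt lt zs" and len: "length zs + 2 = n"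
    using zs n by (auto simp: chains_def)
  have "sorted_wrt lt (whole zs)"
    using zsI s bot_less_top by (auto simp: sorted_wrt_append open_interval_def)
  moreover have "set (whole zs) \<subseteq> P" using whole_in[OF zsI] by blast
  moreover have "card (wp_bot n) = card (last (whole zs)) + length (zs @ [wp_top n i])"
    using len by (simp add: card_wp_bot card_wp_top)
  ultimately obtain ns where ns: "valid_nodes (wp_bot n) ns" "merge_chain (wp_bot n) ns = whole zs"
    using saturated_chain_is_merge_chain by blast
  then have c: "complete ns" using last_merge_chain[of "wp_bot n" ns] by (simp add: complete_def)
  then have "inner ns = zs" using whole_inner[OF c] ns(2) by simp
  then show ?thesis using all_vanish[OF assms(1), of ns] c by (simp add: vanishes_def)
qed

end

section \<open>Top cohomology\<close>

lemma free_module_subset: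
  fixes C :: "('a \<Rightarrow>\<^sub>0 'k::comm_ring_1) set"
  assumes C: "pm_submodule C" and "\<And>x. x \<in> A \<Longrightarrow> Poly_Mapping.single x 1 \<in> C"
  shows "carrier (free_module A) \<subseteq> C"
proof
  fix f :: "'a \<Rightarrow>\<^sub>0 'k" assume f: "f \<in> carrier (free_module A)"
  have "f = (\<Sum>x\<in>Poly_Mapping.keys f. pm_scale (Poly_Mapping.lookup f x) (Poly_Mapping.single x 1))"
  proof (rule poly_mapping_eqI)
    fix y
    have "Poly_Mapping.lookup f y = (\<Sum>x\<in>Poly_Mapping.keys f. if x = y then Poly_Mapping.lookup f x else 0)"
      by (simp add: in_keys_iff)
    then show "Poly_Mapping.lookup f y =
        Poly_Mapping.lookup (\<Sum>x\<in>Poly_Mapping.keys f. pm_scale (Poly_Mapping.lookup f x) (Poly_Mapping.single x 1)) y"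
      by (simp add: lookup_sum lookup_single when_def)
  qed
  also have "\<dots> \<in> C"
    using f by (intro pm_submodule_sum[OF C] pm_submoduleD(3)[OF C] assms(2)) (auto simp: free_module_def)
  finally show "f \<in> C" .
qed

lemma coboundary_superset:
  assumes "finite A" "Poly_Mapping.keys f \<subseteq> A"
  shows "coboundary P lt f = (\<Sum>xs\<in>A. pm_scale (Poly_Mapping.lookup f xs) (coboundary_chain P lt xs))"
  unfolding coboundary_def using assms by (intro sum.mono_neutral_left) (auto simp: in_keys_iff)

lemma coboundary_add: "coboundary P lt (f + g) = coboundary P lt f + coboundary P lt g"
proof -
  let ?A = "Poly_Mapping.keys f \<union> Poly_Mapping.keys g"
  have "coboundary P lt (f + g) = (\<Sum>xs\<in>?A. pm_scale (Poly_Mapping.lookup (f + g) xs) (coboundary_chain P lt xs))"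
    by (intro coboundary_superset keys_add) simp
  also have "\<dots> = coboundary P lt f + coboundary P lt g"
    by (subst (1 2) coboundary_superset[of ?A]) (simp_all add: lookup_add sum.distrib)
  finally show ?thesis .
qed

lemma coboundary_scale: "coboundary P lt (pm_scale c f) = pm_scale c (coboundary P lt f)"
proof -
  have "Poly_Mapping.keys (pm_scale c f) \<subseteq> Poly_Mapping.keys f" by (auto simp: in_keys_iff)
  then show ?thesis
    by (subst coboundary_superset[of "Poly_Mapping.keys f"]) (simp_all add: coboundary_def pm_scale_sum)
qed

lemma coboundary_single: "coboundary P lt (Poly_Mapping.single xs 1) = (coboundary_chain P lt xs :: _ \<Rightarrow>\<^sub>0 'k::comm_ring_1)"
  by (subst coboundary_superset[of "{xs}"]) auto

lemma pm_submodule_coboundaries: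
  "pm_submodule (coboundaries P lt r :: ('a list \<Rightarrow>\<^sub>0 'k::comm_ring_1) set)"
proof -
  let ?Y = "carrier (cochains P lt (r - 1)) :: ('a list \<Rightarrow>\<^sub>0 'k) set"
  have Y: "pm_submodule ?Y" unfolding cochains_def by (rule pm_submodule_free_module)
  show ?thesis unfolding pm_submodule_def coboundaries_def
  proof (intro conjI ballI allI)
    have "coboundary P lt (0 :: 'a list \<Rightarrow>\<^sub>0 'k) = 0" by (simp add: coboundary_def)
    then show "0 \<in> coboundary P lt ` ?Y" using pm_submoduleD(1)[OF Y] by (metis imageI)
    fix x assume "x \<in> coboundary P lt ` ?Y"
    then obtain f where f: "f \<in> ?Y" "x = coboundary P lt f" by blast
    show "pm_scale c x \<in> coboundary P lt ` ?Y" for c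
      using pm_submoduleD(3)[OF Y f(1), of c] unfolding f(2) coboundary_scale[symmetric] by (rule imageI)
    fix y assume "y \<in> coboundary P lt ` ?Y"
    then obtain g where g: "g \<in> ?Y" "y = coboundary P lt g" by blast
    show "x + y \<in> coboundary P lt ` ?Y"
      using pm_submoduleD(2)[OF Y f(1) g(1)] unfolding f(2) g(2) coboundary_add[symmetric] by (rule imageI)
  qed
qed

context max_interval
begin

lemma insert_chain:
  assumes ys: "ys \<in> chains I lt r" and j: "j \<le> length ys" and z: "z \<in> I"
    "0 < j \<Longrightarrow> lt (ys ! (j - 1)) z" "j < length ys \<Longrightarrow> lt z (ys ! j)"
  shows "take j ys @ z # drop j ys \<in> chains I lt (r + 1)"
proof -
  have ysI: "set ys \<subseteq> I" and s: "sorted_wrt lt ys" and len: "int (length ys) = r + 1"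
    using ys by (simp_all add: chains_def)
  have P: "ys ! k \<in> P" if "k < length ys" for k using nth_mem[OF that] ysI I_subset by blast
  have zP: "z \<in> P" using z(1) I_subset by blast
  have before: "lt x z" if x: "x \<in> set (take j ys)" for x
  proof -
    obtain k where k: "k < j" "x = ys ! k" using x j by (auto simp: in_set_conv_nth)
    have jz: "lt (ys ! (j - 1)) z" using z(2) k(1) by simp
    show ?thesis
    proof (cases "k = j - 1")
      case False
      then have "lt (ys ! k) (ys ! (j - 1))" using sorted_wrt_nth_less[OF s, of k "j - 1"] k(1) j by simp
      then show ?thesis using lt_trans[OF P P zP _ jz, of k] k j by simp
    qed (use jz k in simp)
  qed
  have after: "lt z x" if x: "x \<in> set (drop j ys)" for x
  proof -
    obtain k where "k < length (drop j ys)" "x = drop j ys ! k" using x by (metis in_set_conv_nth)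
    then have k: "j + k < length ys" "x = ys ! (j + k)" using j by simp_all
    have jz: "lt z (ys ! j)" using z(3) k(1) by simp
    show ?thesis
    proof (cases "k = 0")
      case False
      then have "lt (ys ! j) (ys ! (j + k))" using sorted_wrt_nth_less[OF s, of j "j + k"] k(1) by simp
      then show ?thesis using lt_trans[OF zP P P jz, of "j + k"] k by simp
    qed (use jz k in simp)
  qed
  have "sorted_wrt lt (take j ys @ drop j ys)" using s by simp
  then have "sorted_wrt lt (take j ys @ z # drop j ys)"
    using before after unfolding sorted_wrt_append by auto
  moreover have "set (take j ys @ z # drop j ys) \<subseteq> I"
    using ysI z(1) set_take_subset[of j ys] set_drop_subset[of j ys] by auto
  ultimately show ?thesis using len j by (simp add: chains_def)
qed

text \<open>With both ends such a chain would have \<open>n + 1\<close> elements and hence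
  \<open>n\<close> drops in the number of blocks, which falls only from \<open>n\<close> to
  1.\<close>

lemma no_longer_chains: "chains I lt (int n - 2) = {}"
proof (rule ccontr)
  assume "chains I lt (int n - 2) \<noteq> {}"
  then obtain zs where zs: "set zs \<subseteq> I" "sorted_wrt lt zs" "length zs + 1 = n"
    using n by (auto simp: chains_def)
  have "sorted_wrt lt (whole zs)"
    using zs bot_less_top by (auto simp: sorted_wrt_append open_interval_def)
  then have "card (last (whole zs)) + length (zs @ [wp_top n i]) \<le> card (wp_bot n)"
    by (rule card_last_le) (use whole_in[OF zs(1)] in blast)
  then show False using zs(3) by (simp add: card_wp_bot card_wp_top)
qed

lemma coboundary_chain_in_free_module:
  assumes "ys \<in> chains I lt r"
  shows "(coboundary_chain I lt ys :: _ \<Rightarrow>\<^sub>0 'k::comm_ring_1) \<in> carrier (free_module (chains I lt (r + 1)))"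
  unfolding coboundary_chain_def
proof (intro pm_submodule_sum pm_submodule_free_module single_in_free_module)
  fix j z assume "j \<in> {0..length ys}"
    "z \<in> {z \<in> I. (0 < j \<longrightarrow> lt (ys ! (j - 1)) z) \<and> (j < length ys \<longrightarrow> lt z (ys ! j))}"
  then show "take j ys @ z # drop j ys \<in> chains I lt (r + 1)" by (intro insert_chain[OF assms]) simp_all
qed

lemma coboundary_top_chain:
  assumes "zs \<in> chains I lt (int n - 3)"
  shows "coboundary_chain I lt zs = (0 :: _ \<Rightarrow>\<^sub>0 'k::comm_ring_1)"
  using coboundary_chain_in_free_module[OF assms, where 'k = 'k] no_longer_chains by (simp add: free_module_def)

lemma proper_tree_chain_eq:
  assumes "T \<in> bicolored_trees n i"
  shows "proper_tree_chain n i T = inner (postorder T)"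
proof -
  note c = complete_postorder[OF assms]
  have "set (inner (postorder T)) \<subseteq> I" using inner_chain[OF c] by (simp add: chains_def)
  then have "\<alpha> \<noteq> wp_bot n \<and> \<alpha> \<noteq> wp_top n i" if "\<alpha> \<in> set (inner (postorder T))" for \<alpha>
    using that by (auto simp: open_interval_def wp_less_def)
  then have "filter (\<lambda>\<alpha>. \<alpha> \<noteq> wp_bot n \<and> \<alpha> \<noteq> wp_top n i) (inner (postorder T)) = inner (postorder T)"
    by (simp add: filter_id_conv)
  then show ?thesis unfolding proper_tree_chain_def tree_chain_def whole_inner[OF c] by simp
qed

theorem lyndon_basis_cohomology:
  "module_basis class_ring (wp_cohomology n i (int n - 3) :: ('k::comm_ring_1, _) module)
     (tree_chain_class n i ` lyndon_trees n i)"
proof -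
  let ?K = "chains I lt (int n - 3)"
  let ?Z = "carrier (free_module ?K) :: (wpartition list \<Rightarrow>\<^sub>0 'k) set"
  let ?N = "coboundaries I lt (int n - 3) :: (wpartition list \<Rightarrow>\<^sub>0 'k) set"
  let ?F = "\<lambda>T. Poly_Mapping.single (proper_tree_chain n i T) (1 :: 'k)"
  let ?C = "combinations ?N ?F (lyndon_trees n i)"
  note N = pm_submodule_coboundaries[of I lt "int n - 3", where 'k = 'k]
  have ne: "wp_bot n \<noteq> wp_top n i" using bot_less_top by (simp add: wp_less_def)
  \<comment> \<open>In the top degree every cochain is a cocycle, as there are no longer
    chains.\<close>
  have cocycles: "cocycles I lt (int n - 3) = ?Z"
  proof -
    have "coboundary I lt f = 0" if f: "f \<in> ?Z" for f
      unfolding coboundary_def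
    proof (rule sum.neutral, rule ballI)
      fix zs assume "zs \<in> Poly_Mapping.keys f"
      then have "zs \<in> ?K" using f by (auto simp: free_module_def)
      then show "pm_scale (Poly_Mapping.lookup f zs) (coboundary_chain I lt zs) = 0" by (simp add: coboundary_top_chain)
    qed
    then show ?thesis by (auto simp: cocycles_def cochains_def)
  qed
  have cohomology: "wp_cohomology n i (int n - 3) = coset_module ?Z ?N"
    unfolding wp_cohomology_def interval_cohomology_def interval_cocycles_def interval_coboundaries_def
      interval_cochains_def if_not_P[OF ne] cocycles
    by (subst quotient_module_eq_coset_module) (simp_all add: cochains_def free_module_def)
  have cls: "tree_chain_class n i = (\<lambda>T. coset ?N (?F T))"
    by (auto simp: fun_eq_iff tree_chain_class_def chain_class_def interval_coboundaries_def interval_cochains_def ne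
        a_r_coset_defs coset_def cochains_def free_module_def)
  have cob: "coboundary_chain I lt ys \<in> ?N" if ys: "ys \<in> chains I lt (int n - 4)" for ys
  proof -
    have "Poly_Mapping.single ys (1 :: 'k) \<in> carrier (cochains I lt (int n - 3 - 1))"
      using ys by (simp add: cochains_def single_in_free_module)
    then show ?thesis unfolding coboundaries_def coboundary_single[symmetric] by (rule imageI)
  qed
  \<comment> \<open>By linearity, properties of coboundaries need only be tested on coboundaries of
    single chains.\<close>
  have N_least: "?N \<subseteq> D" if D: "pm_submodule D" "\<And>ys. ys \<in> chains I lt (int n - 4) \<Longrightarrow> coboundary_chain I lt ys \<in> D" for D
  proof
    fix x assume "x \<in> ?N"
    then obtain f :: "wpartition list \<Rightarrow>\<^sub>0 'k" where f: "f \<in> carrier (free_module (chains I lt (int n - 4)))" "x = coboundary I lt f"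
      by (auto simp: coboundaries_def cochains_def)
    show "x \<in> D" unfolding f(2) coboundary_def
      by (intro pm_submodule_sum[OF D(1)] pm_submoduleD(3)[OF D(1)] D(2)) (use f(1) in \<open>auto simp: free_module_def\<close>)
  qed
  have NZ: "?N \<subseteq> ?Z"
    by (rule N_least[OF pm_submodule_free_module]) (use coboundary_chain_in_free_module[of _ "int n - 4", where 'k = 'k] in simp)
  interpret submodule_pair ?Z ?N
    by unfold_locales (rule pm_submodule_free_module N NZ)+
  \<comment> \<open>With this choice of \<open>C\<close> the Lyndon chains vanish by construction,
    and the conclusion that all top chains vanish is the spanning property.\<close>
  interpret coboundary_submodule n i ?C
    by unfold_locales (use pm_submodule_combinations[OF N] subset_combinations[of ?N] cob in blast)+
  have ly: "T \<in> bicolored_trees n i" "bicolored_lyndon T" "distinct (leaf_labels T)" "set (leaf_labels T) = {1..n}"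
    "mset (leaf_labels T) = mset_set {1..n}"
    if "T \<in> lyndon_trees n i" for T
    using that by (auto simp: lyndon_trees_def bicolored_trees_def mset_set_set[symmetric])
  have len: "length (tree_edges T) = length (postorder T)" for T
    by (rule list_all2_lengthD[OF tree_edges_cross])
  have len_n: "length (tree_edges T) = n - 1" if "T \<in> lyndon_trees n i" for T
    using length_complete[OF complete_postorder[OF ly(1)[OF that]]] by (simp add: len)
  define \<phi> :: "ltree \<Rightarrow> (wpartition list \<Rightarrow>\<^sub>0 'k) \<Rightarrow> 'k" where
    "\<phi> T = linear_ext (\<lambda>zs. chain_weight (tree_edges T) (whole zs))" for T
  have "module_basis class_ring M ((\<lambda>T. coset ?N (?F T)) ` lyndon_trees n i)"
  proof (rule module_basis_cosets[where \<phi> = \<phi> and rank = "\<lambda>T. val (Suc n) (word_of T)"])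
    show "?F T \<in> ?Z" if "T \<in> lyndon_trees n i" for T
      using inner_chain[OF complete_postorder[OF ly(1)[OF that]]]
      unfolding proper_tree_chain_eq[OF ly(1)[OF that]] by (rule single_in_free_module)
    show "?Z \<subseteq> ?C"
    proof (rule free_module_subset[OF pm_submodule_combinations[OF N] top_chain_in])
      fix T assume T: "T \<in> lyndon_trees n i"
      from combinations_base[OF N T, of ?F] show "vanishes (postorder T)"
        unfolding vanishes_def proper_tree_chain_eq[OF ly(1)[OF T]] by blast
    qed
    show "\<phi> T (x + y) = \<phi> T x + \<phi> T y" "\<phi> T (pm_scale c x) = c * \<phi> T x" for T x y c
      by (simp_all add: \<phi>_def linear_ext_add linear_ext_scale)
    show "\<phi> T x = 0" if "T \<in> lyndon_trees n i" "x \<in> ?N" for T x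
    proof -
      have "?N \<subseteq> {x. \<phi> T x = 0}"
      proof (rule N_least)
        show "pm_submodule {x. \<phi> T x = 0}"
          by (simp add: pm_submodule_def \<phi>_def linear_ext_add linear_ext_scale)
        show "coboundary_chain I lt ys \<in> {x. \<phi> T x = 0}" if "ys \<in> chains I lt (int n - 4)" for ys
          using coboundary_weight[OF that len_n[OF \<open>T \<in> lyndon_trees n i\<close>]] by (simp add: \<phi>_def)
      qed
      with that(2) show ?thesis by blast
    qed
    show "\<phi> T (?F T) = 1" if "T \<in> lyndon_trees n i" for T
      using chain_weight_own_edges[OF ly(1)[OF that], where 'k = 'k] proper_tree_chain_eq[OF ly(1)[OF that]]
      by (simp add: \<phi>_def)
    show "S = T \<or> val (Suc n) (word_of S) < val (Suc n) (word_of T)"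
      if S: "S \<in> lyndon_trees n i" and T: "T \<in> lyndon_trees n i" and "\<phi> T (?F S) \<noteq> 0" for S T
    proof (rule tree_triangular)
      have "length (tree_edges T) = length (postorder S)" using len_n[OF S] len_n[OF T] len[of S] by simp
      moreover have "chain_weight (tree_edges T) (whole (inner (postorder S))) \<noteq> (0 :: 'k)"
        using that(3) proper_tree_chain_eq[OF ly(1)[OF S]] by (simp add: \<phi>_def)
      ultimately show "crossed (set (tree_edges T)) nd" if "nd \<in> set (postorder S)" for nd
        using that by (rule crossed_if_chain_weight_nonzero[OF complete_postorder[OF ly(1)[OF S]]])
      show "bounded (Suc n) (word_of T)"
        unfolding bounded_def labels_word_of ly(5)[OF T] by auto
    qed (use ly[OF S] ly[OF T] in auto)
  qed
  then show ?thesis unfolding cls cohomology .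
qed

end

text \<open>The only tree is a single leaf, and its chain without ends is empty. The coefficient of
  the empty list serves as dual functional, and with one index triangularity is trivial.\<close>

lemma lyndon_basis_cohomology_one:
  "module_basis class_ring (wp_cohomology 1 0 (- 2) :: ('k::comm_ring_1, _) module)
     (tree_chain_class 1 0 ` lyndon_trees 1 0)"
proof -
  let ?Z = "carrier (free_module {[]}) :: (wpartition list \<Rightarrow>\<^sub>0 'k) set"
  let ?F = "\<lambda>T. Poly_Mapping.single (proper_tree_chain 1 0 T) (1 :: 'k)"
  have eq: "wp_bot 1 = wp_top 1 0" by (simp add: wp_bot_def wp_top_def)
  have leaf: "T = Leaf 1" if T: "T \<in> lyndon_trees 1 0" for T
  proof -
    have d: "distinct (leaf_labels T)" "set (leaf_labels T) = {1}" using T by (auto simp: lyndon_trees_def bicolored_trees_def)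
    then have "length (leaf_labels T) = 1" using distinct_card[OF d(1)] by simp
    then have "postorder T = []" using length_postorder[of T] by simp
    then show ?thesis using d(2) by (cases T) auto
  qed
  have "Leaf 1 \<in> lyndon_trees 1 0"
    by (simp add: lyndon_trees_def bicolored_trees_def bicolored_lyndon_def normalized_def)
  then have ly: "lyndon_trees 1 0 = {Leaf 1}" using leaf by blast
  have chain: "proper_tree_chain 1 0 (Leaf 1) = []" by (simp add: proper_tree_chain_def tree_chain_def eq)
  have cohomology: "wp_cohomology 1 0 (- 2) = coset_module ?Z {0}"
    unfolding wp_cohomology_def interval_cohomology_def interval_cocycles_def interval_coboundaries_def
      interval_cochains_def if_P[OF eq]
    by (subst quotient_module_eq_coset_module) (simp_all add: free_module_def)
  have cls: "tree_chain_class 1 0 = (\<lambda>T. coset {0} (?F T))"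
    unfolding fun_eq_iff tree_chain_class_def chain_class_def interval_coboundaries_def interval_cochains_def if_P[OF eq]
    by (auto simp: a_r_coset_defs coset_def free_module_def)
  have zero: "pm_submodule {0 :: wpartition list \<Rightarrow>\<^sub>0 'k}" by (simp add: pm_submodule_def)
  interpret submodule_pair ?Z "{0}"
    by unfold_locales (use pm_submodule_free_module zero pm_submoduleD(1) in auto)
  have "module_basis class_ring M ((\<lambda>T. coset {0} (?F T)) ` lyndon_trees 1 0)"
  proof (rule module_basis_cosets[where \<phi> = "\<lambda>_ f. Poly_Mapping.lookup f []" and rank = "\<lambda>_. 0"])
    show "?F T \<in> ?Z" if "T \<in> lyndon_trees 1 0" for T
      using that unfolding leaf[OF that] chain by (intro single_in_free_module) simp
    show "?Z \<subseteq> combinations {0} ?F (lyndon_trees 1 0)"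
    proof (rule free_module_subset[OF pm_submodule_combinations[OF zero]])
      fix zs :: "wpartition list" assume "zs \<in> {[]}"
      then show "Poly_Mapping.single zs 1 \<in> combinations {0} ?F (lyndon_trees 1 0)"
        using combinations_base[OF zero, of "Leaf 1" "lyndon_trees 1 0" ?F] chain ly by simp
    qed
    show "Poly_Mapping.lookup (?F T) [] = 1" if "T \<in> lyndon_trees 1 0" for T
      unfolding leaf[OF that] chain by simp
    show "S = T \<or> (0 :: nat) < 0" if "S \<in> lyndon_trees 1 0" "T \<in> lyndon_trees 1 0" for S T
      using leaf[OF that(1)] leaf[OF that(2)] by metis
  qed (auto simp: lookup_add)
  then show ?thesis unfolding cls cohomology .
qed

theorem lyndon_basis_wp_cohomology:
  assumes "1 \<le> n" "i \<le> n - 1"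
  shows "module_basis class_ring (wp_cohomology n i (int n - 3) :: ('k::comm_ring_1, _) module)
     (tree_chain_class n i ` lyndon_trees n i)"
proof (cases "n = 1")
  case True
  then show ?thesis using assms(2) lyndon_basis_cohomology_one by simp
next
  case False
  then interpret max_interval n i using assms by unfold_locales simp_all
  show ?thesis by (rule lyndon_basis_cohomology)
qed

theorem corollary5p8:
  fixes n i :: nat
  assumes "1 \<le> n" and "i \<le> n - 1"
  shows "module_basis (class_ring :: int ring)
           (wp_cohomology n i (int n - 3)) (tree_chain_class n i ` lyndon_trees n i) \<and>
         module_basis (class_ring :: 'k::field ring)
           (wp_cohomology n i (int n - 3)) (tree_chain_class n i ` lyndon_trees n i) \<and>
         module_basis (class_ring :: 'k::field ring)
           (lie2 n i) (tree_bracket_class n ` lyndon_trees n i)"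
  by (intro conjI lyndon_basis_wp_cohomology lyndon_basis_lie2 assms)

end
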